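(* Let $\mu>0$, let $\{Y_{i,j}:(i,j)\in\mathbb Z_+^2\}$ be i.i.d. random variables with $Y_{i,j}^{-1}\sim\mathrm{Gamma}(\mu)$, and let $(s,t)\in(0,\infty)^2$. Define $$I_{s,t}(r)=\begin{cases}\displaystyle\sup_{\xi\in[0,\mu)}\Big\{r\xi-\inf_{\theta\in(\xi,\mu)}\big(t\,M_\theta(\xi)-s\,M_{\mu-\theta}(-\xi)\big)\Big\}, & r\ge p(s,t),\\[4pt] \infty, & r<p(s,t).\end{cases}$$ Then the distributions of $n^{-1}\log Z_{\lfloor ns\rfloor,\lfloor nt\rfloor}$ satisfy a large deviation principle with normalization $n$ and rate function $I_{s,t}$: for every closed set $F\subseteq\mathbb R$ and every open set $G\subseteq\mathbb R$, $$\limsup_{n\to\infty}n^{-1}\log\mathbb P\{n^{-1}\log Z_{\lfloor ns\rfloor,\lfloor nt\rfloor}\in F\}\le-\inf_{r\in F}I_{s,t}(r)$$ and $$\liminf_{n\to\infty}n^{-1}\log\mathbb P\{n^{-1}\log Z_{\lfloor ns\rfloor,\lfloor nt\rfloor}\in G\}\ge-\inf_{r\in G}I_{s,t}(r).$$ On $[p(s,t),\infty)$ the rate function $I_{s,t}$ is finite, strictly increasing, continuous and convex. In particular, the unique zero of $I_{s,t}(r)$ is at $r=p(s,t)$. The right tail rate $$J_{s,t}(r)=-\lim_{n\to\infty}n^{-1}\log\mathbb P\{\log Z_{\lfloor ns\rfloor,\lfloor nt\rfloor}\ge nr\}$$ is given by $J_{s,t}(r)=0$ for $r\in(-\infty,p(s,t)]$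 and $J_{s,t}(r)=I_{s,t}(r)$ for $r\in[p(s,t),\infty)$.
   Context: $\mathbb Z_+$ denotes the nonnegative integers. $\mathrm{Gamma}(\mu)$ is the distribution on $(0,\infty)$ with density $\Gamma(\mu)^{-1}x^{\mu-1}e^{-x}$. For $\nu>0$, $M_\nu(\xi)=\log\Gamma(\nu-\xi)-\log\Gamma(\nu)$ for $\xi<\nu$ and $M_\nu(\xi)=\infty$ for $\xi\ge\nu$; this is the logarithmic moment generating function of $\log Y$ when $Y^{-1}\sim\mathrm{Gamma}(\nu)$. A directed path from $(0,0)$ to $(m,n)$ is a sequence $x_0=(0,0),x_1,\dots,x_{m+n}=(m,n)$ in $\mathbb Z_+^2$ with each step $x_{k+1}-x_k\in\{(1,0),(0,1)\}$. The point-to-point partition function is $Z_{m,n}=\sum_{x_\cdot}\prod_{j=1}^{m+n}Y_{x_j}$, the sum being over all directed paths from $(0,0)$ to $(m,n)$. The limiting free energy is the almost sure limit $p(s,t)=\lim_{n\to\infty}n^{-1}\log Z_{\lfloor ns\rfloor,\lfloor nt\rfloor}$, a finite constant, equal to $\inf_{0<\rho<\mu}\{-s\Psi_0(\rho)-t\Psi_0(\mu-\rho)\}$, where $\Psi_0=\Gamma'/\Gamma$ is the digamma function. *)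

theory Defs
  imports "HOL-Probability.Probability"
begin

definition gamma_density :: "real \<Rightarrow> real \<Rightarrow> real" where
  "gamma_density \<mu> x = (if 0 < x then x powr (\<mu> - 1) * exp (- x) / Gamma \<mu> else 0)"

definition inverse_gamma_weights :: "'w measure \<Rightarrow> real \<Rightarrow> (nat \<times> nat \<Rightarrow> 'w \<Rightarrow> real) \<Rightarrow> bool" where
  "inverse_gamma_weights M \<mu> Y \<longleftrightarrow>
     prob_space.indep_vars M (\<lambda>_. borel) Y UNIV \<and>
     (\<forall>v. distributed M lborel (\<lambda>\<omega>. inverse (Y v \<omega>)) (\<lambda>x. ennreal (gamma_density \<mu> x)))"

text \<open>A path is the list of all its vertices, including the starting point; addition on pairs is
  componentwise.\<close>

definition directed_paths :: "nat \<Rightarrow> nat \<Rightarrow> (nat \<times> nat) list set" where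
  "directed_paths m n =
     {xs. length xs = m + n + 1 \<and> xs ! 0 = (0, 0) \<and> xs ! (m + n) = (m, n) \<and>
        (\<forall>k<m + n. xs ! Suc k \<in> {xs ! k + (1, 0), xs ! k + (0, 1)})}"

text \<open>The weight at the origin is excluded from the product.\<close>

definition partition_function :: "(nat \<times> nat \<Rightarrow> real) \<Rightarrow> nat \<Rightarrow> nat \<Rightarrow> real" where
  "partition_function y m n = (\<Sum>xs\<in>directed_paths m n. \<Prod>j=1..m + n. y (xs ! j))"

definition log_Z :: "(nat \<times> nat \<Rightarrow> 'w \<Rightarrow> real) \<Rightarrow> real \<Rightarrow> real \<Rightarrow> nat \<Rightarrow> 'w \<Rightarrow> real" where
  "log_Z Y s t n \<omega> =
     ln (partition_function (\<lambda>v. Y v \<omega>) (nat \<lfloor>real n * s\<rfloor>) (nat \<lfloor>real n * t\<rfloor>))"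

text \<open>The constant to which the normalized log partition functions converge almost surely. On a
  probability space there is at most one such constant.\<close>

definition free_energy :: "'w measure \<Rightarrow> (nat \<times> nat \<Rightarrow> 'w \<Rightarrow> real) \<Rightarrow> real \<Rightarrow> real \<Rightarrow> real" where
  "free_energy M Y s t =
     (THE c. AE \<omega> in M. (\<lambda>n. log_Z Y s t n \<omega> / real n) \<longlonglongrightarrow> c)"

definition log_mgf :: "real \<Rightarrow> real \<Rightarrow> ereal" where
  "log_mgf \<nu> \<xi> = (if \<xi> < \<nu> then ereal (ln (Gamma (\<nu> - \<xi>)) - ln (Gamma \<nu>)) else \<infinity>)"

text \<open>The argument \<open>p\<close> stands for the limiting free energy.\<close>

definition rate_function :: "real \<Rightarrow> real \<Rightarrow> real \<Rightarrow> real \<Rightarrow> real \<Rightarrow> ereal" where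
  "rate_function \<mu> s t p r =
     (if p \<le> r
      then (SUP \<xi>\<in>{0..<\<mu>}. ereal (r * \<xi>) -
              (INF \<theta>\<in>{\<xi><..<\<mu>}. ereal t * log_mgf \<theta> \<xi> - ereal s * log_mgf (\<mu> - \<theta>) (- \<xi>)))
      else \<infinity>)"

text \<open>Logarithm of a probability, with \<open>log 0 = -\<infinity>\<close>; the library's real \<open>ln 0 = 0\<close> would be wrong
  here.\<close>

definition log_prob :: "'w measure \<Rightarrow> 'w set \<Rightarrow> ereal" where
  "log_prob M A = (if measure M A = 0 then -\<infinity> else ereal (ln (measure M A)))"

definition satisfies_LDP :: "'w measure \<Rightarrow> (nat \<Rightarrow> 'w \<Rightarrow> real) \<Rightarrow> (real \<Rightarrow> ereal) \<Rightarrow> bool" where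
  "satisfies_LDP M X I \<longleftrightarrow>
     (\<forall>F. closed F \<longrightarrow>
        limsup (\<lambda>n. ereal (1 / real n) * log_prob M {\<omega> \<in> space M. X n \<omega> \<in> F}) \<le> - (INF r\<in>F. I r)) \<and>
     (\<forall>G. open G \<longrightarrow>
        liminf (\<lambda>n. ereal (1 / real n) * log_prob M {\<omega> \<in> space M. X n \<omega> \<in> G}) \<ge> - (INF r\<in>G. I r))"

definition right_tail_seq ::
    "'w measure \<Rightarrow> (nat \<times> nat \<Rightarrow> 'w \<Rightarrow> real) \<Rightarrow> real \<Rightarrow> real \<Rightarrow> real \<Rightarrow> nat \<Rightarrow> ereal" where
  "right_tail_seq M Y s t r n =
     ereal (1 / real n) * log_prob M {\<omega> \<in> space M. log_Z Y s t n \<omega> \<ge> real n * r}"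

definition right_tail_rate ::
    "'w measure \<Rightarrow> (nat \<times> nat \<Rightarrow> 'w \<Rightarrow> real) \<Rightarrow> real \<Rightarrow> real \<Rightarrow> real \<Rightarrow> ereal" where
  "right_tail_rate M Y s t r = - lim (right_tail_seq M Y s t r)"

end

theory Submission
  imports Defs "HOL-Real_Asymp.Real_Asymp"
begin

text \<open>The proof rests on one exact moment formula. Put inverse gamma weights with parameter \<open>z\<close> on the
  vertical axis and with parameter \<open>\<mu> - z + \<xi>\<close> on the horizontal axis. Up to the tilt by the
  \<open>\<xi>\<close>-th power of the horizontal weights this is the stationary model, so the Burke property gives
  the \<open>\<xi>\<close>-th moment of its partition function as an explicit exponential with rate
  \<open>t M\<^sub>z(\<xi>) - s M\<^bsub>\<mu>-z\<^esub>(-\<xi>)\<close>. Paths that leave the axis at once bound the moments of the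
  original model from above for every \<open>z\<close>. Conversely, at a critical \<open>z\<close> a small change of \<open>z\<close>
  costs only second order but makes exits far from the origin negligible to first order, which
  yields matching lower bounds; the same argument with vanishing \<open>\<xi>\<close> gives the law of large numbers
  from below. Chernoff bounds and tilting turn the moment asymptotics into the right tail. The left
  tail decays faster than exponentially, because many disjoint lanes of independent
  blocks would all have to be atypically small.

  In the rate function the bracket is \<open>h(z - \<xi>) - h(z)\<close> with
  \<open>h(x) = t log \<Gamma>(x) - s log \<Gamma>(\<mu> - x)\<close>, and \<open>- h'\<close> is the function whose minimum is the free
  energy.\<close>

section \<open>The partition function as a recursion in the log-weights\<close>

text \<open>The obstacle is that exits are not localised at first. If the contribution of an exit is
  bounded with the parameter \<open>z0\<close> of the axes themselves, the bound equals the whole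
  boundary moment up to a constant, whatever the distance k of the exit. Only a bound at a different
  parameter loses a factor exponential in k. Exits within \<epsilon>N of the origin then cost
  exp(O(\<epsilon>N)), with \<epsilon> small against the allowed error.

  Sharp moment asymptotics are used only at pairs (\<xi>, z) that maximise the objective for some r.
  There \<open>phi\<close> equals r at both z - \<xi> and z: equality of the two values is
  criticality in z, and the common value is the derivative in \<xi>, which centres the tilted
  measure at r. Regularity of a limiting moment function never enters.

  The existence of the free energy is a conclusion: both tails are summable. The law of large
  numbers from below feeds only the left tail.

  Environments consist of log-weights, so partition functions are positive and the Burke map is
  defined everywhere; the almost sure relation to the given weights enters at the very end.\<close>

fun Zrec :: "(nat \<times> nat \<Rightarrow> real) \<Rightarrow> nat \<Rightarrow> nat \<Rightarrow> real" where
  "Zrec w 0 0 = 1"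
| "Zrec w (Suc m) 0 = exp (w (Suc m, 0)) * Zrec w m 0"
| "Zrec w 0 (Suc n) = exp (w (0, Suc n)) * Zrec w 0 n"
| "Zrec w (Suc m) (Suc n) = exp (w (Suc m, Suc n)) * (Zrec w m (Suc n) + Zrec w (Suc m) n)"

definition shift_env :: "nat \<Rightarrow> nat \<Rightarrow> (nat \<times> nat \<Rightarrow> 'a) \<Rightarrow> nat \<times> nat \<Rightarrow> 'a" where
  "shift_env a b w v = w (a + fst v, b + snd v)"

lemma shift_env_apply [simp]: "shift_env a b w (i, j) = w (a + i, b + j)"
  by (simp add: shift_env_def)

lemma Zrec_pos [simp]: "Zrec w m n > 0"
  by (induction w m n rule: Zrec.induct) (auto intro: add_pos_pos)

lemma Zrec_nonneg [simp]: "Zrec w m n \<ge> 0"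
  using Zrec_pos[of w m n] by linarith

lemma Zrec_neq_0 [simp]: "Zrec w m n \<noteq> 0"
  using Zrec_pos[of w m n] by linarith

lemma Zrec_cong:
  "(\<And>i j. i \<le> m \<Longrightarrow> j \<le> n \<Longrightarrow> (i, j) \<noteq> (0, 0) \<Longrightarrow> w (i, j) = w' (i, j)) \<Longrightarrow> Zrec w m n = Zrec w' m n"
  by (induction w m n rule: Zrec.induct) auto

lemma Zrec_right: "Zrec w (Suc m) n \<ge> exp (w (Suc m, n)) * Zrec w m n"
  by (cases n) auto

lemma Zrec_up: "Zrec w m (Suc n) \<ge> exp (w (m, Suc n)) * Zrec w m n"
  by (cases m) auto

text \<open>Keep only the paths through (a, b). The weight there is counted once, because a
  partition function omits the weight at its own starting point.\<close>

lemma Zrec_supermult: "Zrec w a b * Zrec (shift_env a b w) i j \<le> Zrec w (a + i) (b + j)"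
proof (induction "shift_env a b w" i j rule: Zrec.induct)
  case (2 m)
  have "Zrec w a b * Zrec (shift_env a b w) (Suc m) 0 = exp (w (a + Suc m, b)) * (Zrec w a b * Zrec (shift_env a b w) m 0)"
    by simp
  also have "\<dots> \<le> exp (w (a + Suc m, b)) * Zrec w (a + m) b"
    using 2 by (intro mult_left_mono) auto
  also have "\<dots> \<le> Zrec w (a + Suc m) b"
    using Zrec_right[of w "a + m" b] by simp
  finally show ?case by simp
next
  case (3 n)
  have "Zrec w a b * Zrec (shift_env a b w) 0 (Suc n) = exp (w (a, b + Suc n)) * (Zrec w a b * Zrec (shift_env a b w) 0 n)"
    by simp
  also have "\<dots> \<le> exp (w (a, b + Suc n)) * Zrec w a (b + n)"
    using 3 by (intro mult_left_mono) auto
  also have "\<dots> \<le> Zrec w a (b + Suc n)"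
    using Zrec_up[of w a "b + n"] by simp
  finally show ?case by simp
next
  case (4 m n)
  have "Zrec w a b * Zrec (shift_env a b w) (Suc m) (Suc n) = exp (w (a + Suc m, b + Suc n)) *
     (Zrec w a b * Zrec (shift_env a b w) m (Suc n) + Zrec w a b * Zrec (shift_env a b w) (Suc m) n)"
    by (simp add: algebra_simps)
  also have "\<dots> \<le> exp (w (a + Suc m, b + Suc n)) * (Zrec w (a + m) (b + Suc n) + Zrec w (a + Suc m) (b + n))"
    using 4 by (intro mult_left_mono add_mono) auto
  also have "\<dots> = Zrec w (a + Suc m) (b + Suc n)" by simp
  finally show ?case .
qed simp

section \<open>Decompositions by the place where a path leaves an axis\<close>

lemma Zrec_transpose: "Zrec (w \<circ> prod.swap) n m = Zrec w m n"
  by (induction w m n rule: Zrec.induct) (auto simp: algebra_simps)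

text \<open>A path leaves column 0 at exactly one height k. Peeling off its last vertex needs the
  identity at both predecessors, hence the induction on \<open>m + n\<close>.\<close>

lemma Zrec_column_crossing:
  "Zrec w (Suc m) n = (\<Sum>k\<le>n. Zrec w 0 k * exp (w (1, k)) * Zrec (shift_env 1 k w) m (n - k))"
proof (induction "m + n" arbitrary: m n rule: less_induct)
  case less
  show ?case
  proof (cases n)
    case 0
    show ?thesis
    proof (cases m)
      case (Suc m')
      show ?thesis using less[of m' 0] Suc 0 by (simp add: algebra_simps)
    qed (simp add: 0)
  next
    case n: (Suc n')
    have IHn: "Zrec w (Suc m) n' = (\<Sum>k\<le>n'. Zrec w 0 k * exp (w (1, k)) * Zrec (shift_env 1 k w) m (n' - k))"
      using less[of m n'] n by simp
    show ?thesis
    proof (cases m)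
      case 0
      have "Zrec w (Suc m) n = exp (w (1, n)) * (Zrec w 0 n + Zrec w 1 n')"
        using 0 n by simp
      also have "\<dots> = Zrec w 0 n * exp (w (1, n)) +
         (\<Sum>k\<le>n'. Zrec w 0 k * exp (w (1, k)) * (exp (w (1, n)) * Zrec (shift_env 1 k w) 0 (n' - k)))"
        using IHn 0 by (simp add: algebra_simps sum_distrib_left)
      also have "(\<Sum>k\<le>n'. Zrec w 0 k * exp (w (1, k)) * (exp (w (1, n)) * Zrec (shift_env 1 k w) 0 (n' - k)))
         = (\<Sum>k\<le>n'. Zrec w 0 k * exp (w (1, k)) * Zrec (shift_env 1 k w) 0 (n - k))"
        using n by (intro sum.cong refl) (auto simp: Suc_diff_le)
      finally show ?thesis using 0 n by simp
    next
      case m: (Suc m')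
      have IHm: "Zrec w (Suc m') n = (\<Sum>k\<le>n. Zrec w 0 k * exp (w (1, k)) * Zrec (shift_env 1 k w) m' (n - k))"
        using less[of m' n] m by simp
      have "Zrec w (Suc m) n = exp (w (Suc m, n)) * (Zrec w (Suc m') n + Zrec w (Suc m) n')"
        using m n by simp
      also have "\<dots> = (\<Sum>k\<le>n'. Zrec w 0 k * exp (w (1, k)) * (exp (w (Suc m, n)) *
            (Zrec (shift_env 1 k w) m' (n - k) + Zrec (shift_env 1 k w) m (n' - k)))) +
          Zrec w 0 n * exp (w (1, n)) * (exp (w (Suc m, n)) * Zrec (shift_env 1 n w) m' 0)"
        unfolding IHm IHn using n by (simp add: algebra_simps sum_distrib_left sum.distrib)
      also have "(\<Sum>k\<le>n'. Zrec w 0 k * exp (w (1, k)) * (exp (w (Suc m, n)) *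
            (Zrec (shift_env 1 k w) m' (n - k) + Zrec (shift_env 1 k w) m (n' - k)))) =
          (\<Sum>k\<le>n'. Zrec w 0 k * exp (w (1, k)) * Zrec (shift_env 1 k w) m (n - k))"
        using n m by (intro sum.cong refl) (auto simp: Suc_diff_le)
      finally show ?thesis using n m by simp
    qed
  qed
qed

lemma Zrec_row_crossing:
  "Zrec w m (Suc n) = (\<Sum>k\<le>m. Zrec w k 0 * exp (w (k, 1)) * Zrec (shift_env k 1 w) (m - k) n)"
proof -
  have *: "shift_env 1 k (w \<circ> prod.swap) = shift_env k 1 w \<circ> prod.swap" for k
    by (auto simp: fun_eq_iff)
  have "Zrec w m (Suc n) = Zrec (w \<circ> prod.swap) (Suc n) m"
    by (simp only: Zrec_transpose)
  also have "\<dots> = (\<Sum>k\<le>m. Zrec w k 0 * exp (w (k, 1)) * Zrec (shift_env k 1 w) (m - k) n)"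
    by (subst Zrec_column_crossing, unfold * Zrec_transpose) simp
  finally show ?thesis .
qed

lemma Zrec_bottom: "Zrec w (Suc k) 0 = exp (w (1, 0)) * Zrec (shift_env 1 0 w) k 0"
  by (induction k) auto

lemma Zrec_exit:
  "Zrec w (Suc m) (Suc n) =
     (\<Sum>k\<le>n. Zrec w 0 (Suc k) * exp (w (1, Suc k)) * Zrec (shift_env 1 (Suc k) w) m (n - k)) +
     (\<Sum>k\<le>m. Zrec w (Suc k) 0 * exp (w (Suc k, 1)) * Zrec (shift_env (Suc k) 1 w) (m - k) n)"
proof -
  have sh: "shift_env k 1 (shift_env 1 0 w) = shift_env (Suc k) 1 w" for k
    by (auto simp: fun_eq_iff)
  \<comment> \<open>The term k = 0 collects the paths whose first step is horizontal; they are
    expanded along the bottom row instead.\<close>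
  have "Zrec w (Suc m) (Suc n) = exp (w (1, 0)) * Zrec (shift_env 1 0 w) m (Suc n) +
     (\<Sum>k\<le>n. Zrec w 0 (Suc k) * exp (w (1, Suc k)) * Zrec (shift_env 1 (Suc k) w) m (n - k))"
    by (subst Zrec_column_crossing, subst sum.atMost_Suc_shift) simp
  also have "exp (w (1, 0)) * Zrec (shift_env 1 0 w) m (Suc n) =
    (\<Sum>k\<le>m. Zrec w (Suc k) 0 * exp (w (Suc k, 1)) * Zrec (shift_env (Suc k) 1 w) (m - k) n)"
    by (subst Zrec_row_crossing) (simp add: sh[unfolded One_nat_def] sum_distrib_left Zrec_bottom algebra_simps del: Zrec.simps(2))
  finally show ?thesis by simp
qed

text \<open>To the right of a column the recursion sees that column only through the values on it,
  so a constant factor between two boundaries propagates. Column 1 can thus serve as the left axis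
  of a smaller rectangle.\<close>

lemma Zrec_new_boundary:
  assumes "\<And>j. j \<le> n \<Longrightarrow> Zrec w 1 j = C * Zrec w' 0 j"
    and "\<And>i j. j \<le> n \<Longrightarrow> w' (Suc i, j) = w (Suc (Suc i), j)"
  shows "j \<le> n \<Longrightarrow> Zrec w (Suc m) j = C * Zrec w' m j"
proof (induction m arbitrary: j)
  case 0 then show ?case using assms by simp
next
  case (Suc m)
  show ?case using Suc.prems
  proof (induction j)
    case 0 then show ?case using Suc.IH[of 0] assms(2)[of 0 m] by (simp add: algebra_simps)
  next
    case (Suc j) then show ?case using Suc.IH \<open>\<And>j. j \<le> n \<Longrightarrow> Zrec w (Suc m) j = C * Zrec w' m j\<close>[of "Suc j"] assms(2)[of "Suc j" m]
      by (simp add: algebra_simps)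
  qed
qed

text \<open>One step of the column-to-column recursion: the horizontal ratio in coordinate \<open>(1, 0)\<close> and
  the vertical ratio in \<open>(0, j)\<close> enter the vertex \<open>(1, j)\<close>; the new horizontal ratio replaces the
  old one and the new vertical ratio replaces the weight of the vertex.\<close>

definition vertex_step :: "nat \<Rightarrow> (nat \<times> nat \<Rightarrow> real) \<Rightarrow> nat \<times> nat \<Rightarrow> real" where
  "vertex_step j w = w ((1, 0) := w (1, j) + ln (1 + exp (w (1, 0) - w (0, j))),
                        (1, j) := w (1, j) + ln (1 + exp (w (0, j) - w (1, 0))))"

primrec column_step :: "nat \<Rightarrow> (nat \<times> nat \<Rightarrow> real) \<Rightarrow> nat \<times> nat \<Rightarrow> real" where
  "column_step 0 w = w"
| "column_step (Suc n) w = vertex_step (Suc n) (column_step n w)"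

lemma exp_add_ln_1_plus_exp: "exp (a + ln (1 + exp (b - c))) = exp a * (1 + exp b / exp (c::real))"
proof -
  have "exp (ln (1 + exp (b - c))) = 1 + exp (b - c)"
    by (rule exp_ln) (simp add: add_pos_pos)
  then show ?thesis by (simp add: exp_add exp_diff)
qed

text \<open>Dividing the recursion at (1, j) by \<open>Zrec w 0 j\<close> or by
  \<open>Zrec w 1 (j - 1)\<close> gives the two updates of \<open>vertex_step\<close>. Coordinate
  (1, 0) starts as the horizontal ratio at height 0 and carries this ratio upwards, while each bulk
  weight of column 1 is overwritten by a vertical ratio.\<close>

lemma column_step_values:
  "exp (column_step n w (1, 0)) = Zrec w 1 n / Zrec w 0 n \<and>
   (\<forall>j. 1 \<le> j \<and> j \<le> n \<longrightarrow> exp (column_step n w (1, j)) = Zrec w 1 j / Zrec w 1 (j - 1)) \<and>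
   (\<forall>i j. i \<noteq> 1 \<or> n < j \<longrightarrow> column_step n w (i, j) = w (i, j))"
proof (induction n)
  case (Suc n)
  let ?c = "column_step n w"
  have IH: "exp (?c (1, 0)) = Zrec w 1 n / Zrec w 0 n"
    "\<And>j. 1 \<le> j \<Longrightarrow> j \<le> n \<Longrightarrow> exp (?c (1, j)) = Zrec w 1 j / Zrec w 1 (j - 1)"
    "\<And>i j. i \<noteq> 1 \<or> n < j \<Longrightarrow> ?c (i, j) = w (i, j)"
    using Suc by auto
  have z: "exp (w (0, Suc n)) = Zrec w 0 (Suc n) / Zrec w 0 n" by simp
  have 1: "exp (column_step (Suc n) w (1, 0)) = Zrec w 1 (Suc n) / Zrec w 0 (Suc n)"
    unfolding column_step.simps vertex_step_def
    by (simp add: exp_add_ln_1_plus_exp IH(1)[unfolded One_nat_def] IH(3) del: exp_le_cancel_iff)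
      (simp add: field_simps)
  have 2: "exp (column_step (Suc n) w (1, Suc n)) = Zrec w 1 (Suc n) / Zrec w 1 n"
    unfolding column_step.simps vertex_step_def
    by (simp add: exp_add_ln_1_plus_exp IH(1)[unfolded One_nat_def] IH(3) del: exp_le_cancel_iff)
      (simp add: field_simps)
  have 3: "exp (column_step (Suc n) w (1, j)) = Zrec w 1 j / Zrec w 1 (j - 1)" if "1 \<le> j" "j \<le> Suc n" for j
    using that 2 IH(2)[of j] by (cases "j = Suc n") (auto simp: vertex_step_def)
  show ?case using 1 3 IH(3) by (auto simp: vertex_step_def)
qed auto

text \<open>Once the first horizontal weight is factored out, the vertical ratios of column 1 act as
  the weights of a new left axis. The horizontal ratio stored in (1, 0) sits at the new origin,
  whose weight a partition function omits.\<close>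

lemma Zrec_column_step:
  "Zrec w (Suc m) n = exp (w (1, 0)) * Zrec (shift_env 1 0 (column_step n w)) m n"
proof (rule Zrec_new_boundary[where n = n])
  show "Zrec w 1 j = exp (w (1, 0)) * Zrec (shift_env 1 0 (column_step n w)) 0 j" if "j \<le> n" for j
    using that
  proof (induction j)
    case (Suc j)
    have "exp (column_step n w (1, Suc j)) = Zrec w 1 (Suc j) / Zrec w 1 j"
      using column_step_values[of n w] Suc.prems by auto
    then show ?case using Suc by (simp add: field_simps)
  qed simp
  show "shift_env 1 0 (column_step n w) (Suc i, j) = w (Suc (Suc i), j)" if "j \<le> n" for i j
    using column_step_values[of n w] by auto
qed simp

section \<open>Path sums satisfy the recursion\<close>

lemma directed_paths_0: "directed_paths 0 0 = {[(0, 0)]}"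
  by (auto simp: directed_paths_def length_Suc_conv)

lemma directed_paths_snoc:
  assumes "m + n = Suc L"
  shows "xs @ [v] \<in> directed_paths m n \<longleftrightarrow> v = (m, n) \<and> length xs = Suc L \<and> xs ! 0 = (0, 0) \<and>
     (\<forall>k<L. xs ! Suc k \<in> {xs ! k + (1, 0), xs ! k + (0, 1)}) \<and>
     (m, n) \<in> {xs ! L + (1, 0), xs ! L + (0, 1)}"
  unfolding directed_paths_def mem_Collect_eq assms All_less_Suc
  by (auto simp: nth_append)

lemma directed_paths_Suc_0:
  "directed_paths (Suc m) 0 = (\<lambda>xs. xs @ [(Suc m, 0)]) ` directed_paths m 0" (is "?A = ?B")
proof (rule set_eqI)
  fix ys
  show "ys \<in> ?A \<longleftrightarrow> ys \<in> ?B"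
  proof (cases ys rule: rev_cases)
    case (snoc xs v)
    show ?thesis unfolding snoc
      by (subst directed_paths_snoc[where L = m])
        (auto simp: image_iff directed_paths_def prod_eq_iff)
  qed (auto simp: directed_paths_def)
qed

lemma directed_paths_0_Suc:
  "directed_paths 0 (Suc n) = (\<lambda>xs. xs @ [(0, Suc n)]) ` directed_paths 0 n" (is "?A = ?B")
proof (rule set_eqI)
  fix ys
  show "ys \<in> ?A \<longleftrightarrow> ys \<in> ?B"
  proof (cases ys rule: rev_cases)
    case (snoc xs v)
    show ?thesis unfolding snoc
      by (subst directed_paths_snoc[where L = n])
        (auto simp: image_iff directed_paths_def prod_eq_iff)
  qed (auto simp: directed_paths_def)
qed

lemma directed_paths_Suc_Suc:
  "directed_paths (Suc m) (Suc n) =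
     (\<lambda>xs. xs @ [(Suc m, Suc n)]) ` (directed_paths m (Suc n) \<union> directed_paths (Suc m) n)" (is "?A = ?B")
proof (rule set_eqI)
  fix ys
  show "ys \<in> ?A \<longleftrightarrow> ys \<in> ?B"
  proof (cases ys rule: rev_cases)
    case (snoc xs v)
    show ?thesis unfolding snoc
      by (subst directed_paths_snoc[where L = "Suc (m + n)"])
        (auto simp: image_iff directed_paths_def prod_eq_iff)
  qed (auto simp: directed_paths_def)
qed

lemma sum_snoc_paths:
  assumes "\<And>xs. xs \<in> A \<Longrightarrow> length xs = Suc L"
  shows "(\<Sum>xs\<in>(\<lambda>xs. xs @ [v]) ` A. \<Prod>j=1..Suc L. y (xs ! j)) = y v * (\<Sum>xs\<in>A. \<Prod>j=1..L. (y (xs ! j) :: real))"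
proof -
  have "(\<Sum>xs\<in>(\<lambda>xs. xs @ [v]) ` A. \<Prod>j=1..Suc L. y (xs ! j)) = (\<Sum>xs\<in>A. \<Prod>j=1..Suc L. y ((xs @ [v]) ! j))"
    by (subst sum.reindex) (auto simp: inj_on_def)
  also have "\<dots> = (\<Sum>xs\<in>A. y v * (\<Prod>j=1..L. y (xs ! j)))"
    using assms by (intro sum.cong refl) (auto simp: nth_append intro!: prod.cong)
  finally show ?thesis by (simp add: sum_distrib_left)
qed

lemma finite_directed_paths: "finite (directed_paths m n)"
  by (induction "\<lambda>_::nat \<times> nat. 0::real" m n rule: Zrec.induct)
    (auto simp: directed_paths_0 directed_paths_Suc_0 directed_paths_0_Suc directed_paths_Suc_Suc)

lemma partition_function_eq_Zrec:
  "partition_function (\<lambda>v. exp (w v)) m n = Zrec w m n"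
proof (induction w m n rule: Zrec.induct)
  case (1 w) then show ?case by (simp add: partition_function_def directed_paths_0)
next
  case (2 w m) then show ?case
    unfolding partition_function_def directed_paths_Suc_0
    by (simp only: add_Suc Zrec.simps, subst sum_snoc_paths) (auto simp: directed_paths_def)
next
  case (3 w n) then show ?case
    unfolding partition_function_def directed_paths_0_Suc
    by (simp only: add_Suc_right Zrec.simps, subst sum_snoc_paths) (auto simp: directed_paths_def)
next
  case (4 w m n)
  have "xs ! (m + Suc n) = (m, Suc n)" if "xs \<in> directed_paths m (Suc n)" for xs
    using that by (auto simp: directed_paths_def)
  moreover have "xs ! (m + Suc n) = (Suc m, n)" if "xs \<in> directed_paths (Suc m) n" for xs
    using that by (auto simp: directed_paths_def)
  ultimately have disj: "directed_paths m (Suc n) \<inter> directed_paths (Suc m) n = {}"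
    by fastforce
  have "partition_function (\<lambda>v. exp (w v)) (Suc m) (Suc n) =
     (\<Sum>xs\<in>(\<lambda>xs. xs @ [(Suc m, Suc n)]) ` (directed_paths m (Suc n) \<union> directed_paths (Suc m) n).
        \<Prod>j=1..Suc (Suc (m + n)). exp (w (xs ! j)))"
    unfolding partition_function_def directed_paths_Suc_Suc by simp
  also have "\<dots> = exp (w (Suc m, Suc n)) * (\<Sum>xs\<in>directed_paths m (Suc n) \<union> directed_paths (Suc m) n.
        \<Prod>j=1..Suc (m + n). exp (w (xs ! j)))"
    by (rule sum_snoc_paths) (auto simp: directed_paths_def)
  also have "\<dots> = exp (w (Suc m, Suc n)) * (partition_function (\<lambda>v. exp (w v)) m (Suc n) + partition_function (\<lambda>v. exp (w v)) (Suc m) n)"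
    by (subst sum.union_disjoint[OF finite_directed_paths finite_directed_paths disj])
      (simp add: partition_function_def)
  finally show ?case using 4 by simp
qed

section \<open>Gamma variables and the Burke property\<close>

lemma Gamma_real_nonzero: "x > 0 \<Longrightarrow> Gamma (x::real) \<noteq> 0"
  by (metis Gamma_real_pos less_irrefl)

lemma gamma_density_measurable [measurable]: "gamma_density \<nu> \<in> borel_measurable borel"
  unfolding gamma_density_def [abs_def] by measurable

lemma gamma_density_nonneg [simp]: "\<nu> > 0 \<Longrightarrow> gamma_density \<nu> x \<ge> 0"
  by (auto simp: gamma_density_def intro!: divide_nonneg_pos Gamma_real_pos)

lemma nn_integral_gamma_density:
  assumes "\<nu> > 0"
  shows "(\<integral>\<^sup>+x. ennreal (gamma_density \<nu> x) \<partial>lborel) = 1"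
proof -
  have "(\<integral>\<^sup>+x. ennreal (gamma_density \<nu> x) \<partial>lborel) =
    (\<integral>\<^sup>+x. ennreal (1 / Gamma \<nu>) * ennreal (indicator {0..} x * x powr (\<nu> - 1) / exp x) \<partial>lborel)"
    by (intro nn_integral_cong_AE eventually_mono[OF AE_lborel_singleton[of 0]])
      (use Gamma_real_pos[OF assms] in \<open>auto simp: gamma_density_def indicator_def exp_minus field_simps ennreal_mult'[symmetric]\<close>)
  also have "\<dots> = ennreal (1 / Gamma \<nu>) * ennreal (Gamma \<nu>)"
    using assms by (subst nn_integral_cmult) (auto simp: Gamma_conv_nn_integral_real)
  also have "\<dots> = 1"
    using Gamma_real_pos[OF assms] by (simp add: ennreal_mult'[symmetric])
  finally show ?thesis .
qed

section \<open>Beta-gamma algebra\<close>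

definition beta_weight :: "real \<Rightarrow> real \<Rightarrow> real \<Rightarrow> real" where
  "beta_weight a b \<beta> = (if 0 < \<beta> \<and> \<beta> < 1
     then \<beta> powr (a - 1) * (1 - \<beta>) powr (b - 1) * Gamma (a + b) / (Gamma a * Gamma b) else 0)"

lemma beta_weight_measurable [measurable]: "beta_weight a b \<in> borel_measurable borel"
  unfolding beta_weight_def [abs_def] by measurable

text \<open>The factor s is the Jacobian of the map from (\<beta>, s) to (s\<beta>, s - s\<beta>).
  For \<beta> outside (0, 1) one of the two arguments is nonpositive and both sides vanish.\<close>

lemma gamma_density_split:
  assumes "a > 0" "b > 0" "s > 0"
  shows "s * (gamma_density a (s * \<beta>) * gamma_density b (s - s * \<beta>)) = beta_weight a b \<beta> * gamma_density (a + b) s"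
proof (cases "0 < \<beta> \<and> \<beta> < 1")
  case True
  then have 1: "s - s * \<beta> = s * (1 - \<beta>)" "s * (1 - \<beta>) > 0" "s * \<beta> > 0" using assms by (auto simp: algebra_simps)
  have "s * (s powr (a - 1) * s powr (b - 1)) = s powr 1 * (s powr (a - 1) * s powr (b - 1))"
    using assms by simp
  also have "\<dots> = s powr (a + b - 1)" by (simp only: powr_add[symmetric]) (simp add: algebra_simps)
  finally have 2: "s * (s powr (a - 1) * s powr (b - 1)) = s powr (a + b - 1)" .
  have nz: "Gamma (a + b) \<noteq> 0" using Gamma_real_nonzero[of "a + b"] assms by simp
  have 3: "exp (- (s * \<beta>)) * exp (- (s * (1 - \<beta>))) = exp (- s)"
    by (simp add: exp_add[symmetric] algebra_simps)
  have "s * (gamma_density a (s * \<beta>) * gamma_density b (s - s * \<beta>)) =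
     (s * (s powr (a - 1) * s powr (b - 1))) * (exp (- (s * \<beta>)) * exp (- (s * (1 - \<beta>)))) *
     \<beta> powr (a - 1) * (1 - \<beta>) powr (b - 1) / (Gamma a * Gamma b)"
    using 1 True assms by (simp add: gamma_density_def powr_mult)
  also have "\<dots> = beta_weight a b \<beta> * gamma_density (a + b) s"
    unfolding 2 3 using assms True nz by (simp add: gamma_density_def beta_weight_def)
  finally show ?thesis .
next
  case False
  then have "s * \<beta> \<le> 0 \<or> s - s * \<beta> \<le> 0"
    using assms by (auto simp: mult_le_0_iff not_less)
  then show ?thesis using False by (auto simp: gamma_density_def beta_weight_def)
qed

text \<open>Ratio and sum of two independent gamma variables are independent. The change of
  variables is made one coordinate at a time: a translation of v, an exchange of the integrals, and
  a scaling of u by s.\<close>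

lemma beta_gamma_independence:
  assumes [measurable]: "(\<lambda>(u, v). H u v) \<in> borel_measurable (borel \<Otimes>\<^sub>M borel)" and ab: "a > 0" "b > 0"
  shows "(\<integral>\<^sup>+u. \<integral>\<^sup>+v. ennreal (gamma_density a u * gamma_density b v) * H u v \<partial>lborel \<partial>lborel) =
    (\<integral>\<^sup>+\<beta>. \<integral>\<^sup>+s. ennreal (beta_weight a b \<beta> * gamma_density (a + b) s) * H (s * \<beta>) (s - s * \<beta>) \<partial>lborel \<partial>lborel)"
proof -
  have "(\<integral>\<^sup>+u. \<integral>\<^sup>+v. ennreal (gamma_density a u * gamma_density b v) * H u v \<partial>lborel \<partial>lborel) =
    (\<integral>\<^sup>+u. \<integral>\<^sup>+s. ennreal (gamma_density a u * gamma_density b (s - u)) * H u (s - u) \<partial>lborel \<partial>lborel)"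
  proof (rule nn_integral_cong)
    fix u :: real
    show "(\<integral>\<^sup>+v. ennreal (gamma_density a u * gamma_density b v) * H u v \<partial>lborel) =
      (\<integral>\<^sup>+s. ennreal (gamma_density a u * gamma_density b (s - u)) * H u (s - u) \<partial>lborel)"
      by (subst nn_integral_real_affine[where c = 1 and t = "- u"]) auto
  qed
  also have "\<dots> = (\<integral>\<^sup>+s. \<integral>\<^sup>+u. ennreal (gamma_density a u * gamma_density b (s - u)) * H u (s - u) \<partial>lborel \<partial>lborel)"
    by (rule lborel_pair.Fubini') measurable
  also have "\<dots> = (\<integral>\<^sup>+s. \<integral>\<^sup>+\<beta>. ennreal (beta_weight a b \<beta> * gamma_density (a + b) s) * H (s * \<beta>) (s - s * \<beta>) \<partial>lborel \<partial>lborel)"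
  proof (rule nn_integral_cong)
    fix s :: real
    show "(\<integral>\<^sup>+u. ennreal (gamma_density a u * gamma_density b (s - u)) * H u (s - u) \<partial>lborel) =
      (\<integral>\<^sup>+\<beta>. ennreal (beta_weight a b \<beta> * gamma_density (a + b) s) * H (s * \<beta>) (s - s * \<beta>) \<partial>lborel)"
    proof (cases "s > 0")
      case True
      have "(\<integral>\<^sup>+u. ennreal (gamma_density a u * gamma_density b (s - u)) * H u (s - u) \<partial>lborel) =
        ennreal s * (\<integral>\<^sup>+\<beta>. ennreal (gamma_density a (s * \<beta>) * gamma_density b (s - s * \<beta>)) * H (s * \<beta>) (s - s * \<beta>) \<partial>lborel)"
        using True by (subst nn_integral_real_affine[where c = s and t = 0]) auto
      also have "\<dots> = (\<integral>\<^sup>+\<beta>. ennreal (s * (gamma_density a (s * \<beta>) * gamma_density b (s - s * \<beta>))) * H (s * \<beta>) (s - s * \<beta>) \<partial>lborel)"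
        using True by (subst nn_integral_cmult[symmetric]) (auto simp: ennreal_mult' mult.assoc)
      finally show ?thesis using gamma_density_split[OF ab True] by simp
    next
      case False
      then have 1: "ennreal (gamma_density a u * gamma_density b (s - u)) * H u (s - u) = 0" for u
        by (auto simp: gamma_density_def)
      have 2: "ennreal (beta_weight a b \<beta> * gamma_density (a + b) s) * H (s * \<beta>) (s - s * \<beta>) = 0" for \<beta>
        using False by (simp add: gamma_density_def)
      show ?thesis by (simp only: 1 2)
    qed
  qed
  also have "\<dots> = (\<integral>\<^sup>+\<beta>. \<integral>\<^sup>+s. ennreal (beta_weight a b \<beta> * gamma_density (a + b) s) * H (s * \<beta>) (s - s * \<beta>) \<partial>lborel \<partial>lborel)"
    by (rule lborel_pair.Fubini') measurable
  finally show ?thesis .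
qed

text \<open>The ratio u / (u + v) is independent of the sum, and the sum has law Gamma(a + b).
  Replacing the sum by a fresh variable q of that law therefore leaves the pair unchanged in law.
  For reciprocal weights this is the Burke property at one vertex.\<close>

lemma burke_gamma:
  assumes F [measurable]: "(\<lambda>(u, v). F u v) \<in> borel_measurable (borel \<Otimes>\<^sub>M borel)" and ab: "a > 0" "b > 0"
  shows "(\<integral>\<^sup>+u. \<integral>\<^sup>+v. ennreal (gamma_density a u * gamma_density b v) *
            (\<integral>\<^sup>+q. ennreal (gamma_density (a + b) q) * F (u / (u + v) * q) (v / (u + v) * q) \<partial>lborel) \<partial>lborel \<partial>lborel) =
    (\<integral>\<^sup>+u. \<integral>\<^sup>+v. ennreal (gamma_density a u * gamma_density b v) * F u v \<partial>lborel \<partial>lborel)"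
proof -
  define H where "H u v = (\<integral>\<^sup>+q. ennreal (gamma_density (a + b) q) * F (u / (u + v) * q) (v / (u + v) * q) \<partial>lborel)" for u v
  have [measurable]: "(\<lambda>(u, v). H u v) \<in> borel_measurable (borel \<Otimes>\<^sub>M borel)"
    unfolding H_def [abs_def] by measurable
  define G where "G \<beta> = (\<integral>\<^sup>+q. ennreal (gamma_density (a + b) q) * F (\<beta> * q) ((1 - \<beta>) * q) \<partial>lborel)" for \<beta>
  have "(\<integral>\<^sup>+u. \<integral>\<^sup>+v. ennreal (gamma_density a u * gamma_density b v) * H u v \<partial>lborel \<partial>lborel) =
    (\<integral>\<^sup>+\<beta>. \<integral>\<^sup>+s. ennreal (beta_weight a b \<beta> * gamma_density (a + b) s) * H (s * \<beta>) (s - s * \<beta>) \<partial>lborel \<partial>lborel)"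
    by (rule beta_gamma_independence) (use ab in auto)
  also have "\<dots> = (\<integral>\<^sup>+\<beta>. ennreal (beta_weight a b \<beta>) * G \<beta> \<partial>lborel)"
  proof (rule nn_integral_cong)
    fix \<beta> :: real
    \<comment> \<open>For s > 0 the pair (s\<beta>, s - s\<beta>) has ratio \<beta> whatever s is,
      so the inner integral depends on \<beta> alone.\<close>
    have "ennreal (beta_weight a b \<beta> * gamma_density (a + b) s) * H (s * \<beta>) (s - s * \<beta>) =
       (ennreal (beta_weight a b \<beta>) * G \<beta>) * ennreal (gamma_density (a + b) s)" for s
    proof (cases "s > 0")
      case True
      then have "H (s * \<beta>) (s - s * \<beta>) = G \<beta>"
        by (simp add: H_def G_def diff_divide_distrib)
      then show ?thesis using ab by (simp add: ennreal_mult'' mult_ac)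
    qed (simp add: gamma_density_def)
    then have "(\<integral>\<^sup>+s. ennreal (beta_weight a b \<beta> * gamma_density (a + b) s) * H (s * \<beta>) (s - s * \<beta>) \<partial>lborel) =
       (\<integral>\<^sup>+s. (ennreal (beta_weight a b \<beta>) * G \<beta>) * ennreal (gamma_density (a + b) s) \<partial>lborel)" by simp
    also have "\<dots> = ennreal (beta_weight a b \<beta>) * G \<beta>"
      using ab by (subst nn_integral_cmult) (auto simp: nn_integral_gamma_density)
    finally show "(\<integral>\<^sup>+s. ennreal (beta_weight a b \<beta> * gamma_density (a + b) s) * H (s * \<beta>) (s - s * \<beta>) \<partial>lborel) =
       ennreal (beta_weight a b \<beta>) * G \<beta>" .
  qed
  also have "\<dots> = (\<integral>\<^sup>+\<beta>. \<integral>\<^sup>+s. ennreal (beta_weight a b \<beta> * gamma_density (a + b) s) * F (s * \<beta>) (s - s * \<beta>) \<partial>lborel \<partial>lborel)"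
    unfolding G_def using ab
    by (intro nn_integral_cong, subst nn_integral_cmult[symmetric])
      (auto simp: ennreal_mult'' mult_ac algebra_simps intro!: nn_integral_cong)
  also have "\<dots> = (\<integral>\<^sup>+u. \<integral>\<^sup>+v. ennreal (gamma_density a u * gamma_density b v) * F u v \<partial>lborel \<partial>lborel)"
    by (rule beta_gamma_independence [symmetric]) (use ab in auto)
  finally show ?thesis by (simp add: H_def)
qed

section \<open>Laws of the log-weights\<close>

definition log_inv_gamma :: "real \<Rightarrow> real measure" where
  "log_inv_gamma \<nu> = distr (density lborel (\<lambda>x. ennreal (gamma_density \<nu> x))) borel (\<lambda>x. - ln x)"

lemma sets_log_inv_gamma [simp, measurable_cong]: "sets (log_inv_gamma \<nu>) = sets borel"
  by (simp add: log_inv_gamma_def)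

lemma space_log_inv_gamma [simp]: "space (log_inv_gamma \<nu>) = UNIV"
  by (simp add: log_inv_gamma_def)

lemma nn_integral_log_inv_gamma:
  assumes [measurable]: "f \<in> borel_measurable borel"
  shows "(\<integral>\<^sup>+x. f x \<partial>log_inv_gamma \<nu>) = (\<integral>\<^sup>+x. ennreal (gamma_density \<nu> x) * f (- ln x) \<partial>lborel)"
  unfolding log_inv_gamma_def by (subst nn_integral_distr) (auto simp: nn_integral_density)

lemma prob_space_log_inv_gamma:
  assumes "\<nu> > 0" shows "prob_space (log_inv_gamma \<nu>)"
proof
  have "emeasure (log_inv_gamma \<nu>) (space (log_inv_gamma \<nu>)) = (\<integral>\<^sup>+x. 1 \<partial>log_inv_gamma \<nu>)" by simp
  also have "\<dots> = 1" using assms by (subst nn_integral_log_inv_gamma) (auto simp: nn_integral_gamma_density)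
  finally show "emeasure (log_inv_gamma \<nu>) (space (log_inv_gamma \<nu>)) = 1" .
qed

text \<open>With u = exp(-x), the factor exp(\<xi>x) is u to the power -\<xi> and merely shifts the
  exponent in the gamma density. The sign of \<xi> is free; negative values serve the lower
  tail.\<close>

lemma tilt_log_inv_gamma:
  assumes [measurable]: "f \<in> borel_measurable borel" and \<nu>: "\<nu> > 0" "\<xi> < \<nu>"
  shows "(\<integral>\<^sup>+x. ennreal (exp (\<xi> * x)) * f x \<partial>log_inv_gamma \<nu>) =
     ennreal (Gamma (\<nu> - \<xi>) / Gamma \<nu>) * (\<integral>\<^sup>+x. f x \<partial>log_inv_gamma (\<nu> - \<xi>))"
proof -
  have *: "gamma_density \<nu> x * exp (\<xi> * - ln x) = Gamma (\<nu> - \<xi>) / Gamma \<nu> * gamma_density (\<nu> - \<xi>) x" for x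
  proof (cases "x > 0")
    case True
    have "exp (\<xi> * - ln x) = x powr (- \<xi>)" using True by (simp add: powr_def)
    moreover have "x powr (\<nu> - 1) * x powr (- \<xi>) = x powr (\<nu> - \<xi> - 1)"
      by (simp add: powr_add[symmetric] algebra_simps)
    moreover have "Gamma (\<nu> - \<xi>) \<noteq> 0" using Gamma_real_nonzero[of "\<nu> - \<xi>"] \<nu> by simp
    ultimately show ?thesis using True \<nu> by (simp add: gamma_density_def mult_ac)
  qed (simp add: gamma_density_def)
  have **: "ennreal (Gamma (\<nu> - \<xi>) / Gamma \<nu> * gamma_density (\<nu> - \<xi>) x) =
      ennreal (Gamma (\<nu> - \<xi>) / Gamma \<nu>) * ennreal (gamma_density (\<nu> - \<xi>) x)" for x
    using \<nu> by (intro ennreal_mult divide_nonneg_nonneg less_imp_le[OF Gamma_real_pos] gamma_density_nonneg) auto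
  have "(\<integral>\<^sup>+x. ennreal (exp (\<xi> * x)) * f x \<partial>log_inv_gamma \<nu>) =
    (\<integral>\<^sup>+x. ennreal (gamma_density \<nu> x) * (ennreal (exp (\<xi> * - ln x)) * f (- ln x)) \<partial>lborel)"
    by (rule nn_integral_log_inv_gamma) measurable
  also have "\<dots> = (\<integral>\<^sup>+x. ennreal (gamma_density \<nu> x * exp (\<xi> * - ln x)) * f (- ln x) \<partial>lborel)"
    by (simp add: ennreal_mult'' mult.assoc)
  also have "\<dots> = (\<integral>\<^sup>+x. ennreal (Gamma (\<nu> - \<xi>) / Gamma \<nu>) * (ennreal (gamma_density (\<nu> - \<xi>) x) * f (- ln x)) \<partial>lborel)"
    unfolding * ** mult.assoc ..
  also have "\<dots> = ennreal (Gamma (\<nu> - \<xi>) / Gamma \<nu>) * (\<integral>\<^sup>+x. f x \<partial>log_inv_gamma (\<nu> - \<xi>))"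
    by (subst nn_integral_cmult) (auto simp: nn_integral_log_inv_gamma)
  finally show ?thesis .
qed

lemma mgf_log_inv_gamma:
  assumes "\<nu> > 0" "\<xi> < \<nu>"
  shows "(\<integral>\<^sup>+x. ennreal (exp (\<xi> * x)) \<partial>log_inv_gamma \<nu>) = ennreal (Gamma (\<nu> - \<xi>) / Gamma \<nu>)"
proof -
  interpret prob_space "log_inv_gamma (\<nu> - \<xi>)" using assms by (intro prob_space_log_inv_gamma) simp
  show ?thesis using tilt_log_inv_gamma[of "\<lambda>_. 1" \<nu> \<xi>] assms emeasure_space_1 by simp
qed

lemma burke_log_inv_gamma:
  assumes F [measurable]: "(\<lambda>(u, v). F u v) \<in> borel_measurable (borel \<Otimes>\<^sub>M borel)" and ab: "a > 0" "b > 0"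
  shows "(\<integral>\<^sup>+x. \<integral>\<^sup>+y. \<integral>\<^sup>+q. F (q + ln (1 + exp (x - y))) (q + ln (1 + exp (y - x)))
            \<partial>log_inv_gamma (a + b) \<partial>log_inv_gamma b \<partial>log_inv_gamma a) =
         (\<integral>\<^sup>+x. \<integral>\<^sup>+y. F x y \<partial>log_inv_gamma b \<partial>log_inv_gamma a)"
proof -
  interpret A: prob_space "log_inv_gamma a" using ab by (intro prob_space_log_inv_gamma)
  interpret B: prob_space "log_inv_gamma b" using ab by (intro prob_space_log_inv_gamma)
  interpret C: prob_space "log_inv_gamma (a + b)" using ab by (intro prob_space_log_inv_gamma) simp
  \<comment> \<open>The logarithmic identities need positive arguments; elsewhere the densities
    vanish, so they are kept as factors.\<close>
  have *: "ennreal (gamma_density a u * gamma_density b v) * (ennreal (gamma_density (a + b) q) *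
      F (- ln q + ln (1 + exp (- ln u - - ln v))) (- ln q + ln (1 + exp (- ln v - - ln u)))) =
    ennreal (gamma_density a u * gamma_density b v) * (ennreal (gamma_density (a + b) q) *
      F (- ln (u / (u + v) * q)) (- ln (v / (u + v) * q)))" for u v q
  proof (cases "u > 0 \<and> v > 0 \<and> q > 0")
    case True
    have 1: "- ln q + ln (1 + exp (- ln u - - ln v)) = - ln (u / (u + v) * q)" if "u > 0" "v > 0" for u v
    proof -
      have "exp (- ln u - - ln v) = v / u" using that by (simp add: exp_diff)
      moreover have "1 + v / u = (u + v) / u" using that by (simp add: field_simps)
      ultimately show ?thesis using that True by (simp add: ln_div ln_mult)
    qed
    show ?thesis using 1[of u v] 1[of v u] True by (simp add: add.commute)
  qed (auto simp: gamma_density_def)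
  have "(\<integral>\<^sup>+x. \<integral>\<^sup>+y. \<integral>\<^sup>+q. F (q + ln (1 + exp (x - y))) (q + ln (1 + exp (y - x)))
            \<partial>log_inv_gamma (a + b) \<partial>log_inv_gamma b \<partial>log_inv_gamma a) =
    (\<integral>\<^sup>+u. \<integral>\<^sup>+v. ennreal (gamma_density a u * gamma_density b v) * (\<integral>\<^sup>+q. ennreal (gamma_density (a + b) q) *
      F (- ln q + ln (1 + exp (- ln u - - ln v))) (- ln q + ln (1 + exp (- ln v - - ln u))) \<partial>lborel) \<partial>lborel \<partial>lborel)"
    using ab by (simp add: nn_integral_log_inv_gamma nn_integral_cmult[symmetric] ennreal_mult'' mult.assoc)
  also have "\<dots> = (\<integral>\<^sup>+u. \<integral>\<^sup>+v. ennreal (gamma_density a u * gamma_density b v) * (\<integral>\<^sup>+q. ennreal (gamma_density (a + b) q) *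
      F (- ln (u / (u + v) * q)) (- ln (v / (u + v) * q)) \<partial>lborel) \<partial>lborel \<partial>lborel)"
  proof (intro nn_integral_cong)
    fix u v :: real
    show "ennreal (gamma_density a u * gamma_density b v) * (\<integral>\<^sup>+q. ennreal (gamma_density (a + b) q) *
      F (- ln q + ln (1 + exp (- ln u - - ln v))) (- ln q + ln (1 + exp (- ln v - - ln u))) \<partial>lborel) =
      ennreal (gamma_density a u * gamma_density b v) * (\<integral>\<^sup>+q. ennreal (gamma_density (a + b) q) *
      F (- ln (u / (u + v) * q)) (- ln (v / (u + v) * q)) \<partial>lborel)"
      by (subst (1 2) nn_integral_cmult[symmetric]) (simp_all only: *, simp_all)
  qed
  also have "\<dots> = (\<integral>\<^sup>+u. \<integral>\<^sup>+v. ennreal (gamma_density a u * gamma_density b v) * F (- ln u) (- ln v) \<partial>lborel \<partial>lborel)"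
    by (rule burke_gamma[of "\<lambda>u v. F (- ln u) (- ln v)"]) (use ab in auto)
  also have "\<dots> = (\<integral>\<^sup>+x. \<integral>\<^sup>+y. F x y \<partial>log_inv_gamma b \<partial>log_inv_gamma a)"
    using ab by (simp add: nn_integral_log_inv_gamma nn_integral_cmult[symmetric] ennreal_mult'' mult.assoc)
  finally show ?thesis .
qed

section \<open>Product environments\<close>

definition env :: "('i \<Rightarrow> real) \<Rightarrow> ('i \<Rightarrow> real) measure" where
  "env c = PiM UNIV (\<lambda>v. log_inv_gamma (c v))"

abbreviation env_borel :: "('i \<Rightarrow> real) measure" where
  "env_borel \<equiv> PiM UNIV (\<lambda>_. borel)"

lemma sets_env [simp, measurable_cong]: "sets (env c) = sets env_borel"
  unfolding env_def by (rule sets_PiM_cong) auto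

lemma space_env [simp]: "space (env c) = UNIV"
  by (simp add: env_def space_PiM PiE_UNIV_domain)

lemma prob_space_env: "(\<And>v. c v > 0) \<Longrightarrow> prob_space (env c)"
  unfolding env_def by (intro prob_space_PiM prob_space_log_inv_gamma)

text \<open>Pointwise dependence on a set of coordinates stands in for measurability with respect to
  a sub-sigma-algebra. Together with measurability on the whole space it suffices for independence
  over disjoint sets.\<close>

definition depends_on :: "'i set \<Rightarrow> (('i \<Rightarrow> real) \<Rightarrow> 'b) \<Rightarrow> bool" where
  "depends_on S f \<longleftrightarrow> (\<forall>w w'. (\<forall>v\<in>S. w v = w' v) \<longrightarrow> f w = f w')"

lemma depends_onI: "(\<And>w w'. (\<And>v. v \<in> S \<Longrightarrow> w v = w' v) \<Longrightarrow> f w = f w') \<Longrightarrow> depends_on S f"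
  unfolding depends_on_def by blast

lemma depends_onD: "depends_on S f \<Longrightarrow> (\<And>v. v \<in> S \<Longrightarrow> w v = w' v) \<Longrightarrow> f w = f w'"
  unfolding depends_on_def by blast

lemma depends_on_mono: "depends_on S f \<Longrightarrow> S \<subseteq> T \<Longrightarrow> depends_on T f"
  unfolding depends_on_def by blast

lemma depends_on_compose: "depends_on S f \<Longrightarrow> depends_on S (\<lambda>w. g (f w))"
  unfolding depends_on_def by metis

lemma in_space_env_borel [simp]: "w \<in> space env_borel"
  by (simp add: space_PiM PiE_UNIV_domain)

lemma measurable_env_upd [measurable]:
  "(\<lambda>(w, x). w(v := x)) \<in> env_borel \<Otimes>\<^sub>M borel \<rightarrow>\<^sub>M (env_borel :: ('i \<Rightarrow> real) measure)"
proof -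
  have "(\<lambda>p i. ((fst p)(v := snd p)) i) \<in> env_borel \<Otimes>\<^sub>M borel \<rightarrow>\<^sub>M (env_borel :: ('i \<Rightarrow> real) measure)"
  proof (rule measurable_abs_UNIV)
    fix i show "(\<lambda>p. ((fst p)(v := snd p)) i) \<in> env_borel \<Otimes>\<^sub>M borel \<rightarrow>\<^sub>M borel"
      by (cases "i = v") auto
  qed
  then show ?thesis by (simp only: case_prod_beta')
qed

lemma measurable_env_upd' [measurable (raw)]:
  assumes "f \<in> M \<rightarrow>\<^sub>M env_borel" "g \<in> M \<rightarrow>\<^sub>M borel"
  shows "(\<lambda>x. (f x)(v := g x)) \<in> M \<rightarrow>\<^sub>M (env_borel :: ('i \<Rightarrow> real) measure)"
  using measurable_compose[OF measurable_Pair[OF assms] measurable_env_upd[of v]] by simp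

lemma extend_measurable:
  "(\<lambda>x i. if i \<in> S then x i else (0::real)) \<in> PiM S (\<lambda>_. borel) \<rightarrow>\<^sub>M env_borel"
proof (rule measurable_abs_UNIV)
  fix i show "(\<lambda>x. if i \<in> S then x i else (0::real)) \<in> PiM S (\<lambda>_. borel) \<rightarrow>\<^sub>M borel"
    by (cases "i \<in> S") auto
qed

lemma nn_integral_env_restrict:
  assumes [measurable]: "f \<in> borel_measurable env_borel" and f: "depends_on S f" and c: "\<And>v. c v > 0"
  shows "(\<integral>\<^sup>+w. f w \<partial>env c) =
    (\<integral>\<^sup>+x. f (\<lambda>i. if i \<in> S then x i else 0) \<partial>PiM S (\<lambda>v. log_inv_gamma (c v)))"
proof -
  have [measurable_cong]: "sets (PiM S (\<lambda>v. log_inv_gamma (c v))) = sets (PiM S (\<lambda>_. borel))"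
    by (rule sets_PiM_cong) auto
  note [measurable] = extend_measurable[of S]
  have "PiM S (\<lambda>v. log_inv_gamma (c v)) = distr (env c) (PiM S (\<lambda>v. log_inv_gamma (c v))) (\<lambda>\<omega>. \<lambda>n\<in>S. \<omega> n)"
    unfolding env_def using c by (intro distr_PiM_reindex[where f = "\<lambda>x. x", symmetric] prob_space_log_inv_gamma) auto
  then have "(\<integral>\<^sup>+x. f (\<lambda>i. if i \<in> S then x i else 0) \<partial>PiM S (\<lambda>v. log_inv_gamma (c v))) =
    (\<integral>\<^sup>+x. f (\<lambda>i. if i \<in> S then x i else 0) \<partial>distr (env c) (PiM S (\<lambda>v. log_inv_gamma (c v))) (\<lambda>\<omega>. \<lambda>n\<in>S. \<omega> n))"
    by metis
  also have "\<dots> = (\<integral>\<^sup>+w. f (\<lambda>i. if i \<in> S then (restrict w S) i else 0) \<partial>env c)"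
    by (subst nn_integral_distr) (auto intro!: measurable_restrict)
  also have "\<dots> = (\<integral>\<^sup>+w. f w \<partial>env c)"
    by (intro nn_integral_cong depends_onD[OF f]) auto
  finally show ?thesis ..
qed

lemma nn_integral_env_cong_param:
  assumes "f \<in> borel_measurable env_borel" "depends_on S f" "\<And>v. c v > 0" "\<And>v. c' v > 0"
    and "\<And>v. v \<in> S \<Longrightarrow> c v = c' v"
  shows "(\<integral>\<^sup>+w. f w \<partial>env c) = (\<integral>\<^sup>+w. f w \<partial>env c')"
proof -
  have "PiM S (\<lambda>v. log_inv_gamma (c v)) = PiM S (\<lambda>v. log_inv_gamma (c' v))"
    using assms(5) by (intro PiM_cong) auto
  then show ?thesis
    by (simp add: nn_integral_env_restrict[OF assms(1,2)] assms(3,4))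
qed

text \<open>Fubini in a single coordinate, arranged so that the outer integral still runs over a
  full environment. Coordinate v of that environment is overwritten, so its parameter there is
  arbitrary, and several coordinates can be resampled one after another.\<close>

lemma nn_integral_env_resample:
  assumes [measurable]: "f \<in> borel_measurable env_borel" and c: "\<And>v. c v > 0" and \<nu>: "\<nu> > 0"
  shows "(\<integral>\<^sup>+w. f w \<partial>env (c(v := \<nu>))) = (\<integral>\<^sup>+w. \<integral>\<^sup>+x. f (w(v := x)) \<partial>log_inv_gamma \<nu> \<partial>env c)"
proof -
  let ?c = "c(v := \<nu>)"
  have c': "?c i > 0" for i using c \<nu> by auto
  interpret L: prob_space "log_inv_gamma \<nu>" using \<nu> by (rule prob_space_log_inv_gamma)
  interpret E: prob_space "env ?c" using c' by (rule prob_space_env)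
  interpret P: pair_sigma_finite "log_inv_gamma \<nu>" "env ?c" ..
  have "env ?c = distr (log_inv_gamma \<nu> \<Otimes>\<^sub>M env ?c) (env ?c) (\<lambda>(x, X). X(v := x))"
    using distr_pair_PiM_eq_PiM[of UNIV "\<lambda>i. log_inv_gamma (?c i)" v,
      OF prob_space_log_inv_gamma[OF c'] prob_space_log_inv_gamma[OF c']]
    by (simp add: env_def insert_absorb)
  then have "(\<integral>\<^sup>+w. f w \<partial>env ?c) = (\<integral>\<^sup>+w. f w \<partial>distr (log_inv_gamma \<nu> \<Otimes>\<^sub>M env ?c) (env ?c) (\<lambda>(x, X). X(v := x)))"
    by metis
  also have "\<dots> = (\<integral>\<^sup>+p. f ((snd p)(v := fst p)) \<partial>(log_inv_gamma \<nu> \<Otimes>\<^sub>M env ?c))"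
    by (subst nn_integral_distr) (auto simp: case_prod_beta')
  also have "\<dots> = (\<integral>\<^sup>+w. \<integral>\<^sup>+x. f (w(v := x)) \<partial>log_inv_gamma \<nu> \<partial>env ?c)"
    by (subst P.nn_integral_snd[symmetric]) auto
  also have "\<dots> = (\<integral>\<^sup>+w. \<integral>\<^sup>+x. f (w(v := x)) \<partial>log_inv_gamma \<nu> \<partial>env c)"
  proof (rule nn_integral_env_cong_param[where S = "- {v}"])
    show "depends_on (- {v}) (\<lambda>w. \<integral>\<^sup>+x. f (w(v := x)) \<partial>log_inv_gamma \<nu>)"
    proof (rule depends_onI)
      fix w w' :: "'a \<Rightarrow> real" assume "\<And>i. i \<in> - {v} \<Longrightarrow> w i = w' i"
      then have "w(v := x) = w'(v := x)" for x by auto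
      then show "(\<integral>\<^sup>+x. f (w(v := x)) \<partial>log_inv_gamma \<nu>) = (\<integral>\<^sup>+x. f (w'(v := x)) \<partial>log_inv_gamma \<nu>)" by simp
    qed
  qed (use c c' in auto)
  finally show ?thesis .
qed

lemma nn_integral_env_resample':
  assumes "f \<in> borel_measurable env_borel" and c: "\<And>v. c v > 0"
  shows "(\<integral>\<^sup>+w. f w \<partial>env c) = (\<integral>\<^sup>+w. \<integral>\<^sup>+x. f (w(v := x)) \<partial>log_inv_gamma (c v) \<partial>env c)"
  using nn_integral_env_resample[where f = f and \<nu> = "c v" and v = v and c = c] assms by simp

lemma nn_integral_env_reindex:
  assumes [measurable]: "f \<in> borel_measurable env_borel" and c: "\<And>v. c v > 0" and "inj \<iota>"
  shows "(\<integral>\<^sup>+w. f (\<lambda>v. w (\<iota> v)) \<partial>env c) = (\<integral>\<^sup>+w. f w \<partial>env (\<lambda>v. c (\<iota> v)))"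
proof -
  have "env (\<lambda>v. c (\<iota> v)) = distr (env c) (env (\<lambda>v. c (\<iota> v))) (\<lambda>\<omega>. \<lambda>n\<in>UNIV. \<omega> (\<iota> n))"
    unfolding env_def using assms by (intro distr_PiM_reindex[symmetric] prob_space_log_inv_gamma) auto
  then have eq: "env (\<lambda>v. c (\<iota> v)) = distr (env c) (env (\<lambda>v. c (\<iota> v))) (\<lambda>\<omega> n. \<omega> (\<iota> n))"
    by (simp only: restrict_UNIV)
  have meas: "(\<lambda>\<omega> n. \<omega> (\<iota> n)) \<in> env c \<rightarrow>\<^sub>M env (\<lambda>v. c (\<iota> v))"
    by (simp cong: measurable_cong_sets) (rule measurable_abs_UNIV, simp)
  have "(\<integral>\<^sup>+w. f w \<partial>env (\<lambda>v. c (\<iota> v))) = (\<integral>\<^sup>+w. f w \<partial>distr (env c) (env (\<lambda>v. c (\<iota> v))) (\<lambda>\<omega> n. \<omega> (\<iota> n)))"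
    by (rule arg_cong[where f = "\<lambda>M. nn_integral M f", OF eq])
  also have "\<dots> = (\<integral>\<^sup>+w. f (\<lambda>v. w (\<iota> v)) \<partial>env c)"
    by (rule nn_integral_distr) (use meas in auto)
  finally show ?thesis ..
qed

text \<open>Each factor is a function of the restriction to its own index set, extended by zero
  elsewhere, and restrictions of independent coordinates to disjoint sets are independent.\<close>

lemma nn_integral_env_mult:
  assumes [measurable]: "f \<in> borel_measurable env_borel" "g \<in> borel_measurable env_borel"
    and f: "depends_on A f" and g: "depends_on B g" and disj: "A \<inter> B = {}" and c: "\<And>v. c v > 0"
  shows "(\<integral>\<^sup>+w. f w * g w \<partial>env c) = (\<integral>\<^sup>+w. f w \<partial>env c) * (\<integral>\<^sup>+w. g w \<partial>env c)"
proof -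
  interpret E: prob_space "env c" using c by (rule prob_space_env)
  have comp: "distr (env c) (log_inv_gamma (c i)) (\<lambda>\<omega>. \<omega> i) = log_inv_gamma (c i)" for i
    unfolding env_def using c by (intro distr_PiM_component prob_space_log_inv_gamma) auto
  have comp': "distr (env c) borel (\<lambda>\<omega>. \<omega> i) = log_inv_gamma (c i)" for i
    by (subst comp[symmetric], rule distr_cong) auto
  have ind: "E.indep_vars (\<lambda>_. borel) (\<lambda>i \<omega>. \<omega> i) UNIV"
  proof (subst E.indep_vars_iff_distr_eq_PiM')
    have "distr (env c) env_borel (\<lambda>x. \<lambda>i\<in>UNIV. x i) = distr (env c) (env c) (\<lambda>x. x)"
      by (rule distr_cong) auto
    also have "\<dots> = env c" by simp
    also have "\<dots> = (\<Pi>\<^sub>M i\<in>UNIV. distr (env c) borel (\<lambda>\<omega>. \<omega> i))"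
      unfolding comp' by (simp add: env_def)
    finally show "distr (env c) env_borel (\<lambda>x. \<lambda>i\<in>UNIV. x i) = (\<Pi>\<^sub>M i\<in>UNIV. distr (env c) borel (\<lambda>\<omega>. \<omega> i))" .
  qed auto
  note [measurable] = extend_measurable[of A] extend_measurable[of B]
  have "E.indep_var borel ((\<lambda>x. f (\<lambda>i. if i \<in> A then x i else 0)) \<circ> (\<lambda>\<omega>. restrict (\<lambda>i. \<omega> i) A))
     borel ((\<lambda>x. g (\<lambda>i. if i \<in> B then x i else 0)) \<circ> (\<lambda>\<omega>. restrict (\<lambda>i. \<omega> i) B))"
    by (rule E.indep_var_compose[OF E.indep_var_restrict[OF ind disj]]) auto
  moreover have "(\<lambda>x. f (\<lambda>i. if i \<in> A then x i else 0)) \<circ> (\<lambda>\<omega>. restrict (\<lambda>i. \<omega> i) A) = f"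
    by (rule ext, unfold comp_def, rule depends_onD[OF f]) auto
  moreover have "(\<lambda>x. g (\<lambda>i. if i \<in> B then x i else 0)) \<circ> (\<lambda>\<omega>. restrict (\<lambda>i. \<omega> i) B) = g"
    by (rule ext, unfold comp_def, rule depends_onD[OF g]) auto
  ultimately have "E.indep_var borel f borel g" by simp
  then have *: "distr (env c) borel f \<Otimes>\<^sub>M distr (env c) borel g = distr (env c) (borel \<Otimes>\<^sub>M borel) (\<lambda>x. (f x, g x))"
    by (simp add: E.indep_var_distribution_eq)
  interpret F: prob_space "distr (env c) borel f" by (rule E.prob_space_distr) simp
  interpret G: prob_space "distr (env c) borel g" by (rule E.prob_space_distr) simp
  have "(\<integral>\<^sup>+w. f w * g w \<partial>env c) = (\<integral>\<^sup>+p. fst p * snd p \<partial>distr (env c) (borel \<Otimes>\<^sub>M borel) (\<lambda>x. (f x, g x)))"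
    by (subst nn_integral_distr) auto
  also have "\<dots> = (\<integral>\<^sup>+x. \<integral>\<^sup>+y. x * y \<partial>distr (env c) borel g \<partial>distr (env c) borel f)"
    unfolding *[symmetric] by (subst G.nn_integral_fst[symmetric]) auto
  also have "\<dots> = (\<integral>\<^sup>+w. f w \<partial>env c) * (\<integral>\<^sup>+w. g w \<partial>env c)"
    by (simp add: nn_integral_cmult nn_integral_multc nn_integral_distr)
  finally show ?thesis .
qed

lemma nn_integral_env_coord:
  assumes [measurable]: "h \<in> borel_measurable borel" and c: "\<And>v. c v > 0"
  shows "(\<integral>\<^sup>+w. h (w v) \<partial>env c) = (\<integral>\<^sup>+x. h x \<partial>log_inv_gamma (c v))"
proof -
  interpret E: prob_space "env c" using c by (rule prob_space_env)
  show ?thesis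
    using E.emeasure_space_1 by (subst nn_integral_env_resample'[where v = v]) (auto simp: c)
qed

section \<open>The polymer with boundary parameters\<close>

lemma Zrec_measurable [measurable]: "(\<lambda>w. Zrec w m n) \<in> borel_measurable env_borel"
  by (induction "\<lambda>_::nat \<times> nat. 0::real" m n rule: Zrec.induct) auto

lemma shift_env_measurable [measurable]: "shift_env a b \<in> env_borel \<rightarrow>\<^sub>M env_borel"
  unfolding shift_env_def [abs_def] by (rule measurable_abs_UNIV) simp

lemma column_step_measurable [measurable]: "column_step n \<in> env_borel \<rightarrow>\<^sub>M env_borel"
proof (induction n)
  case (Suc n)
  have [measurable]: "vertex_step j \<in> env_borel \<rightarrow>\<^sub>M env_borel" for j
    unfolding vertex_step_def [abs_def] by measurable
  show ?case using Suc by (auto intro: measurable_compose)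
qed auto

lemma nn_integral_env_shift:
  assumes "f \<in> borel_measurable env_borel" "\<And>v. c v > 0"
  shows "(\<integral>\<^sup>+w. f (shift_env a b w) \<partial>env c) = (\<integral>\<^sup>+w. f w \<partial>env (shift_env a b c))"
  unfolding shift_env_def
  by (rule nn_integral_env_reindex[OF assms]) (auto simp: inj_on_def)

lemma depends_on_Zrec:
  "depends_on ({..m} \<times> {..n} - {(0, 0)}) (\<lambda>w. Zrec w m n)"
  by (rule depends_onI, rule Zrec_cong) auto

text \<open>The vertex consumes a horizontal ratio of parameter a, a vertical ratio of parameter b
  and a weight of parameter a + b; by the Burke property it returns two independent ratios of
  parameters a and b. The used vertical ratio at (0, j) stays correlated with them, so f must ignore
  it. Only the parameter at (1, j) changes.\<close>

lemma vertex_step_invariant: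
  assumes [measurable]: "f \<in> borel_measurable env_borel" and f: "depends_on (- {(0, j)}) f"
    and c: "\<And>v. c v > 0" "c (1, 0) = a" "c (0, j) = b" "c (1, j) = a + b" and j: "j \<noteq> 0"
  shows "(\<integral>\<^sup>+w. f (vertex_step j w) \<partial>env c) = (\<integral>\<^sup>+w. f w \<partial>env (c((1, j) := b)))"
proof -
  have ab: "a > 0" "b > 0" using c(1)[of "(1, 0)"] c(1)[of "(0, j)"] c by auto
  have [measurable]: "vertex_step j \<in> env_borel \<rightarrow>\<^sub>M env_borel"
    unfolding vertex_step_def [abs_def] by measurable
  interpret A: prob_space "log_inv_gamma a" using ab by (intro prob_space_log_inv_gamma)
  interpret B: prob_space "log_inv_gamma b" using ab by (intro prob_space_log_inv_gamma)
  interpret C: prob_space "log_inv_gamma (a + b)" using ab by (intro prob_space_log_inv_gamma) simp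
  \<comment> \<open>The three coordinates of the vertex become explicit integrals with the rest of
    the environment frozen, so that the planar identity applies inside.\<close>
  have "(\<integral>\<^sup>+w. f (vertex_step j w) \<partial>env c) =
     (\<integral>\<^sup>+w. \<integral>\<^sup>+q. f (vertex_step j (w((1, j) := q))) \<partial>log_inv_gamma (a + b) \<partial>env c)"
    by (rule nn_integral_env_resample'[where v = "(1, j)" and c = c, unfolded c(4)]) (simp_all add: c(1))
  also have "\<dots> = (\<integral>\<^sup>+w. \<integral>\<^sup>+y. \<integral>\<^sup>+q. f (vertex_step j (w((0, j) := y, (1, j) := q)))
        \<partial>log_inv_gamma (a + b) \<partial>log_inv_gamma b \<partial>env c)"
    by (rule nn_integral_env_resample'[where v = "(0, j)" and c = c, unfolded c(3)]) (simp_all add: c(1))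
  also have "\<dots> = (\<integral>\<^sup>+w. \<integral>\<^sup>+x. \<integral>\<^sup>+y. \<integral>\<^sup>+q. f (vertex_step j (w((1, 0) := x, (0, j) := y, (1, j) := q)))
        \<partial>log_inv_gamma (a + b) \<partial>log_inv_gamma b \<partial>log_inv_gamma a \<partial>env c)"
    by (rule nn_integral_env_resample'[where v = "(1, 0)" and c = c, unfolded c(2)]) (simp_all add: c(1))
  also have "\<dots> = (\<integral>\<^sup>+w. \<integral>\<^sup>+x. \<integral>\<^sup>+y. \<integral>\<^sup>+q. f (w((1, 0) := q + ln (1 + exp (x - y)), (1, j) := q + ln (1 + exp (y - x))))
        \<partial>log_inv_gamma (a + b) \<partial>log_inv_gamma b \<partial>log_inv_gamma a \<partial>env c)"
    using j by (intro nn_integral_cong depends_onD[OF f]) (auto simp: vertex_step_def)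
  also have "\<dots> = (\<integral>\<^sup>+w. \<integral>\<^sup>+x. \<integral>\<^sup>+y. f (w((1, 0) := x, (1, j) := y)) \<partial>log_inv_gamma b \<partial>log_inv_gamma a \<partial>env c)"
  proof (rule nn_integral_cong)
    fix w :: "nat \<times> nat \<Rightarrow> real"
    show "(\<integral>\<^sup>+x. \<integral>\<^sup>+y. \<integral>\<^sup>+q. f (w((1, 0) := q + ln (1 + exp (x - y)), (1, j) := q + ln (1 + exp (y - x))))
        \<partial>log_inv_gamma (a + b) \<partial>log_inv_gamma b \<partial>log_inv_gamma a) =
      (\<integral>\<^sup>+x. \<integral>\<^sup>+y. f (w((1, 0) := x, (1, j) := y)) \<partial>log_inv_gamma b \<partial>log_inv_gamma a)"
      using ab by (intro burke_log_inv_gamma[of "\<lambda>x y. f (w((1, 0) := x, (1, j) := y))"]) auto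
  qed
  also have "\<dots> = (\<integral>\<^sup>+w. \<integral>\<^sup>+y. f (w((1, j) := y)) \<partial>log_inv_gamma b \<partial>env c)"
    by (rule nn_integral_env_resample'[where v = "(1, 0)" and c = c, unfolded c(2), symmetric]) (simp_all add: c(1))
  also have "\<dots> = (\<integral>\<^sup>+w. f w \<partial>env (c((1, j) := b)))"
    using ab c by (intro nn_integral_env_resample[symmetric]) auto
  finally show ?thesis .
qed

text \<open>Each vertex hands its horizontal ratio, again of parameter a, to the vertex above and
  leaves behind a vertical ratio of parameter b. The left ratios used on the way must be invisible
  to f.\<close>

lemma column_step_invariant:
  fixes f :: "(nat \<times> nat \<Rightarrow> real) \<Rightarrow> ennreal"
  assumes "f \<in> borel_measurable env_borel" and "depends_on (- {(0, j) |j. 1 \<le> j \<and> j \<le> n}) f"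
    and c: "\<And>v. c v > 0" "c (1, 0) = a" "\<And>j. 1 \<le> j \<Longrightarrow> c (0, j) = b" "\<And>j. 1 \<le> j \<Longrightarrow> c (1, j) = a + b"
  shows "(\<integral>\<^sup>+w. f (column_step n w) \<partial>env c) =
     (\<integral>\<^sup>+w. f w \<partial>env (\<lambda>v. if fst v = 1 \<and> 1 \<le> snd v \<and> snd v \<le> n then b else c v))"
  using assms(1,2)
proof (induction n arbitrary: f)
  case 0
  have "(\<lambda>v. if fst v = 1 \<and> 1 \<le> snd v \<and> snd v \<le> 0 then b else c v) = c" by (auto simp: fun_eq_iff)
  then show ?case by simp
next
  case (Suc n)
  note [measurable] = Suc.prems(1)
  have [measurable]: "vertex_step j \<in> env_borel \<rightarrow>\<^sub>M env_borel" for j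
    unfolding vertex_step_def [abs_def] by measurable
  let ?c = "\<lambda>n v. if fst v = 1 \<and> 1 \<le> snd v \<and> snd v \<le> n then b else c v"
  have b: "b > 0" using c(1)[of "(0, 1)"] c(3)[of 1] by auto
  have "(\<integral>\<^sup>+w. f (column_step (Suc n) w) \<partial>env c) = (\<integral>\<^sup>+w. f (vertex_step (Suc n) w) \<partial>env (?c n))"
    unfolding column_step.simps
  proof (rule Suc.IH)
    show "depends_on (- {(0, j) |j. 1 \<le> j \<and> j \<le> n}) (\<lambda>w. f (vertex_step (Suc n) w))"
    proof (rule depends_onI, rule depends_onD[OF Suc.prems(2)])
      fix w w' :: "nat \<times> nat \<Rightarrow> real" and v :: "nat \<times> nat"
      assume w: "\<And>v. v \<in> - {(0, j) |j. 1 \<le> j \<and> j \<le> n} \<Longrightarrow> w v = w' v"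
        and v: "v \<in> - {(0, j) |j. 1 \<le> j \<and> j \<le> Suc n}"
      have "w (0, Suc n) = w' (0, Suc n)" "w (1, 0) = w' (1, 0)" "w (1, Suc n) = w' (1, Suc n)" "w v = w' v"
        using v by (auto intro!: w)
      then show "vertex_step (Suc n) w v = vertex_step (Suc n) w' v"
        by (auto simp: vertex_step_def)
    qed
  qed simp
  also have "\<dots> = (\<integral>\<^sup>+w. f w \<partial>env ((?c n)((1, Suc n) := b)))"
    by (rule vertex_step_invariant[where a = a]) (use c b in \<open>auto intro: depends_on_mono[OF Suc.prems(2)]\<close>)
  also have "(?c n)((1, Suc n) := b) = ?c (Suc n)"
    by (auto simp: fun_eq_iff)
  finally show ?case .
qed

definition boundary_params :: "real \<Rightarrow> real \<Rightarrow> real \<Rightarrow> nat \<times> nat \<Rightarrow> real" where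
  "boundary_params \<mu> z a v = (if fst v = 0 then z else if snd v = 0 then a else \<mu>)"

lemma powr_exp_eq: "exp (x::real) powr \<xi> = exp (\<xi> * x)"
  by (simp add: powr_def)

lemma nn_integral_column_power:
  assumes c: "\<And>v. c v > 0" "\<And>j. 1 \<le> j \<Longrightarrow> c (0, j) = b" and \<xi>: "\<xi> < b"
  shows "(\<integral>\<^sup>+w. ennreal (Zrec w 0 n powr \<xi>) \<partial>env c) = ennreal ((Gamma (b - \<xi>) / Gamma b) ^ n)"
proof (induction n)
  case 0
  interpret prob_space "env c" using c by (intro prob_space_env)
  show ?case using emeasure_space_1 by simp
next
  case (Suc n)
  have b: "b > 0" using c(1)[of "(0, 1)"] c(2)[of 1] by auto
  have "(\<integral>\<^sup>+w. ennreal (Zrec w 0 (Suc n) powr \<xi>) \<partial>env c) =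
    (\<integral>\<^sup>+w. ennreal (exp (\<xi> * w (0, Suc n))) * ennreal (Zrec w 0 n powr \<xi>) \<partial>env c)"
    by (simp add: powr_mult powr_exp_eq ennreal_mult')
  also have "\<dots> = (\<integral>\<^sup>+w. ennreal (exp (\<xi> * w (0, Suc n))) \<partial>env c) * (\<integral>\<^sup>+w. ennreal (Zrec w 0 n powr \<xi>) \<partial>env c)"
    by (rule nn_integral_env_mult[where A = "{(0, Suc n)}" and B = "{..0} \<times> {..n} - {(0, 0)}"])
      (use depends_on_compose[OF depends_on_Zrec[of 0 n], of "\<lambda>x. ennreal (x powr \<xi>)"] c in \<open>auto intro!: depends_onI\<close>)
  also have "(\<integral>\<^sup>+w. ennreal (exp (\<xi> * w (0, Suc n))) \<partial>env c) = (\<integral>\<^sup>+x. ennreal (exp (\<xi> * x)) \<partial>log_inv_gamma b)"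
    using c by (subst nn_integral_env_coord[where h = "\<lambda>x. ennreal (exp (\<xi> * x))"]) auto
  also have "\<dots> = ennreal (Gamma (b - \<xi>) / Gamma b)"
    using \<xi> b by (rule mgf_log_inv_gamma[rotated])
  finally show ?case
    using Gamma_real_pos[of "b - \<xi>"] Gamma_real_pos[of b] \<xi> b
    by (simp add: Suc ennreal_mult'[symmetric] less_imp_le)
qed

text \<open>The boundary parameters differ from the stationary ones exactly by the tilt with the
  \<open>\<xi>\<close>-th power of the horizontal boundary weights, so that the \<open>\<xi>\<close>-th moment of the
  partition function becomes an expectation over the independent increments on the right edge.\<close>

theorem boundary_moment:
  assumes "z < \<mu>" "\<xi> < z" "0 < z" "0 < \<mu> - z + \<xi>"
  shows "(\<integral>\<^sup>+w. ennreal (Zrec w m n powr \<xi>) \<partial>env (boundary_params \<mu> z (\<mu> - z + \<xi>))) =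
     ennreal ((Gamma (z - \<xi>) / Gamma z) ^ n * (Gamma (\<mu> - z) / Gamma (\<mu> - z + \<xi>)) ^ m)"
proof (induction m)
  case 0
  show ?case using assms
    by (subst nn_integral_column_power[where b = z]) (auto simp: boundary_params_def)
next
  case (Suc m)
  let ?a = "\<mu> - z + \<xi>"
  let ?c = "boundary_params \<mu> z ?a"
  let ?c' = "?c((1, 0) := \<mu> - z)"
  let ?c'' = "\<lambda>v. if fst v = 1 \<and> 1 \<le> snd v \<and> snd v \<le> n then z else ?c' v"
  define F where "F w = ennreal (Zrec w m n powr \<xi>)" for w
  define G where "G w = F (shift_env 1 0 (column_step n w))" for w
  have F [measurable]: "F \<in> borel_measurable env_borel" unfolding F_def [abs_def] by measurable
  have G [measurable]: "G \<in> borel_measurable env_borel" unfolding G_def [abs_def] by measurable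
  have pos: "?c v > 0" "?c' v > 0" "?c'' v > 0" for v using assms by (auto simp: boundary_params_def)
  have depF: "depends_on ({..m} \<times> {..n} - {(0, 0)}) F"
    unfolding F_def by (intro depends_on_compose[OF depends_on_Zrec])
  have "ennreal (Zrec w (Suc m) n powr \<xi>) = ennreal (exp (\<xi> * w (1, 0))) * G w" for w
    unfolding Zrec_column_step G_def F_def by (simp add: powr_mult powr_exp_eq ennreal_mult')
  then have "(\<integral>\<^sup>+w. ennreal (Zrec w (Suc m) n powr \<xi>) \<partial>env ?c) =
    (\<integral>\<^sup>+w. ennreal (exp (\<xi> * w (1, 0))) * G w \<partial>env ?c)" by simp
  also have "\<dots> = (\<integral>\<^sup>+w. \<integral>\<^sup>+x. ennreal (exp (\<xi> * x)) * G (w((1, 0) := x)) \<partial>log_inv_gamma ?a \<partial>env ?c)"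
    using nn_integral_env_resample'[where v = "(1, 0)" and c = ?c and f = "\<lambda>w. ennreal (exp (\<xi> * w (1, 0))) * G w", OF _ pos(1)]
    by (simp add: boundary_params_def)
  \<comment> \<open>The tilt turns the parameter of the first horizontal weight from
    \<open>\<mu> - z + \<xi>\<close> into \<open>\<mu> - z\<close>. Together with z this sums to the
    bulk parameter \<mu>, as the Burke property requires.\<close>
  also have "\<dots> = (\<integral>\<^sup>+w. ennreal (Gamma (\<mu> - z) / Gamma ?a) * (\<integral>\<^sup>+x. G (w((1, 0) := x)) \<partial>log_inv_gamma (\<mu> - z)) \<partial>env ?c)"
    using assms by (intro nn_integral_cong, subst tilt_log_inv_gamma) auto
  also have "\<dots> = ennreal (Gamma (\<mu> - z) / Gamma ?a) * (\<integral>\<^sup>+w. \<integral>\<^sup>+x. G (w((1, 0) := x)) \<partial>log_inv_gamma (\<mu> - z) \<partial>env ?c)"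
  proof (rule nn_integral_cmult)
    interpret prob_space "log_inv_gamma (\<mu> - z)" using assms by (intro prob_space_log_inv_gamma) simp
    show "(\<lambda>w. \<integral>\<^sup>+x. G (w((1, 0) := x)) \<partial>log_inv_gamma (\<mu> - z)) \<in> borel_measurable (env ?c)" by measurable
  qed
  also have "(\<integral>\<^sup>+w. \<integral>\<^sup>+x. G (w((1, 0) := x)) \<partial>log_inv_gamma (\<mu> - z) \<partial>env ?c) = (\<integral>\<^sup>+w. G w \<partial>env ?c')"
    using assms pos by (intro nn_integral_env_resample[symmetric]) auto
  also have "\<dots> = (\<integral>\<^sup>+w. F (shift_env 1 0 w) \<partial>env ?c'')"
    unfolding G_def
  proof (rule column_step_invariant[where a = "\<mu> - z"])
    show "?c' v > 0" for v by (rule pos)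
  qed (auto simp: boundary_params_def intro!: depends_onI depends_onD[OF depF])
  also have "\<dots> = (\<integral>\<^sup>+w. F w \<partial>env (shift_env 1 0 ?c''))"
    by (rule nn_integral_env_shift[OF F pos(3)])
  \<comment> \<open>On the rectangle both parameter families agree except at its origin, which
    \<open>F\<close> does not read.\<close>
  also have "\<dots> = (\<integral>\<^sup>+w. F w \<partial>env ?c)"
  proof (rule nn_integral_env_cong_param[OF F depF])
    show "shift_env 1 0 ?c'' v > 0" for v unfolding shift_env_def by (rule pos(3))
    show "?c v > 0" for v by (rule pos(1))
  qed (auto simp: shift_env_def boundary_params_def)
  also have "\<dots> = ennreal ((Gamma (z - \<xi>) / Gamma z) ^ n * (Gamma (\<mu> - z) / Gamma ?a) ^ m)"
    unfolding F_def by (rule Suc)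
  finally show ?case using assms Gamma_real_pos[of "\<mu> - z"] Gamma_real_pos[of ?a]
    by (simp add: ennreal_mult'[symmetric] less_imp_le mult_ac)
qed

definition lmgf :: "real \<Rightarrow> real \<Rightarrow> real" where
  "lmgf \<nu> \<xi> = ln_Gamma (\<nu> - \<xi>) - ln_Gamma \<nu>"

lemma Gamma_ratio_eq_exp: "\<nu> > 0 \<Longrightarrow> \<xi> < \<nu> \<Longrightarrow> Gamma (\<nu> - \<xi>) / Gamma \<nu> = exp (lmgf \<nu> \<xi>)"
  by (simp add: lmgf_def exp_diff Gamma_real_pos_exp)

lemma nn_integral_exp_sum:
  assumes "finite S" and c: "\<And>v. c v > 0" "\<And>v. v \<in> S \<Longrightarrow> \<xi> < c v"
  shows "(\<integral>\<^sup>+w. ennreal (exp (\<xi> * (\<Sum>v\<in>S. w v))) \<partial>env c) = ennreal (exp (\<Sum>v\<in>S. lmgf (c v) \<xi>))"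
  using assms(1,3)
proof (induction S rule: finite_induct)
  case empty
  interpret prob_space "env c" using c by (intro prob_space_env)
  show ?case using emeasure_space_1 by simp
next
  case (insert v S)
  have "(\<integral>\<^sup>+w. ennreal (exp (\<xi> * (\<Sum>v\<in>insert v S. w v))) \<partial>env c) =
    (\<integral>\<^sup>+w. ennreal (exp (\<xi> * w v)) * ennreal (exp (\<xi> * (\<Sum>v\<in>S. w v))) \<partial>env c)"
    using insert by (simp add: distrib_left exp_add ennreal_mult')
  also have "\<dots> = (\<integral>\<^sup>+w. ennreal (exp (\<xi> * w v)) \<partial>env c) * (\<integral>\<^sup>+w. ennreal (exp (\<xi> * (\<Sum>v\<in>S. w v))) \<partial>env c)"
    using insert by (intro nn_integral_env_mult[where A = "{v}" and B = S])
      (auto simp: c intro!: depends_onI sum.cong arg_cong[where f = "\<lambda>x. ennreal (exp (\<xi> * x))"])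
  also have "(\<integral>\<^sup>+w. ennreal (exp (\<xi> * w v)) \<partial>env c) = ennreal (exp (lmgf (c v) \<xi>))"
    using insert c by (subst nn_integral_env_coord[where h = "\<lambda>x. ennreal (exp (\<xi> * x))"])
      (auto simp: mgf_log_inv_gamma Gamma_ratio_eq_exp)
  finally show ?case
    using insert by (simp add: exp_add ennreal_mult')
qed

lemma Zrec_left_edge: "Zrec w 0 n = exp (\<Sum>v\<in>{0} \<times> {1..n}. w v)"
proof (induction n)
  case (Suc n)
  have "{0::nat} \<times> {1..Suc n} = insert (0, Suc n) ({0} \<times> {1..n})" by auto
  then show ?case using Suc by (simp add: exp_add)
qed simp

lemma Zrec_bottom_edge: "Zrec w m 0 = exp (\<Sum>v\<in>{1..m} \<times> {0}. w v)"
proof (induction m)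
  case (Suc m)
  have "{1..Suc m} \<times> {0::nat} = insert (Suc m, 0) ({1..m} \<times> {0})" by auto
  then show ?case using Suc by (simp add: exp_add)
qed simp

definition moment :: "real \<Rightarrow> real \<Rightarrow> nat \<Rightarrow> nat \<Rightarrow> ennreal" where
  "moment \<mu> \<xi> m n = (\<integral>\<^sup>+w. ennreal (Zrec w m n powr \<xi>) \<partial>env (\<lambda>_. \<mu>))"

lemma nn_integral_path_shift:
  assumes c: "\<And>v. c v > 0" and "finite S" "\<And>v. v \<in> S \<Longrightarrow> \<xi> < c v"
    and S: "S \<inter> {v. a \<le> fst v \<and> b \<le> snd v \<and> v \<noteq> (a, b)} = {}"
    and \<mu>: "\<And>i j. c (a + i, b + j) = \<mu>"
  shows "(\<integral>\<^sup>+w. ennreal ((exp (\<Sum>v\<in>S. w v) * Zrec (shift_env a b w) m n) powr \<xi>) \<partial>env c) =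
    ennreal (exp (\<Sum>v\<in>S. lmgf (c v) \<xi>)) * moment \<mu> \<xi> m n"
proof -
  have dep: "depends_on {v. a \<le> fst v \<and> b \<le> snd v \<and> v \<noteq> (a, b)} (\<lambda>w. ennreal (Zrec (shift_env a b w) m n powr \<xi>))"
  proof (rule depends_onI)
    fix w w' :: "nat \<times> nat \<Rightarrow> real"
    assume "\<And>v. v \<in> {v. a \<le> fst v \<and> b \<le> snd v \<and> v \<noteq> (a, b)} \<Longrightarrow> w v = w' v"
    then have "Zrec (shift_env a b w) m n = Zrec (shift_env a b w') m n"
      by (intro Zrec_cong) auto
    then show "ennreal (Zrec (shift_env a b w) m n powr \<xi>) = ennreal (Zrec (shift_env a b w') m n powr \<xi>)" by simp
  qed
  have "(\<integral>\<^sup>+w. ennreal ((exp (\<Sum>v\<in>S. w v) * Zrec (shift_env a b w) m n) powr \<xi>) \<partial>env c) =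
    (\<integral>\<^sup>+w. ennreal (exp (\<xi> * (\<Sum>v\<in>S. w v))) * ennreal (Zrec (shift_env a b w) m n powr \<xi>) \<partial>env c)"
    by (simp add: powr_mult powr_exp_eq ennreal_mult')
  also have "\<dots> = (\<integral>\<^sup>+w. ennreal (exp (\<xi> * (\<Sum>v\<in>S. w v))) \<partial>env c) * (\<integral>\<^sup>+w. ennreal (Zrec (shift_env a b w) m n powr \<xi>) \<partial>env c)"
    by (rule nn_integral_env_mult[OF _ _ _ dep S])
      (auto simp: c intro!: depends_onI sum.cong arg_cong[where f = "\<lambda>x. ennreal (exp (\<xi> * x))"])
  also have "(\<integral>\<^sup>+w. ennreal (Zrec (shift_env a b w) m n powr \<xi>) \<partial>env c) = moment \<mu> \<xi> m n"
  proof -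
    have "shift_env a b c = (\<lambda>_. \<mu>)" using \<mu> by (auto simp: shift_env_def)
    then show ?thesis
      unfolding moment_def using nn_integral_env_shift[of "\<lambda>w. ennreal (Zrec w m n powr \<xi>)" c a b] c by simp
  qed
  also have "(\<integral>\<^sup>+w. ennreal (exp (\<xi> * (\<Sum>v\<in>S. w v))) \<partial>env c) = ennreal (exp (\<Sum>v\<in>S. lmgf (c v) \<xi>))"
    by (rule nn_integral_exp_sum) (use assms in auto)
  finally show ?thesis .
qed

section \<open>Exit points and their moments\<close>

definition left_exit :: "(nat \<times> nat \<Rightarrow> real) \<Rightarrow> nat \<Rightarrow> nat \<Rightarrow> nat \<Rightarrow> real" where
  "left_exit w m n k = Zrec w 0 (Suc k) * exp (w (1, Suc k)) * Zrec (shift_env 1 (Suc k) w) m (n - k)"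

definition bottom_exit :: "(nat \<times> nat \<Rightarrow> real) \<Rightarrow> nat \<Rightarrow> nat \<Rightarrow> nat \<Rightarrow> real" where
  "bottom_exit w m n k = Zrec w (Suc k) 0 * exp (w (Suc k, 1)) * Zrec (shift_env (Suc k) 1 w) (m - k) n"

lemma left_exit_measurable [measurable]: "(\<lambda>w. left_exit w m n k) \<in> borel_measurable env_borel"
  unfolding left_exit_def by measurable

lemma bottom_exit_measurable [measurable]: "(\<lambda>w. bottom_exit w m n k) \<in> borel_measurable env_borel"
  unfolding bottom_exit_def by measurable

lemma left_exit_pos: "left_exit w m n k > 0"
  unfolding left_exit_def by (intro mult_pos_pos) auto

lemma bottom_exit_pos: "bottom_exit w m n k > 0"
  unfolding bottom_exit_def by (intro mult_pos_pos) auto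

lemma Zrec_eq_exits:
  "Zrec w (Suc m) (Suc n) = (\<Sum>k\<le>n. left_exit w m n k) + (\<Sum>k\<le>m. bottom_exit w m n k)"
  unfolding left_exit_def bottom_exit_def by (rule Zrec_exit)

lemma left_exit_le: "k \<le> n \<Longrightarrow> left_exit w m n k \<le> Zrec w (Suc m) (Suc n)"
  unfolding Zrec_eq_exits
  by (intro add_increasing2 member_le_sum sum_nonneg) (auto intro: less_imp_le left_exit_pos bottom_exit_pos)

lemma bottom_exit_le: "k \<le> m \<Longrightarrow> bottom_exit w m n k \<le> Zrec w (Suc m) (Suc n)"
  unfolding Zrec_eq_exits
  by (intro add_increasing member_le_sum sum_nonneg) (auto intro: less_imp_le left_exit_pos bottom_exit_pos)

lemma moment_left_exit:
  assumes c: "\<And>v. c v > 0" and "\<And>j. 1 \<le> j \<Longrightarrow> c (0, j) = b" "\<And>i j. 1 \<le> i \<Longrightarrow> 1 \<le> j \<Longrightarrow> c (i, j) = \<mu>"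
    and "\<xi> < b" "\<xi> < \<mu>"
  shows "(\<integral>\<^sup>+w. ennreal (left_exit w m n k powr \<xi>) \<partial>env c) =
    ennreal (exp (real (Suc k) * lmgf b \<xi> + lmgf \<mu> \<xi>)) * moment \<mu> \<xi> m (n - k)"
proof -
  let ?S = "insert (1, Suc k) ({0} \<times> {1..Suc k})"
  have "left_exit w m n k = exp (\<Sum>v\<in>?S. w v) * Zrec (shift_env 1 (Suc k) w) m (n - k)" for w
    unfolding left_exit_def Zrec_left_edge by (subst sum.insert) (auto simp: exp_add)
  moreover have "(\<Sum>v\<in>?S. lmgf (c v) \<xi>) = real (Suc k) * lmgf b \<xi> + lmgf \<mu> \<xi>"
  proof -
    have "(\<Sum>v\<in>{0} \<times> {1..Suc k}. lmgf (c v) \<xi>) = (\<Sum>v\<in>{0::nat} \<times> {1..Suc k}. lmgf b \<xi>)"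
      using assms by (intro sum.cong) auto
    then show ?thesis using assms by (subst sum.insert) auto
  qed
  moreover have "\<xi> < c v" if "v \<in> ?S" for v using that assms by auto
  ultimately show ?thesis
    using assms by (simp only:, subst nn_integral_path_shift[where \<mu> = \<mu>]) (auto simp: add.commute)
qed

lemma moment_bottom_exit:
  assumes c: "\<And>v. c v > 0" and "\<And>i. 1 \<le> i \<Longrightarrow> c (i, 0) = a" "\<And>i j. 1 \<le> i \<Longrightarrow> 1 \<le> j \<Longrightarrow> c (i, j) = \<mu>"
    and "\<xi> < a" "\<xi> < \<mu>"
  shows "(\<integral>\<^sup>+w. ennreal (bottom_exit w m n k powr \<xi>) \<partial>env c) =
    ennreal (exp (real (Suc k) * lmgf a \<xi> + lmgf \<mu> \<xi>)) * moment \<mu> \<xi> (m - k) n"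
proof -
  let ?S = "insert (Suc k, 1) ({1..Suc k} \<times> {0})"
  have "bottom_exit w m n k = exp (\<Sum>v\<in>?S. w v) * Zrec (shift_env (Suc k) 1 w) (m - k) n" for w
    unfolding bottom_exit_def Zrec_bottom_edge by (subst sum.insert) (auto simp: exp_add)
  moreover have "(\<Sum>v\<in>?S. lmgf (c v) \<xi>) = real (Suc k) * lmgf a \<xi> + lmgf \<mu> \<xi>"
  proof -
    have "(\<Sum>v\<in>{1..Suc k} \<times> {0}. lmgf (c v) \<xi>) = (\<Sum>v\<in>{1..Suc k} \<times> {0::nat}. lmgf a \<xi>)"
      using assms by (intro sum.cong) auto
    then show ?thesis using assms by (subst sum.insert) auto
  qed
  moreover have "\<xi> < c v" if "v \<in> ?S" for v using that assms by auto
  ultimately show ?thesis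
    using assms by (simp only:, subst nn_integral_path_shift[where \<mu> = \<mu>]) (auto simp: add.commute)
qed

lemma boundary_moment_exp:
  assumes "z < \<mu>" "\<xi> < z" "0 < z" "0 < \<mu> - z + \<xi>"
  shows "(\<integral>\<^sup>+w. ennreal (Zrec w m n powr \<xi>) \<partial>env (boundary_params \<mu> z (\<mu> - z + \<xi>))) =
     ennreal (exp (real n * lmgf z \<xi> + real m * lmgf (\<mu> - z + \<xi>) \<xi>))"
proof -
  have "Gamma (\<mu> - z) / Gamma (\<mu> - z + \<xi>) = exp (lmgf (\<mu> - z + \<xi>) \<xi>)"
    using Gamma_ratio_eq_exp[of "\<mu> - z + \<xi>" \<xi>] assms by simp
  then show ?thesis
    by (simp add: boundary_moment[OF assms] Gamma_ratio_eq_exp assms exp_add exp_of_nat_mult)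
qed

text \<open>\<open>left_exit\<close> with k = 0 is a product of one axis weight, the weight at (1,
  1) and a homogeneous partition function of the required size, all independent. The loss against
  the boundary moment is a constant free of m and n, so the bound can later be applied to rectangles
  shortened by an exit.\<close>

lemma moment_upper_bound:
  assumes "z < \<mu>" "0 \<le> \<xi>" "\<xi> < z"
  shows "moment \<mu> \<xi> m n \<le> ennreal (exp (lmgf (\<mu> - z + \<xi>) \<xi> - lmgf \<mu> \<xi>) *
     exp (real n * lmgf z \<xi> + real m * lmgf (\<mu> - z + \<xi>) \<xi>))"
proof -
  let ?c = "boundary_params \<mu> z (\<mu> - z + \<xi>)"
  let ?A = "lmgf z \<xi>" and ?B = "lmgf (\<mu> - z + \<xi>) \<xi>"
  have "ennreal (exp (?A + lmgf \<mu> \<xi>)) * moment \<mu> \<xi> m n = (\<integral>\<^sup>+w. ennreal (left_exit w m n 0 powr \<xi>) \<partial>env ?c)"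
    using assms by (subst moment_left_exit[where b = z and \<mu> = \<mu>]) (auto simp: boundary_params_def)
  also have "\<dots> \<le> (\<integral>\<^sup>+w. ennreal (Zrec w (Suc m) (Suc n) powr \<xi>) \<partial>env ?c)"
    using assms by (intro nn_integral_mono ennreal_leI powr_mono2 left_exit_le) (auto intro: less_imp_le left_exit_pos)
  also have "\<dots> = ennreal (exp (real (Suc n) * ?A + real (Suc m) * ?B))"
    by (rule boundary_moment_exp) (use assms in auto)
  finally have *: "ennreal (exp (?A + lmgf \<mu> \<xi>)) * moment \<mu> \<xi> m n \<le> ennreal (exp (real (Suc n) * ?A + real (Suc m) * ?B))" .
  have "moment \<mu> \<xi> m n = ennreal (exp (- (?A + lmgf \<mu> \<xi>))) * (ennreal (exp (?A + lmgf \<mu> \<xi>)) * moment \<mu> \<xi> m n)"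
    by (simp add: mult.assoc[symmetric] ennreal_mult'[symmetric] exp_add[symmetric])
  also have "\<dots> \<le> ennreal (exp (- (?A + lmgf \<mu> \<xi>))) * ennreal (exp (real (Suc n) * ?A + real (Suc m) * ?B))"
    by (intro mult_left_mono *) auto
  also have "\<dots> = ennreal (exp (?B - lmgf \<mu> \<xi>) * exp (real n * ?A + real m * ?B))"
    by (simp add: ennreal_mult'[symmetric] exp_add[symmetric] algebra_simps)
  finally show ?thesis .
qed

text \<open>Forcing homogeneous paths up the left column for k + 1 steps and then to the right
  compares the shortened rectangle with the full one. The price in the exponent is linear in
  k.\<close>

lemma moment_left_near:
  assumes "\<mu> > 0" "0 \<le> \<xi>" "\<xi> < \<mu>" "k \<le> n"
  shows "ennreal (exp (real (k + 2) * lmgf \<mu> \<xi>)) * moment \<mu> \<xi> m (n - k) \<le> moment \<mu> \<xi> (Suc m) (Suc n)"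
proof -
  have "ennreal (exp (real (k + 2) * lmgf \<mu> \<xi>)) * moment \<mu> \<xi> m (n - k) =
    (\<integral>\<^sup>+w. ennreal (left_exit w m n k powr \<xi>) \<partial>env (\<lambda>_. \<mu>))"
    using assms by (subst moment_left_exit[where b = \<mu> and \<mu> = \<mu>]) (auto simp: algebra_simps)
  also have "\<dots> \<le> moment \<mu> \<xi> (Suc m) (Suc n)"
    unfolding moment_def using assms
    by (intro nn_integral_mono ennreal_leI powr_mono2 left_exit_le) (auto intro: less_imp_le left_exit_pos)
  finally show ?thesis .
qed

lemma moment_bottom_near:
  assumes "\<mu> > 0" "0 \<le> \<xi>" "\<xi> < \<mu>" "k \<le> m"
  shows "ennreal (exp (real (k + 2) * lmgf \<mu> \<xi>)) * moment \<mu> \<xi> (m - k) n \<le> moment \<mu> \<xi> (Suc m) (Suc n)"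
proof -
  have "ennreal (exp (real (k + 2) * lmgf \<mu> \<xi>)) * moment \<mu> \<xi> (m - k) n =
    (\<integral>\<^sup>+w. ennreal (bottom_exit w m n k powr \<xi>) \<partial>env (\<lambda>_. \<mu>))"
    using assms by (subst moment_bottom_exit[where a = \<mu> and \<mu> = \<mu>]) (auto simp: algebra_simps)
  also have "\<dots> \<le> moment \<mu> \<xi> (Suc m) (Suc n)"
    unfolding moment_def using assms
    by (intro nn_integral_mono ennreal_leI powr_mono2 bottom_exit_le) (auto intro: less_imp_le bottom_exit_pos)
  finally show ?thesis .
qed

text \<open>A sum is at most its number of terms times its largest term. This treats exponents below
  and above 1 alike, and for exit sums the factor is polynomial in the size of the rectangle, hence
  invisible on the exponential scale.\<close>

lemma sum_powr_le:
  fixes f :: "'b \<Rightarrow> real"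
  assumes "finite S" "S \<noteq> {}" "\<And>i. i \<in> S \<Longrightarrow> f i > 0" "\<xi> \<ge> 0"
  shows "(\<Sum>i\<in>S. f i) powr \<xi> \<le> real (card S) powr \<xi> * (\<Sum>i\<in>S. f i powr \<xi>)"
proof -
  define M where "M = Max (f ` S)"
  have "M \<in> f ` S" unfolding M_def using assms by (intro Max_in) auto
  then obtain i where i: "i \<in> S" "M = f i" by auto
  have "(\<Sum>i\<in>S. f i) \<le> real (card S) * M"
    using assms by (intro sum_bounded_above) (auto simp: M_def)
  moreover have "0 \<le> (\<Sum>i\<in>S. f i)"
    using assms by (intro sum_nonneg less_imp_le)
  ultimately have "(\<Sum>i\<in>S. f i) powr \<xi> \<le> (real (card S) * M) powr \<xi>"
    by (intro powr_mono2 assms(4))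
  also have "\<dots> = real (card S) powr \<xi> * f i powr \<xi>"
    using i assms(3)[of i] by (simp add: powr_mult)
  also have "\<dots> \<le> real (card S) powr \<xi> * (\<Sum>i\<in>S. f i powr \<xi>)"
    using i(1) assms(1) by (intro mult_left_mono member_le_sum[of i S "\<lambda>i. f i powr \<xi>"]) auto
  finally show ?thesis .
qed

lemma Zrec_powr_le_exits:
  assumes "\<xi> \<ge> 0"
  shows "Zrec w (Suc m) (Suc n) powr \<xi> \<le> real (m + n + 2) powr \<xi> *
    ((\<Sum>k\<le>n. left_exit w m n k powr \<xi>) + (\<Sum>k\<le>m. bottom_exit w m n k powr \<xi>))"
proof -
  let ?S = "{..n} <+> {..m}"
  let ?f = "case_sum (left_exit w m n) (bottom_exit w m n)"
  have 1: "Zrec w (Suc m) (Suc n) = (\<Sum>i\<in>?S. ?f i)"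
    unfolding Zrec_eq_exits by (simp add: sum.Plus)
  have 2: "(\<Sum>i\<in>?S. ?f i powr \<xi>) = (\<Sum>k\<le>n. left_exit w m n k powr \<xi>) + (\<Sum>k\<le>m. bottom_exit w m n k powr \<xi>)"
    by (simp add: sum.Plus)
  have 3: "card ?S = m + n + 2" by (simp add: card_Plus)
  have 4: "?f i > 0" for i by (cases i) (auto simp: left_exit_pos bottom_exit_pos)
  have "(\<Sum>i\<in>?S. ?f i) powr \<xi> \<le> real (card ?S) powr \<xi> * (\<Sum>i\<in>?S. ?f i powr \<xi>)"
    by (rule sum_powr_le) (use 4 assms in auto)
  then show ?thesis unfolding 1 2 3 .
qed

section \<open>Moments of the partition function\<close>

text \<open>The parameter z of the upper bound may differ from the parameter b of the axis. An exit
  at height k + 1 replaces k + 1 factors of rate \<open>lmgf z \<xi>\<close> by factors of rate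
  \<open>lmgf b \<xi>\<close>, so it falls short of the boundary moment at z by their difference in
  every step.\<close>

lemma far_left_exit:
  assumes c: "\<And>v. c v > 0" and "\<And>j. 1 \<le> j \<Longrightarrow> c (0, j) = b" "\<And>i j. 1 \<le> i \<Longrightarrow> 1 \<le> j \<Longrightarrow> c (i, j) = \<mu>"
    and "\<xi> < b" and z: "z < \<mu>" "0 \<le> \<xi>" "\<xi> < z" and A: "lmgf b \<xi> \<le> lmgf z \<xi>" and k: "K \<le> Suc k" "k \<le> n"
  shows "(\<integral>\<^sup>+w. ennreal (left_exit w m n k powr \<xi>) \<partial>env c) \<le>
    ennreal (exp (real (Suc n) * lmgf z \<xi> + real (Suc m) * lmgf (\<mu> - z + \<xi>) \<xi> - real K * (lmgf z \<xi> - lmgf b \<xi>)))"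
proof -
  let ?A = "lmgf z \<xi>" and ?B = "lmgf (\<mu> - z + \<xi>) \<xi>"
  have "(\<integral>\<^sup>+w. ennreal (left_exit w m n k powr \<xi>) \<partial>env c) =
    ennreal (exp (real (Suc k) * lmgf b \<xi> + lmgf \<mu> \<xi>)) * moment \<mu> \<xi> m (n - k)"
    using assms by (intro moment_left_exit) auto
  also have "\<dots> \<le> ennreal (exp (real (Suc k) * lmgf b \<xi> + lmgf \<mu> \<xi>)) *
    ennreal (exp (?B - lmgf \<mu> \<xi>) * exp (real (n - k) * ?A + real m * ?B))"
    by (intro mult_left_mono moment_upper_bound z) auto
  also have "\<dots> = ennreal (exp (real (Suc n) * ?A + real (Suc m) * ?B - real (Suc k) * (?A - lmgf b \<xi>)))"
    using k by (simp add: ennreal_mult'[symmetric] exp_add[symmetric] of_nat_diff algebra_simps)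
  also have "\<dots> \<le> ennreal (exp (real (Suc n) * ?A + real (Suc m) * ?B - real K * (?A - lmgf b \<xi>)))"
    using A k by (intro ennreal_leI iffD2[OF exp_le_cancel_iff] diff_left_mono mult_right_mono) auto
  finally show ?thesis .
qed

text \<open>\<open>moment_upper_bound\<close> comes from a vertical first step, which breaks the
  symmetry of the axes: the exponents are n and m + 2 here instead of n + 1 and m + 1. The
  difference is only a constant factor.\<close>

lemma far_bottom_exit:
  assumes c: "\<And>v. c v > 0" and "\<And>i. 1 \<le> i \<Longrightarrow> c (i, 0) = a" "\<And>i j. 1 \<le> i \<Longrightarrow> 1 \<le> j \<Longrightarrow> c (i, j) = \<mu>"
    and "\<xi> < a" and z: "z < \<mu>" "0 \<le> \<xi>" "\<xi> < z" and B: "lmgf a \<xi> \<le> lmgf (\<mu> - z + \<xi>) \<xi>"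
    and k: "K \<le> Suc k" "k \<le> m"
  shows "(\<integral>\<^sup>+w. ennreal (bottom_exit w m n k powr \<xi>) \<partial>env c) \<le>
    ennreal (exp (real n * lmgf z \<xi> + real (Suc (Suc m)) * lmgf (\<mu> - z + \<xi>) \<xi> - real K * (lmgf (\<mu> - z + \<xi>) \<xi> - lmgf a \<xi>)))"
proof -
  let ?A = "lmgf z \<xi>" and ?B = "lmgf (\<mu> - z + \<xi>) \<xi>"
  have "(\<integral>\<^sup>+w. ennreal (bottom_exit w m n k powr \<xi>) \<partial>env c) =
    ennreal (exp (real (Suc k) * lmgf a \<xi> + lmgf \<mu> \<xi>)) * moment \<mu> \<xi> (m - k) n"
    using assms by (intro moment_bottom_exit) auto
  also have "\<dots> \<le> ennreal (exp (real (Suc k) * lmgf a \<xi> + lmgf \<mu> \<xi>)) *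
    ennreal (exp (?B - lmgf \<mu> \<xi>) * exp (real n * ?A + real (m - k) * ?B))"
    by (intro mult_left_mono moment_upper_bound z) auto
  also have "\<dots> = ennreal (exp (real n * ?A + real (Suc (Suc m)) * ?B - real (Suc k) * (?B - lmgf a \<xi>)))"
    using k by (simp add: ennreal_mult'[symmetric] exp_add[symmetric] of_nat_diff algebra_simps)
  also have "\<dots> \<le> ennreal (exp (real n * ?A + real (Suc (Suc m)) * ?B - real K * (?B - lmgf a \<xi>)))"
    using B k by (intro ennreal_leI iffD2[OF exp_le_cancel_iff] diff_left_mono mult_right_mono) auto
  finally show ?thesis .
qed

lemma near_left_exit:
  assumes "\<mu> > 0" "0 \<le> \<xi>" "\<xi> < \<mu>" "\<And>v. c v > 0" "\<And>j. 1 \<le> j \<Longrightarrow> c (0, j) = b" "\<And>i j. 1 \<le> i \<Longrightarrow> 1 \<le> j \<Longrightarrow> c (i, j) = \<mu>"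
    and "\<xi> < b" and D: "\<bar>lmgf b \<xi>\<bar> + \<bar>lmgf \<mu> \<xi>\<bar> \<le> D" and k: "Suc k \<le> K" "k \<le> n"
  shows "(\<integral>\<^sup>+w. ennreal (left_exit w m n k powr \<xi>) \<partial>env c) \<le> ennreal (exp (real K * D)) * moment \<mu> \<xi> (Suc m) (Suc n)"
proof -
  have "real (Suc k) * (lmgf b \<xi> - lmgf \<mu> \<xi>) \<le> real (Suc k) * D"
    using D by (intro mult_left_mono) auto
  also have "\<dots> \<le> real K * D"
    using k D by (intro mult_right_mono) auto
  finally have le: "real (Suc k) * (lmgf b \<xi> - lmgf \<mu> \<xi>) \<le> real K * D" .
  have "(\<integral>\<^sup>+w. ennreal (left_exit w m n k powr \<xi>) \<partial>env c) =
    ennreal (exp (real (Suc k) * lmgf b \<xi> + lmgf \<mu> \<xi>)) * moment \<mu> \<xi> m (n - k)"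
    using assms by (intro moment_left_exit) auto
  also have "\<dots> = ennreal (exp (real (Suc k) * (lmgf b \<xi> - lmgf \<mu> \<xi>))) *
     (ennreal (exp (real (k + 2) * lmgf \<mu> \<xi>)) * moment \<mu> \<xi> m (n - k))"
    by (simp only: mult.assoc[symmetric] ennreal_mult'[symmetric] exp_ge_zero exp_add[symmetric])
      (simp add: algebra_simps)
  also have "\<dots> \<le> ennreal (exp (real K * D)) * moment \<mu> \<xi> (Suc m) (Suc n)"
    using le assms by (intro mult_mono moment_left_near ennreal_leI) auto
  finally show ?thesis .
qed

lemma near_bottom_exit:
  assumes "\<mu> > 0" "0 \<le> \<xi>" "\<xi> < \<mu>" "\<And>v. c v > 0" "\<And>i. 1 \<le> i \<Longrightarrow> c (i, 0) = a" "\<And>i j. 1 \<le> i \<Longrightarrow> 1 \<le> j \<Longrightarrow> c (i, j) = \<mu>"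
    and "\<xi> < a" and D: "\<bar>lmgf a \<xi>\<bar> + \<bar>lmgf \<mu> \<xi>\<bar> \<le> D" and k: "Suc k \<le> K" "k \<le> m"
  shows "(\<integral>\<^sup>+w. ennreal (bottom_exit w m n k powr \<xi>) \<partial>env c) \<le> ennreal (exp (real K * D)) * moment \<mu> \<xi> (Suc m) (Suc n)"
proof -
  have "real (Suc k) * (lmgf a \<xi> - lmgf \<mu> \<xi>) \<le> real (Suc k) * D"
    using D by (intro mult_left_mono) auto
  also have "\<dots> \<le> real K * D"
    using k D by (intro mult_right_mono) auto
  finally have le: "real (Suc k) * (lmgf a \<xi> - lmgf \<mu> \<xi>) \<le> real K * D" .
  have "(\<integral>\<^sup>+w. ennreal (bottom_exit w m n k powr \<xi>) \<partial>env c) =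
    ennreal (exp (real (Suc k) * lmgf a \<xi> + lmgf \<mu> \<xi>)) * moment \<mu> \<xi> (m - k) n"
    using assms by (intro moment_bottom_exit) auto
  also have "\<dots> = ennreal (exp (real (Suc k) * (lmgf a \<xi> - lmgf \<mu> \<xi>))) *
     (ennreal (exp (real (k + 2) * lmgf \<mu> \<xi>)) * moment \<mu> \<xi> (m - k) n)"
    by (simp only: mult.assoc[symmetric] ennreal_mult'[symmetric] exp_ge_zero exp_add[symmetric])
      (simp add: algebra_simps)
  also have "\<dots> \<le> ennreal (exp (real K * D)) * moment \<mu> \<xi> (Suc m) (Suc n)"
    using le assms by (intro mult_mono moment_bottom_near ennreal_leI) auto
  finally show ?thesis .
qed

text \<open>The exact boundary moment at z0 is split over the exits. Those up to K are compared with
  the homogeneous moment, the others with boundary moments at z1 or z2. Two auxiliary parameters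
  appear because left exits will be penalised by lowering z and bottom exits by raising it.\<close>

lemma moment_lower_ineq:
  assumes \<xi>: "0 \<le> \<xi>" and z0: "\<xi> < z0" "z0 < \<mu>" and z1: "\<xi> < z1" "z1 < \<mu>" "lmgf z0 \<xi> \<le> lmgf z1 \<xi>"
    and z2: "\<xi> < z2" "z2 < \<mu>" "lmgf (\<mu> - z0 + \<xi>) \<xi> \<le> lmgf (\<mu> - z2 + \<xi>) \<xi>"
    and D: "\<bar>lmgf z0 \<xi>\<bar> + \<bar>lmgf \<mu> \<xi>\<bar> \<le> D" "\<bar>lmgf (\<mu> - z0 + \<xi>) \<xi>\<bar> + \<bar>lmgf \<mu> \<xi>\<bar> \<le> D"
  shows "ennreal (exp (real (Suc n) * lmgf z0 \<xi> + real (Suc m) * lmgf (\<mu> - z0 + \<xi>) \<xi>)) \<le>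
    ennreal (real (m + n + 2) powr (\<xi> + 1)) * (ennreal (exp (real K * D)) * moment \<mu> \<xi> (Suc m) (Suc n) +
      ennreal (exp (real (Suc n) * lmgf z1 \<xi> + real (Suc m) * lmgf (\<mu> - z1 + \<xi>) \<xi> - real K * (lmgf z1 \<xi> - lmgf z0 \<xi>)) +
        exp (real n * lmgf z2 \<xi> + real (Suc (Suc m)) * lmgf (\<mu> - z2 + \<xi>) \<xi> - real K * (lmgf (\<mu> - z2 + \<xi>) \<xi> - lmgf (\<mu> - z0 + \<xi>) \<xi>))))"
    (is "?L \<le> ennreal (?P powr (\<xi> + 1)) * (?X + ennreal (?Y1 + ?Y2))")
proof -
  let ?c = "boundary_params \<mu> z0 (\<mu> - z0 + \<xi>)"
  have c: "?c v > 0" "1 \<le> j \<Longrightarrow> ?c (0, j) = z0" "1 \<le> i \<Longrightarrow> ?c (i, 0) = \<mu> - z0 + \<xi>" "1 \<le> i \<Longrightarrow> 1 \<le> j \<Longrightarrow> ?c (i, j) = \<mu>" for v i j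
    using z0 \<xi> by (auto simp: boundary_params_def)
  have pos: "\<mu> > 0" "\<xi> < \<mu>" "\<xi> < \<mu> - z0 + \<xi>" using z0 \<xi> by auto
  have L: "(\<integral>\<^sup>+w. ennreal (left_exit w m n k powr \<xi>) \<partial>env ?c) \<le> ?X + ennreal (?Y1 + ?Y2)" if "k \<le> n" for k
  proof (cases "Suc k \<le> K")
    case True
    have "(\<integral>\<^sup>+w. ennreal (left_exit w m n k powr \<xi>) \<partial>env ?c) \<le> ?X"
      by (rule near_left_exit[where b = z0]) (use c pos D \<xi> z0 True that in auto)
    then show ?thesis by (rule order_trans) simp
  next
    case False
    have "(\<integral>\<^sup>+w. ennreal (left_exit w m n k powr \<xi>) \<partial>env ?c) \<le> ennreal ?Y1"
      by (rule far_left_exit[where b = z0]) (use c pos z1 \<xi> z0 False that in auto)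
    also have "\<dots> \<le> ?X + ennreal (?Y1 + ?Y2)" by (rule add_increasing, simp, rule ennreal_leI, simp)
    finally show ?thesis .
  qed
  have B: "(\<integral>\<^sup>+w. ennreal (bottom_exit w m n k powr \<xi>) \<partial>env ?c) \<le> ?X + ennreal (?Y1 + ?Y2)" if "k \<le> m" for k
  proof (cases "Suc k \<le> K")
    case True
    have "(\<integral>\<^sup>+w. ennreal (bottom_exit w m n k powr \<xi>) \<partial>env ?c) \<le> ?X"
      by (rule near_bottom_exit[where a = "\<mu> - z0 + \<xi>"]) (use c pos D \<xi> z0 True that in auto)
    then show ?thesis by (rule order_trans) simp
  next
    case False
    have "(\<integral>\<^sup>+w. ennreal (bottom_exit w m n k powr \<xi>) \<partial>env ?c) \<le> ennreal ?Y2"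
      by (rule far_bottom_exit[where a = "\<mu> - z0 + \<xi>"]) (use c pos z2 \<xi> z0 False that in auto)
    also have "\<dots> \<le> ?X + ennreal (?Y1 + ?Y2)" by (rule add_increasing, simp, rule ennreal_leI, simp)
    finally show ?thesis .
  qed
  have "?L = (\<integral>\<^sup>+w. ennreal (Zrec w (Suc m) (Suc n) powr \<xi>) \<partial>env ?c)"
    using z0 \<xi> by (intro boundary_moment_exp[symmetric]) auto
  also have "\<dots> \<le> (\<integral>\<^sup>+w. ennreal (?P powr \<xi>) *
    ((\<Sum>k\<le>n. ennreal (left_exit w m n k powr \<xi>)) + (\<Sum>k\<le>m. ennreal (bottom_exit w m n k powr \<xi>))) \<partial>env ?c)"
    using Zrec_powr_le_exits[OF \<xi>]
    by (intro nn_integral_mono) (simp add: ennreal_mult'[symmetric] ennreal_plus[symmetric] sum_nonneg ennreal_leI del: ennreal_plus)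
  also have "\<dots> = ennreal (?P powr \<xi>) *
    ((\<Sum>k\<le>n. \<integral>\<^sup>+w. ennreal (left_exit w m n k powr \<xi>) \<partial>env ?c) + (\<Sum>k\<le>m. \<integral>\<^sup>+w. ennreal (bottom_exit w m n k powr \<xi>) \<partial>env ?c))"
    by (simp add: nn_integral_cmult nn_integral_add nn_integral_sum del: sum_ennreal)
  also have "\<dots> \<le> ennreal (?P powr \<xi>) *
    ((\<Sum>k\<le>n. ?X + ennreal (?Y1 + ?Y2)) + (\<Sum>k\<le>m. ?X + ennreal (?Y1 + ?Y2)))"
    by (intro mult_left_mono add_mono sum_mono L B) auto
  \<comment> \<open>The number of exits supplies one more power of \<open>m + n + 2\<close>.\<close>
  also have "\<dots> = ennreal (?P powr \<xi>) * (of_nat (m + n + 2) * (?X + ennreal (?Y1 + ?Y2)))"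
    by (simp add: algebra_simps)
  also have "\<dots> = ennreal (?P powr (\<xi> + 1)) * (?X + ennreal (?Y1 + ?Y2))"
    by (simp only: powr_add ennreal_of_nat_eq_real_of_nat mult.assoc[symmetric] ennreal_mult'[symmetric] powr_ge_zero) simp
  finally show ?thesis .
qed


text \<open>The exponential rate of the boundary moment. Its second term is -s M_{\<mu>-z}(-\<xi>),
  so this is the expression under the infimum in \<open>rate_function\<close>.\<close>

definition gfun :: "real \<Rightarrow> real \<Rightarrow> real \<Rightarrow> real \<Rightarrow> real \<Rightarrow> real" where
  "gfun \<mu> s t \<xi> z = t * lmgf z \<xi> + s * lmgf (\<mu> - z + \<xi>) \<xi>"

definition ldim :: "real \<Rightarrow> nat \<Rightarrow> nat" where
  "ldim x N = nat \<lfloor>real N * x\<rfloor>"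

lemma ldim_bounds: "x \<ge> 0 \<Longrightarrow> real (ldim x N) \<le> real N * x" "x \<ge> 0 \<Longrightarrow> real (ldim x N) \<ge> real N * x - 1"
  unfolding ldim_def by (simp_all add: floor_correct)

lemma ldim_mult_bound: "x \<ge> 0 \<Longrightarrow> \<bar>real (ldim x N) * A - real N * x * A\<bar> \<le> \<bar>A\<bar>"
proof -
  assume "x \<ge> 0"
  have "\<bar>real (ldim x N) * A - real N * x * A\<bar> = \<bar>real (ldim x N) - real N * x\<bar> * \<bar>A\<bar>"
    by (simp add: left_diff_distrib abs_mult[symmetric])
  also have "\<dots> \<le> 1 * \<bar>A\<bar>"
    using ldim_bounds[OF \<open>x \<ge> 0\<close>, of N] by (intro mult_right_mono) auto
  finally show ?thesis by simp
qed

lemma eventually_ldim_ge: "x > 0 \<Longrightarrow> eventually (\<lambda>N. k \<le> ldim x N) sequentially"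
proof -
  assume x: "x > 0"
  have "filterlim (\<lambda>N. real N * x) at_top sequentially" using x by real_asymp
  then have "eventually (\<lambda>N. real k + 1 \<le> real N * x) sequentially"
    by (simp add: filterlim_at_top)
  then show ?thesis
    by eventually_elim (use ldim_bounds(2)[of x] x in \<open>smt (verit) of_nat_le_iff\<close>)
qed

lemma moment_finite:
  assumes "0 \<le> \<xi>" "\<xi> < \<mu>"
  shows "moment \<mu> \<xi> m n < \<infinity>"
proof -
  obtain z where "\<xi> < z" "z < \<mu>" using dense[OF assms(2)] by auto
  then show ?thesis using moment_upper_bound[of z \<mu> \<xi> m n] assms
    by (metis ennreal_less_top infinity_ennreal_def order_le_less_trans)
qed

lemma DERIV_lmgf_param:
  assumes "z > 0" "\<xi> < z"
  shows "((\<lambda>z. lmgf z \<xi>) has_real_derivative (Digamma (z - \<xi>) - Digamma z)) (at z)"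
  unfolding lmgf_def using assms by (auto intro!: derivative_eq_intros)

lemma DERIV_lmgf_param':
  assumes "z < \<mu>" "0 < \<mu> - z + \<xi>"
  shows "((\<lambda>z. lmgf (\<mu> - z + \<xi>) \<xi>) has_real_derivative (Digamma (\<mu> - z + \<xi>) - Digamma (\<mu> - z))) (at z)"
  unfolding lmgf_def using assms by (auto intro!: derivative_eq_intros)

text \<open>Moving a critical point \<open>z\<close> by \<open>h\<close> changes \<open>gfun\<close> only by \<open>o(h)\<close> but the exponent
  of either boundary to first order. This separates distant exit points.\<close>

lemma gfun_perturb:
  assumes \<xi>: "0 < \<xi>" "\<xi> < z" "z < \<mu>" and st: "s > 0" "t > 0" and \<epsilon>: "\<epsilon> > 0"
    and crit: "t * (Digamma (z - \<xi>) - Digamma z) + s * (Digamma (\<mu> - z + \<xi>) - Digamma (\<mu> - z)) = 0"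
  shows "\<exists>z1. \<xi> < z1 \<and> z1 < \<mu> \<and> lmgf z \<xi> \<le> lmgf z1 \<xi> \<and>
           gfun \<mu> s t \<xi> z1 - \<epsilon> * (lmgf z1 \<xi> - lmgf z \<xi>) < gfun \<mu> s t \<xi> z" (is ?A)
    and "\<exists>z2. \<xi> < z2 \<and> z2 < \<mu> \<and> lmgf (\<mu> - z + \<xi>) \<xi> \<le> lmgf (\<mu> - z2 + \<xi>) \<xi> \<and>
           gfun \<mu> s t \<xi> z2 - \<epsilon> * (lmgf (\<mu> - z2 + \<xi>) \<xi> - lmgf (\<mu> - z + \<xi>) \<xi>) < gfun \<mu> s t \<xi> z" (is ?B)
proof -
  let ?a = "Digamma (z - \<xi>) - Digamma z" and ?b = "Digamma (\<mu> - z + \<xi>) - Digamma (\<mu> - z)"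
  have a: "?a < 0" using \<xi> Digamma_real_strict_mono[of "z - \<xi>" z] by auto
  have b: "?b > 0" using \<xi> Digamma_real_strict_mono[of "\<mu> - z" "\<mu> - z + \<xi>"] by auto
  have dA: "((\<lambda>z. lmgf z \<xi>) has_real_derivative ?a) (at z)" by (rule DERIV_lmgf_param) (use \<xi> in auto)
  have dB: "((\<lambda>z. lmgf (\<mu> - z + \<xi>) \<xi>) has_real_derivative ?b) (at z)" by (rule DERIV_lmgf_param') (use \<xi> in auto)
  have dG: "((\<lambda>z. gfun \<mu> s t \<xi> z) has_real_derivative 0) (at z)"
    unfolding gfun_def by (rule derivative_eq_intros dA dB refl | (use crit in \<open>simp add: mult.commute\<close>))+
  have d1: "((\<lambda>z1. gfun \<mu> s t \<xi> z1 - \<epsilon> * lmgf z1 \<xi>) has_real_derivative (- \<epsilon> * ?a)) (at z)"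
    by (rule derivative_eq_intros dG dA refl | simp)+
  have d2: "((\<lambda>z2. gfun \<mu> s t \<xi> z2 - \<epsilon> * lmgf (\<mu> - z2 + \<xi>) \<xi>) has_real_derivative (- \<epsilon> * ?b)) (at z)"
    by (rule derivative_eq_intros dG dB refl | simp)+
  show ?A
  proof -
    have "0 < - \<epsilon> * ?a" using mult_pos_neg[OF \<epsilon> a] by simp
    from DERIV_pos_inc_left[OF d1 this] obtain e1 where
      e1: "e1 > 0" "\<And>h. 0 < h \<Longrightarrow> h < e1 \<Longrightarrow> gfun \<mu> s t \<xi> (z - h) - \<epsilon> * lmgf (z - h) \<xi> < gfun \<mu> s t \<xi> z - \<epsilon> * lmgf z \<xi>"
      by auto
    from DERIV_neg_dec_left[OF dA a] obtain e2 where
      e2: "e2 > 0" "\<And>h. 0 < h \<Longrightarrow> h < e2 \<Longrightarrow> lmgf z \<xi> < lmgf (z - h) \<xi>" by auto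
    define h where "h = min (min e1 e2) (z - \<xi>) / 2"
    have "0 < h" "h < e1" "h < e2" "h < z - \<xi>" unfolding h_def using e1 e2 \<xi> by (auto simp: min_def)
    then show ?thesis using e1(2)[of h] e2(2)[of h] \<xi>
      by (intro exI[of _ "z - h"]) (auto simp: algebra_simps)
  qed
  show ?B
  proof -
    have "- \<epsilon> * ?b < 0" using b \<epsilon> by simp
    from DERIV_neg_dec_right[OF d2 this] obtain e1 where
      e1: "e1 > 0" "\<And>h. 0 < h \<Longrightarrow> h < e1 \<Longrightarrow> gfun \<mu> s t \<xi> (z + h) - \<epsilon> * lmgf (\<mu> - (z + h) + \<xi>) \<xi> < gfun \<mu> s t \<xi> z - \<epsilon> * lmgf (\<mu> - z + \<xi>) \<xi>"
      by auto
    from DERIV_pos_inc_right[OF dB b] obtain e2 where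
      e2: "e2 > 0" "\<And>h. 0 < h \<Longrightarrow> h < e2 \<Longrightarrow> lmgf (\<mu> - z + \<xi>) \<xi> < lmgf (\<mu> - (z + h) + \<xi>) \<xi>" by auto
    define h where "h = min (min e1 e2) (\<mu> - z) / 2"
    have "0 < h" "h < e1" "h < e2" "h < \<mu> - z" unfolding h_def using e1 e2 \<xi> by (auto simp: min_def)
    then show ?thesis using e1(2)[of h] e2(2)[of h] \<xi>
      by (intro exI[of _ "z + h"]) (auto simp: algebra_simps)
  qed
qed

text \<open>With K of order \<epsilon>N the far exits are exponentially smaller than the exact
  boundary moment by \<open>gfun_perturb\<close>. The near exits must therefore carry it, and they
  exceed the homogeneous moment by at most exp(O(\<epsilon>N)).\<close>

lemma moment_asymptotic_lower:
  assumes \<xi>: "0 < \<xi>" "\<xi> < z0" "z0 < \<mu>" and st: "s > 0" "t > 0" and \<delta>: "\<delta> > 0"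
    and crit: "t * (Digamma (z0 - \<xi>) - Digamma z0) + s * (Digamma (\<mu> - z0 + \<xi>) - Digamma (\<mu> - z0)) = 0"
  shows "eventually (\<lambda>N. ennreal (exp (real N * (gfun \<mu> s t \<xi> z0 - \<delta>))) \<le> moment \<mu> \<xi> (ldim s N) (ldim t N)) sequentially"
proof -
  let ?A = "\<lambda>z. lmgf z \<xi>" and ?B = "\<lambda>z. lmgf (\<mu> - z + \<xi>) \<xi>" and ?g = "gfun \<mu> s t \<xi>"
  define D where "D = \<bar>?A z0\<bar> + \<bar>?B z0\<bar> + \<bar>lmgf \<mu> \<xi>\<bar>"
  have D: "D \<ge> 0" unfolding D_def by simp
  \<comment> \<open>Exits up to \<epsilon>N cost a factor exp(\<epsilon>DN), which has to stay below
    the allowed loss exp(\<delta>N).\<close>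
  define \<epsilon> where "\<epsilon> = \<delta> / (2 * (D + 1))"
  have \<epsilon>: "\<epsilon> > 0" using \<delta> D by (simp add: \<epsilon>_def)
  have "\<epsilon> * D < \<delta>"
  proof -
    have "\<epsilon> * D = \<delta> * (D / (2 * (D + 1)))" by (simp add: \<epsilon>_def)
    also have "\<dots> < \<delta> * 1" using \<delta> D by (intro mult_strict_left_mono) auto
    finally show ?thesis by simp
  qed
  obtain z1 where z1: "\<xi> < z1" "z1 < \<mu>" "?A z0 \<le> ?A z1" "?g z1 - \<epsilon> * (?A z1 - ?A z0) < ?g z0"
    using gfun_perturb(1)[OF \<xi> st \<epsilon> crit] by auto
  obtain z2 where z2: "\<xi> < z2" "z2 < \<mu>" "?B z0 \<le> ?B z2" "?g z2 - \<epsilon> * (?B z2 - ?B z0) < ?g z0"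
    using gfun_perturb(2)[OF \<xi> st \<epsilon> crit] by auto
  \<comment> \<open>The rate by which both kinds of far exits fall short of the full moment.\<close>
  define \<eta> where "\<eta> = min (?g z0 - (?g z1 - \<epsilon> * (?A z1 - ?A z0))) (?g z0 - (?g z2 - \<epsilon> * (?B z2 - ?B z0)))"
  have \<eta>: "\<eta> > 0" using z1 z2 by (simp add: \<eta>_def)
  \<comment> \<open>C absorbs the rounding of the rectangle, at most one unit per side. The terms at
    z2 are doubled because the bottom bound uses n and m + 2.\<close>
  define C where "C = \<bar>?A z0\<bar> + \<bar>?B z0\<bar> + \<bar>?A z1\<bar> + \<bar>?B z1\<bar> + 2 * \<bar>?A z2\<bar> + 2 * \<bar>?B z2\<bar>"
  define Q where "Q N = (real N * (s + t)) powr (\<xi> + 1)" for N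
  \<comment> \<open>This makes the far exits at most half of the lower bound for the full moment.
    The second limit lets the margin \<delta> - \<epsilon>D absorb the polynomial factor and the
    constants.\<close>
  have "((\<lambda>N. Q N * (2 * exp (C - \<eta> * real N))) \<longlongrightarrow> 0) sequentially"
    unfolding Q_def using \<eta> st \<xi> by real_asymp
  then have ev1: "eventually (\<lambda>N. Q N * (2 * exp (C - \<eta> * real N)) < exp (- C) / 2) sequentially"
    by (rule order_tendstoD) simp
  have "((\<lambda>N. Q N * (2 * exp (C + D) * exp ((\<epsilon> * D - \<delta>) * real N))) \<longlongrightarrow> 0) sequentially"
    unfolding Q_def using \<open>\<epsilon> * D < \<delta>\<close> st \<xi> by real_asymp
  then have ev2: "eventually (\<lambda>N. Q N * (2 * exp (C + D) * exp ((\<epsilon> * D - \<delta>) * real N)) < 1) sequentially"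
    by (rule order_tendstoD) simp
  show ?thesis
    using ev1 ev2 eventually_ldim_ge[OF st(1), of 1] eventually_ldim_ge[OF st(2), of 1] eventually_gt_at_top[of 0]
  proof eventually_elim
    case (elim N)
    obtain m n where mn: "ldim s N = Suc m" "ldim t N = Suc n"
      using elim(3,4) by (metis Suc_le_D One_nat_def)
    define K where "K = nat \<lceil>\<epsilon> * real N\<rceil>"
    have K: "\<epsilon> * real N \<le> real K" "real K \<le> \<epsilon> * real N + 1"
      using \<epsilon> unfolding K_def by (simp_all add: real_nat_ceiling_ge)
    obtain M where M: "moment \<mu> \<xi> (Suc m) (Suc n) = ennreal M" "M \<ge> 0"
      using moment_finite[of \<xi> \<mu> "Suc m" "Suc n"] \<xi> by (cases "moment \<mu> \<xi> (Suc m) (Suc n)") auto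
    have dt: "\<bar>real (Suc n) * A - real N * t * A\<bar> \<le> \<bar>A\<bar>" for A
      using ldim_mult_bound[of t N A] st mn by simp
    have ds: "\<bar>real (Suc m) * A - real N * s * A\<bar> \<le> \<bar>A\<bar>" for A
      using ldim_mult_bound[of s N A] st mn by simp
    have g: "real N * t * ?A z + real N * s * ?B z = real N * ?g z" for z
      by (simp add: gfun_def algebra_simps)
    have low: "real (Suc n) * ?A z0 + real (Suc m) * ?B z0 \<ge> real N * ?g z0 - C"
      using dt[of "?A z0"] ds[of "?B z0"] g[of z0] unfolding C_def by linarith
    have up1: "real (Suc n) * ?A z1 + real (Suc m) * ?B z1 - real K * (?A z1 - ?A z0) \<le> real N * (?g z0 - \<eta>) + C"
    proof -
      have "\<epsilon> * real N * (?A z1 - ?A z0) \<le> real K * (?A z1 - ?A z0)"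
        using z1 K by (intro mult_right_mono) auto
      moreover have "real N * (?g z1 - \<epsilon> * (?A z1 - ?A z0)) \<le> real N * (?g z0 - \<eta>)"
        by (intro mult_left_mono) (auto simp: \<eta>_def)
      ultimately show ?thesis
        using dt[of "?A z1"] ds[of "?B z1"] g[of z1] unfolding C_def by (simp add: algebra_simps) linarith
    qed
    have up2: "real n * ?A z2 + real (Suc (Suc m)) * ?B z2 - real K * (?B z2 - ?B z0) \<le> real N * (?g z0 - \<eta>) + C"
    proof -
      have "\<epsilon> * real N * (?B z2 - ?B z0) \<le> real K * (?B z2 - ?B z0)"
        using z2 K by (intro mult_right_mono) auto
      moreover have "real N * (?g z2 - \<epsilon> * (?B z2 - ?B z0)) \<le> real N * (?g z0 - \<eta>)"
        by (intro mult_left_mono) (auto simp: \<eta>_def)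
      ultimately show ?thesis
        using dt[of "?A z2"] ds[of "?B z2"] g[of z2] unfolding C_def by (simp add: algebra_simps) linarith
    qed
    have KD: "real K * D \<le> \<epsilon> * D * real N + D"
      using mult_right_mono[OF K(2) D] by (simp add: algebra_simps)
    have P: "real (m + n + 2) powr (\<xi> + 1) \<le> Q N"
      unfolding Q_def using ldim_bounds(1)[of s N] ldim_bounds(1)[of t N] st \<xi> mn
      by (intro powr_mono2) (auto simp: algebra_simps)
    have "ennreal (exp (real N * ?g z0 - C)) \<le> ennreal (exp (real (Suc n) * ?A z0 + real (Suc m) * ?B z0))"
      using low by (intro ennreal_leI) simp
    also have "\<dots> \<le> ennreal (real (m + n + 2) powr (\<xi> + 1)) * (ennreal (exp (real K * D)) * moment \<mu> \<xi> (Suc m) (Suc n) +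
      ennreal (exp (real (Suc n) * ?A z1 + real (Suc m) * ?B z1 - real K * (?A z1 - ?A z0)) +
        exp (real n * ?A z2 + real (Suc (Suc m)) * ?B z2 - real K * (?B z2 - ?B z0))))"
      by (rule moment_lower_ineq) (use \<xi> z1 z2 in \<open>auto simp: D_def\<close>)
    also have "\<dots> \<le> ennreal (Q N) * (ennreal (exp (\<epsilon> * D * real N + D)) * ennreal M +
       ennreal (exp (real N * (?g z0 - \<eta>) + C) + exp (real N * (?g z0 - \<eta>) + C)))"
      unfolding M using P KD up1 up2 by (intro mult_mono add_mono ennreal_leI) auto
    also have "\<dots> = ennreal (Q N * (exp (\<epsilon> * D * real N + D) * M + 2 * exp (real N * (?g z0 - \<eta>) + C)))"
      using M by (simp add: ennreal_mult'[symmetric] ennreal_plus[symmetric] Q_def del: ennreal_plus)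
    finally have ineq: "exp (real N * ?g z0 - C) \<le> Q N * (exp (\<epsilon> * D * real N + D) * M + 2 * exp (real N * (?g z0 - \<eta>) + C))"
      using M by (subst (asm) ennreal_le_iff) (auto simp: Q_def)
    have e1: "exp (real N * (?g z0 - \<eta>) + C) = exp (real N * ?g z0) * exp (C - \<eta> * real N)"
      by (simp add: exp_add[symmetric] algebra_simps)
    have e2: "exp (real N * (?g z0 - \<delta>)) * exp (\<epsilon> * D * real N + D) =
        exp (real N * ?g z0 - C) * (exp (C + D) * exp ((\<epsilon> * D - \<delta>) * real N))"
      by (simp add: exp_add[symmetric] algebra_simps)
    have "Q N * (2 * exp (real N * (?g z0 - \<eta>) + C)) = exp (real N * ?g z0) * (Q N * (2 * exp (C - \<eta> * real N)))"
      unfolding e1 by simp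
    also have "\<dots> \<le> exp (real N * ?g z0) * (exp (- C) / 2)"
      using elim(1) by (intro mult_left_mono) auto
    also have "\<dots> = exp (real N * ?g z0 - C) / 2"
      unfolding diff_conv_add_uminus exp_add by simp
    finally have half: "exp (real N * ?g z0 - C) / 2 \<le> Q N * exp (\<epsilon> * D * real N + D) * M"
      using ineq by (simp add: algebra_simps)
    have Qpos: "Q N > 0" using elim(5) st by (simp add: Q_def)
    have "exp (real N * (?g z0 - \<delta>)) * (Q N * exp (\<epsilon> * D * real N + D)) =
       Q N * (exp (real N * (?g z0 - \<delta>)) * exp (\<epsilon> * D * real N + D))"
      by (rule mult.left_commute)
    also have "\<dots> =
       (exp (real N * ?g z0 - C) / 2) * (Q N * (2 * exp (C + D) * exp ((\<epsilon> * D - \<delta>) * real N)))"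
      unfolding e2 by simp
    also have "\<dots> \<le> (exp (real N * ?g z0 - C) / 2) * 1"
      using elim(2) by (intro mult_left_mono) auto
    also have "\<dots> \<le> M * (Q N * exp (\<epsilon> * D * real N + D))"
      using half by (simp add: algebra_simps)
    finally have "exp (real N * (?g z0 - \<delta>)) \<le> M"
      using Qpos by (simp add: mult_le_cancel_right)
    then show ?case unfolding mn M by (rule ennreal_leI)
  qed
qed

section \<open>Small values of the bulk, compared with the boundary model\<close>

definition phi :: "real \<Rightarrow> real \<Rightarrow> real \<Rightarrow> real \<Rightarrow> real" where
  "phi \<mu> s t z = - t * Digamma z - s * Digamma (\<mu> - z)"

definition bulk :: "(nat \<times> nat \<Rightarrow> real) \<Rightarrow> nat \<Rightarrow> nat \<Rightarrow> real" where
  "bulk w m n = exp (w (1, 1)) * Zrec (shift_env 1 1 w) m n"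

lemma bulk_measurable [measurable]: "(\<lambda>w. bulk w m n) \<in> borel_measurable env_borel"
  unfolding bulk_def by measurable

lemma bulk_pos: "bulk w m n > 0"
  by (simp add: bulk_def)

lemma shift_env_shift_env: "shift_env a b (shift_env a' b' w) = shift_env (a' + a) (b' + b) w"
  by (auto simp: fun_eq_iff add.assoc)

text \<open>Among the bulk paths are those that climb column 1 from (1, 1) to the exit height and
  then continue freely. An early exit can thus exceed the bulk only through the ratio of axis
  weights to weights of column 1.\<close>

lemma left_exit_le_bulk:
  assumes "k \<le> n"
  shows "left_exit w m n k \<le> bulk w m n * (Zrec w 0 (Suc k) * exp (- (\<Sum>v\<in>{1} \<times> {1..k}. w v)))"
proof -
  have col: "exp (w (1, 1)) * Zrec (shift_env 1 1 w) 0 k = exp (\<Sum>v\<in>{1} \<times> {1..k}. w v) * exp (w (1, Suc k))" for k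
  proof (induction k)
    case (Suc k)
    have *: "{1::nat} \<times> {1..Suc k} = insert (1, Suc k) ({1} \<times> {1..k})" by auto
    show ?case unfolding * using Suc by (subst sum.insert) (auto simp: exp_add)
  qed simp
  have "exp (\<Sum>v\<in>{1} \<times> {1..k}. w v) * (exp (w (1, Suc k)) * Zrec (shift_env 1 (Suc k) w) m (n - k)) =
     exp (w (1, 1)) * (Zrec (shift_env 1 1 w) 0 k * Zrec (shift_env 0 k (shift_env 1 1 w)) m (n - k))"
    by (simp only: mult.assoc[symmetric] col) (simp add: shift_env_shift_env)
  also have "\<dots> \<le> bulk w m n"
    unfolding bulk_def using Zrec_supermult[of "shift_env 1 1 w" 0 k m "n - k"] assms by simp
  finally have *: "exp (\<Sum>v\<in>{1} \<times> {1..k}. w v) * (exp (w (1, Suc k)) * Zrec (shift_env 1 (Suc k) w) m (n - k)) \<le> bulk w m n" .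
  have "left_exit w m n k = (exp (\<Sum>v\<in>{1} \<times> {1..k}. w v) * (exp (w (1, Suc k)) * Zrec (shift_env 1 (Suc k) w) m (n - k))) *
      (Zrec w 0 (Suc k) * exp (- (\<Sum>v\<in>{1} \<times> {1..k}. w v)))"
    unfolding left_exit_def exp_minus by (simp del: Zrec.simps)
  also have "\<dots> \<le> bulk w m n * (Zrec w 0 (Suc k) * exp (- (\<Sum>v\<in>{1} \<times> {1..k}. w v)))"
    by (intro mult_right_mono *) (simp del: Zrec.simps)
  finally show ?thesis .
qed

lemma bottom_exit_le_bulk:
  assumes "k \<le> m"
  shows "bottom_exit w m n k \<le> bulk w m n * (Zrec w (Suc k) 0 * exp (- (\<Sum>v\<in>{1..k} \<times> {1}. w v)))"
proof -
  have row: "exp (w (1, 1)) * Zrec (shift_env 1 1 w) k 0 = exp (\<Sum>v\<in>{1..k} \<times> {1}. w v) * exp (w (Suc k, 1))" for k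
  proof (induction k)
    case (Suc k)
    have *: "{1..Suc k} \<times> {1::nat} = insert (Suc k, 1) ({1..k} \<times> {1})" by auto
    show ?case unfolding * using Suc by (subst sum.insert) (auto simp: exp_add)
  qed simp
  have "exp (\<Sum>v\<in>{1..k} \<times> {1}. w v) * (exp (w (Suc k, 1)) * Zrec (shift_env (Suc k) 1 w) (m - k) n) =
     exp (w (1, 1)) * (Zrec (shift_env 1 1 w) k 0 * Zrec (shift_env k 0 (shift_env 1 1 w)) (m - k) n)"
    by (simp only: mult.assoc[symmetric] row) (simp add: shift_env_shift_env)
  also have "\<dots> \<le> bulk w m n"
    unfolding bulk_def using Zrec_supermult[of "shift_env 1 1 w" k 0 "m - k" n] assms by simp
  finally have *: "exp (\<Sum>v\<in>{1..k} \<times> {1}. w v) * (exp (w (Suc k, 1)) * Zrec (shift_env (Suc k) 1 w) (m - k) n) \<le> bulk w m n" .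
  have "bottom_exit w m n k = (exp (\<Sum>v\<in>{1..k} \<times> {1}. w v) * (exp (w (Suc k, 1)) * Zrec (shift_env (Suc k) 1 w) (m - k) n)) *
      (Zrec w (Suc k) 0 * exp (- (\<Sum>v\<in>{1..k} \<times> {1}. w v)))"
    unfolding bottom_exit_def exp_minus by (simp del: Zrec.simps)
  also have "\<dots> \<le> bulk w m n * (Zrec w (Suc k) 0 * exp (- (\<Sum>v\<in>{1..k} \<times> {1}. w v)))"
    by (intro mult_right_mono *) (simp del: Zrec.simps)
  finally show ?thesis .
qed

lemma moment_edge_ratio:
  assumes c: "\<And>v. c v > 0" and "finite S" "finite T" "S \<inter> T = {}" "\<And>v. v \<in> S \<Longrightarrow> \<zeta> < c v" "\<zeta> \<ge> 0"
  shows "(\<integral>\<^sup>+w. ennreal ((exp (\<Sum>v\<in>S. w v) * exp (- (\<Sum>v\<in>T. w v))) powr \<zeta>) \<partial>env c) =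
    ennreal (exp ((\<Sum>v\<in>S. lmgf (c v) \<zeta>) + (\<Sum>v\<in>T. lmgf (c v) (- \<zeta>))))"
proof -
  have "(\<integral>\<^sup>+w. ennreal ((exp (\<Sum>v\<in>S. w v) * exp (- (\<Sum>v\<in>T. w v))) powr \<zeta>) \<partial>env c) =
    (\<integral>\<^sup>+w. ennreal (exp (\<zeta> * (\<Sum>v\<in>S. w v))) * ennreal (exp (- \<zeta> * (\<Sum>v\<in>T. w v))) \<partial>env c)"
    by (simp add: powr_mult powr_exp_eq ennreal_mult')
  also have "\<dots> = (\<integral>\<^sup>+w. ennreal (exp (\<zeta> * (\<Sum>v\<in>S. w v))) \<partial>env c) * (\<integral>\<^sup>+w. ennreal (exp (- \<zeta> * (\<Sum>v\<in>T. w v))) \<partial>env c)"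
    using assms by (intro nn_integral_env_mult[where A = S and B = T])
      (auto intro!: depends_onI sum.cong arg_cong[where f = "\<lambda>x. ennreal (exp (\<zeta> * x))"] arg_cong[where f = "\<lambda>x. ennreal (exp (- (\<zeta> * x)))"])
  also have "\<dots> = ennreal (exp (\<Sum>v\<in>S. lmgf (c v) \<zeta>)) * ennreal (exp (\<Sum>v\<in>T. lmgf (c v) (- \<zeta>)))"
  proof -
    have "- \<zeta> < c v" for v using c[of v] assms by linarith
    then show ?thesis
      by (subst (1 2) nn_integral_exp_sum) (use assms in auto)
  qed
  finally show ?thesis by (simp add: ennreal_mult'[symmetric] exp_add)
qed

text \<open>Each of the at most K steps contributes one axis weight and at most one inverse bulk
  weight, hence the factor 2.\<close>

lemma moment_left_ratio:
  assumes c: "\<And>v. c v > 0" and "\<And>j. 1 \<le> j \<Longrightarrow> c (0, j) = b" "\<And>i j. 1 \<le> i \<Longrightarrow> 1 \<le> j \<Longrightarrow> c (i, j) = \<mu>"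
    and "0 \<le> \<zeta>" "\<zeta> < b" and D: "lmgf b \<zeta> \<le> D" "lmgf \<mu> (- \<zeta>) \<le> D" "0 \<le> D" and k: "Suc k \<le> K"
  shows "(\<integral>\<^sup>+w. ennreal ((Zrec w 0 (Suc k) * exp (- (\<Sum>v\<in>{1} \<times> {1..k}. w v))) powr \<zeta>) \<partial>env c) \<le> ennreal (exp (real K * (2 * D)))"
proof -
  have "(\<Sum>v\<in>{0::nat} \<times> {1..Suc k}. lmgf (c v) \<zeta>) + (\<Sum>v\<in>{1} \<times> {1..k}. lmgf (c v) (- \<zeta>)) \<le>
     (\<Sum>v\<in>{0::nat} \<times> {1..Suc k}. D) + (\<Sum>v\<in>{1::nat} \<times> {1..k}. D)"
    using assms by (intro add_mono sum_mono) auto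
  also have "\<dots> = (real (Suc k) + real k) * D" by (simp add: algebra_simps)
  also have "\<dots> \<le> (real K * 2) * D" using k D by (intro mult_right_mono) auto
  finally have "(\<Sum>v\<in>{0::nat} \<times> {1..Suc k}. lmgf (c v) \<zeta>) + (\<Sum>v\<in>{1} \<times> {1..k}. lmgf (c v) (- \<zeta>)) \<le> real K * (2 * D)" by simp
  then show ?thesis
    unfolding Zrec_left_edge using assms
    by (subst moment_edge_ratio) (auto intro!: ennreal_leI)
qed

lemma moment_bottom_ratio:
  assumes c: "\<And>v. c v > 0" and "\<And>i. 1 \<le> i \<Longrightarrow> c (i, 0) = b" "\<And>i j. 1 \<le> i \<Longrightarrow> 1 \<le> j \<Longrightarrow> c (i, j) = \<mu>"
    and "0 \<le> \<zeta>" "\<zeta> < b" and D: "lmgf b \<zeta> \<le> D" "lmgf \<mu> (- \<zeta>) \<le> D" "0 \<le> D" and k: "Suc k \<le> K"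
  shows "(\<integral>\<^sup>+w. ennreal ((Zrec w (Suc k) 0 * exp (- (\<Sum>v\<in>{1..k} \<times> {1}. w v))) powr \<zeta>) \<partial>env c) \<le> ennreal (exp (real K * (2 * D)))"
proof -
  have "(\<Sum>v\<in>{1..Suc k} \<times> {0::nat}. lmgf (c v) \<zeta>) + (\<Sum>v\<in>{1..k} \<times> {1}. lmgf (c v) (- \<zeta>)) \<le>
     (\<Sum>v\<in>{1..Suc k} \<times> {0::nat}. D) + (\<Sum>v\<in>{1..k} \<times> {1::nat}. D)"
    using assms by (intro add_mono sum_mono) auto
  also have "\<dots> = (real (Suc k) + real k) * D" by (simp add: algebra_simps)
  also have "\<dots> \<le> (real K * 2) * D" using k D by (intro mult_right_mono) auto
  finally have "(\<Sum>v\<in>{1..Suc k} \<times> {0::nat}. lmgf (c v) \<zeta>) + (\<Sum>v\<in>{1..k} \<times> {1}. lmgf (c v) (- \<zeta>)) \<le> real K * (2 * D)" by simp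
  then show ?thesis
    unfolding Zrec_bottom_edge using assms
    by (subst moment_edge_ratio) (auto intro!: ennreal_leI)
qed

declare Zrec.simps(4) [simp del]

text \<open>If the bulk is small, then either the whole boundary model is small or one exit term is large;
  both alternatives are controlled by moments.\<close>

lemma bulk_small_prob:
  fixes \<mu> :: real
  assumes z0: "0 < z0" "z0 < \<mu>" and \<kappa>: "0 < \<kappa>" "\<kappa> < \<mu> - z0" and \<zeta>: "0 < \<zeta>" "\<zeta> < z0" "\<zeta> < \<mu> - z0 - \<kappa>"
    and z1: "\<zeta> < z1" "z1 < \<mu>" "lmgf z0 \<zeta> \<le> lmgf z1 \<zeta>"
    and z2: "\<zeta> < z2" "z2 < \<mu>" "lmgf (\<mu> - z0 - \<kappa>) \<zeta> \<le> lmgf (\<mu> - z2 + \<zeta>) \<zeta>"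
    and D: "lmgf z0 \<zeta> \<le> D" "lmgf (\<mu> - z0 - \<kappa>) \<zeta> \<le> D" "lmgf \<mu> (- \<zeta>) \<le> D" "0 \<le> D"
  shows "emeasure (env (\<lambda>_. \<mu>)) {w. exp (w (0, 0)) * Zrec w m n \<le> exp Y} \<le>
    ennreal (exp (\<kappa> * X + real (Suc n) * lmgf z0 (- \<kappa>) + real (Suc m) * lmgf (\<mu> - z0 - \<kappa>) (- \<kappa>)) +
      real (m + n + 2) powr (\<zeta> + 1) * (
        exp (- \<zeta> * X + real (Suc n) * lmgf z1 \<zeta> + real (Suc m) * lmgf (\<mu> - z1 + \<zeta>) \<zeta> - real K * (lmgf z1 \<zeta> - lmgf z0 \<zeta>)) +
        exp (- \<zeta> * X + real n * lmgf z2 \<zeta> + real (Suc (Suc m)) * lmgf (\<mu> - z2 + \<zeta>) \<zeta> - real K * (lmgf (\<mu> - z2 + \<zeta>) \<zeta> - lmgf (\<mu> - z0 - \<kappa>) \<zeta>)) +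
        exp (- \<zeta> * X + \<zeta> * Y + real K * (2 * D))))"
    (is "?L \<le> ennreal (?E0 + ?P powr (\<zeta> + 1) * (?E1 + ?E2 + ?E3))")
proof -
  \<comment> \<open>The exact moment formula with exponent -\<kappa> forces this parameter on the
    bottom axis. The positive exponent \<zeta> is applied only to single exits, where each axis
    enters through its own moment generating function.\<close>
  let ?a = "\<mu> - z0 - \<kappa>"
  let ?c = "boundary_params \<mu> z0 ?a"
  have c: "?c v > 0" "1 \<le> j \<Longrightarrow> ?c (0, j) = z0" "1 \<le> i \<Longrightarrow> ?c (i, 0) = ?a" "1 \<le> i \<Longrightarrow> 1 \<le> j \<Longrightarrow> ?c (i, j) = \<mu>" for v i j
    using z0 \<kappa> by (auto simp: boundary_params_def)
  \<comment> \<open>Near exits are measured by their bound after the bulk is replaced by exp(Y); far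
    exits are kept as they are.\<close>
  define fl where "fl k w = (if Suc k \<le> K then exp (\<zeta> * Y) * (Zrec w 0 (Suc k) * exp (- (\<Sum>v\<in>{1} \<times> {1..k}. w v))) powr \<zeta>
      else left_exit w m n k powr \<zeta>)" for k w
  define fb where "fb k w = (if Suc k \<le> K then exp (\<zeta> * Y) * (Zrec w (Suc k) 0 * exp (- (\<Sum>v\<in>{1..k} \<times> {1}. w v))) powr \<zeta>
      else bottom_exit w m n k powr \<zeta>)" for k w
  have [measurable]: "fl k \<in> borel_measurable env_borel" "fb k \<in> borel_measurable env_borel" for k
    unfolding fl_def fb_def by measurable
  have nonneg: "fl k w \<ge> 0" "fb k w \<ge> 0" for k w by (auto simp: fl_def fb_def)
  have scale: "ennreal (exp (- \<zeta> * X)) * ennreal (exp u) = ennreal (exp (- \<zeta> * X + u))" for u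
    by (simp add: ennreal_mult'[symmetric] exp_add[symmetric])
  have IL: "ennreal (exp (- \<zeta> * X)) * (\<integral>\<^sup>+w. ennreal (fl k w) \<partial>env ?c) \<le> ennreal (?E1 + ?E2 + ?E3)" if "k \<le> n" for k
  proof (cases "Suc k \<le> K")
    case True
    have "(\<integral>\<^sup>+w. ennreal (fl k w) \<partial>env ?c) = ennreal (exp (\<zeta> * Y)) *
       (\<integral>\<^sup>+w. ennreal ((Zrec w 0 (Suc k) * exp (- (\<Sum>v\<in>{1} \<times> {1..k}. w v))) powr \<zeta>) \<partial>env ?c)"
      using True by (simp add: fl_def ennreal_mult' nn_integral_cmult del: Zrec.simps)
    also have "\<dots> \<le> ennreal (exp (\<zeta> * Y)) * ennreal (exp (real K * (2 * D)))"
      by (intro mult_left_mono moment_left_ratio[where b = z0 and \<mu> = \<mu>]) (use c \<zeta> D True in auto)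
    also have "\<dots> = ennreal (exp (\<zeta> * Y + real K * (2 * D)))"
      by (simp add: ennreal_mult'[symmetric] exp_add)
    finally have "ennreal (exp (- \<zeta> * X)) * (\<integral>\<^sup>+w. ennreal (fl k w) \<partial>env ?c) \<le>
        ennreal (exp (- \<zeta> * X)) * ennreal (exp (\<zeta> * Y + real K * (2 * D)))"
      by (rule mult_left_mono) simp
    also have "\<dots> = ennreal ?E3" unfolding scale by (simp add: add.assoc)
    also have "\<dots> \<le> ennreal (?E1 + ?E2 + ?E3)" by (rule ennreal_leI) simp
    finally show ?thesis .
  next
    case False
    then have "(\<integral>\<^sup>+w. ennreal (fl k w) \<partial>env ?c) = (\<integral>\<^sup>+w. ennreal (left_exit w m n k powr \<zeta>) \<partial>env ?c)"
      by (simp add: fl_def)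
    also have "\<dots> \<le> ennreal (exp (real (Suc n) * lmgf z1 \<zeta> + real (Suc m) * lmgf (\<mu> - z1 + \<zeta>) \<zeta> - real K * (lmgf z1 \<zeta> - lmgf z0 \<zeta>)))"
      by (rule far_left_exit) (use c \<zeta> z1 False that in auto)
    finally have "ennreal (exp (- \<zeta> * X)) * (\<integral>\<^sup>+w. ennreal (fl k w) \<partial>env ?c) \<le>
        ennreal (exp (- \<zeta> * X)) * ennreal (exp (real (Suc n) * lmgf z1 \<zeta> + real (Suc m) * lmgf (\<mu> - z1 + \<zeta>) \<zeta> - real K * (lmgf z1 \<zeta> - lmgf z0 \<zeta>)))"
      by (rule mult_left_mono) simp
    also have "\<dots> = ennreal ?E1" unfolding scale by (simp add: algebra_simps)
    also have "\<dots> \<le> ennreal (?E1 + ?E2 + ?E3)" by (rule ennreal_leI) simp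
    finally show ?thesis .
  qed
  have IB: "ennreal (exp (- \<zeta> * X)) * (\<integral>\<^sup>+w. ennreal (fb k w) \<partial>env ?c) \<le> ennreal (?E1 + ?E2 + ?E3)" if "k \<le> m" for k
  proof (cases "Suc k \<le> K")
    case True
    have "(\<integral>\<^sup>+w. ennreal (fb k w) \<partial>env ?c) = ennreal (exp (\<zeta> * Y)) *
       (\<integral>\<^sup>+w. ennreal ((Zrec w (Suc k) 0 * exp (- (\<Sum>v\<in>{1..k} \<times> {1}. w v))) powr \<zeta>) \<partial>env ?c)"
      using True by (simp add: fb_def ennreal_mult' nn_integral_cmult del: Zrec.simps)
    also have "\<dots> \<le> ennreal (exp (\<zeta> * Y)) * ennreal (exp (real K * (2 * D)))"
      by (intro mult_left_mono moment_bottom_ratio[where b = ?a and \<mu> = \<mu>]) (use c \<zeta> D True in auto)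
    also have "\<dots> = ennreal (exp (\<zeta> * Y + real K * (2 * D)))"
      by (simp add: ennreal_mult'[symmetric] exp_add)
    finally have "ennreal (exp (- \<zeta> * X)) * (\<integral>\<^sup>+w. ennreal (fb k w) \<partial>env ?c) \<le>
        ennreal (exp (- \<zeta> * X)) * ennreal (exp (\<zeta> * Y + real K * (2 * D)))"
      by (rule mult_left_mono) simp
    also have "\<dots> = ennreal ?E3" unfolding scale by (simp add: add.assoc)
    also have "\<dots> \<le> ennreal (?E1 + ?E2 + ?E3)" by (rule ennreal_leI) simp
    finally show ?thesis .
  next
    case False
    then have "(\<integral>\<^sup>+w. ennreal (fb k w) \<partial>env ?c) = (\<integral>\<^sup>+w. ennreal (bottom_exit w m n k powr \<zeta>) \<partial>env ?c)"
      by (simp add: fb_def)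
    also have "\<dots> \<le> ennreal (exp (real n * lmgf z2 \<zeta> + real (Suc (Suc m)) * lmgf (\<mu> - z2 + \<zeta>) \<zeta> - real K * (lmgf (\<mu> - z2 + \<zeta>) \<zeta> - lmgf ?a \<zeta>)))"
      by (rule far_bottom_exit) (use c \<zeta> z2 False that in auto)
    finally have "ennreal (exp (- \<zeta> * X)) * (\<integral>\<^sup>+w. ennreal (fb k w) \<partial>env ?c) \<le>
        ennreal (exp (- \<zeta> * X)) * ennreal (exp (real n * lmgf z2 \<zeta> + real (Suc (Suc m)) * lmgf (\<mu> - z2 + \<zeta>) \<zeta> - real K * (lmgf (\<mu> - z2 + \<zeta>) \<zeta> - lmgf ?a \<zeta>)))"
      by (rule mult_left_mono) simp
    also have "\<dots> = ennreal ?E2" unfolding scale by (simp add: algebra_simps)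
    also have "\<dots> \<le> ennreal (?E1 + ?E2 + ?E3)" by (rule ennreal_leI) simp
    finally show ?thesis .
  qed
  \<comment> \<open>W is at least 1 on the event: through its first summand, a negative power, if
    the boundary partition function is at most exp(X), and through the second, a positive power,
    otherwise. The integral of W therefore bounds the probability.\<close>
  define W where "W w = exp (\<kappa> * X) * Zrec w (Suc m) (Suc n) powr (- \<kappa>) +
      exp (- \<zeta> * X) * (?P powr \<zeta> * ((\<Sum>k\<le>n. fl k w) + (\<Sum>k\<le>m. fb k w)))" for w
  have W0: "0 \<le> (\<Sum>k\<le>n. fl k w) + (\<Sum>k\<le>m. fb k w)" for w
    by (intro add_nonneg_nonneg sum_nonneg nonneg)
  have W: "1 \<le> W w" if small: "bulk w m n \<le> exp Y" for w
  proof (cases "Zrec w (Suc m) (Suc n) \<le> exp X")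
    case True
    have "1 = exp (\<kappa> * X) * exp X powr (- \<kappa>)" by (simp add: powr_exp_eq exp_minus)
    also have "\<dots> \<le> exp (\<kappa> * X) * Zrec w (Suc m) (Suc n) powr (- \<kappa>)"
      using True \<kappa> by (intro mult_left_mono powr_mono2') auto
    also have "\<dots> \<le> W w" unfolding W_def using W0[of w] by simp
    finally show ?thesis .
  next
    case False
    have nl: "left_exit w m n k powr \<zeta> \<le> fl k w" if k: "k \<le> n" for k
    proof (cases "Suc k \<le> K")
      case True
      have "left_exit w m n k \<le> bulk w m n * (Zrec w 0 (Suc k) * exp (- (\<Sum>v\<in>{1} \<times> {1..k}. w v)))"
        by (rule left_exit_le_bulk[OF k])
      also have "\<dots> \<le> exp Y * (Zrec w 0 (Suc k) * exp (- (\<Sum>v\<in>{1} \<times> {1..k}. w v)))"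
        using small by (intro mult_right_mono) (auto simp del: Zrec.simps)
      finally have "left_exit w m n k powr \<zeta> \<le> (exp Y * (Zrec w 0 (Suc k) * exp (- (\<Sum>v\<in>{1} \<times> {1..k}. w v)))) powr \<zeta>"
        using \<zeta> by (intro powr_mono2) (auto intro: less_imp_le left_exit_pos)
      then show ?thesis using True by (simp add: fl_def powr_mult powr_exp_eq del: Zrec.simps)
    qed (simp add: fl_def)
    have nb: "bottom_exit w m n k powr \<zeta> \<le> fb k w" if k: "k \<le> m" for k
    proof (cases "Suc k \<le> K")
      case True
      have "bottom_exit w m n k \<le> bulk w m n * (Zrec w (Suc k) 0 * exp (- (\<Sum>v\<in>{1..k} \<times> {1}. w v)))"
        by (rule bottom_exit_le_bulk[OF k])
      also have "\<dots> \<le> exp Y * (Zrec w (Suc k) 0 * exp (- (\<Sum>v\<in>{1..k} \<times> {1}. w v)))"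
        using small by (intro mult_right_mono) (auto simp del: Zrec.simps)
      finally have "bottom_exit w m n k powr \<zeta> \<le> (exp Y * (Zrec w (Suc k) 0 * exp (- (\<Sum>v\<in>{1..k} \<times> {1}. w v)))) powr \<zeta>"
        using \<zeta> by (intro powr_mono2) (auto intro: less_imp_le bottom_exit_pos)
      then show ?thesis using True by (simp add: fb_def powr_mult powr_exp_eq del: Zrec.simps)
    qed (simp add: fb_def)
    have "1 = exp (- \<zeta> * X) * exp X powr \<zeta>" by (simp add: powr_exp_eq exp_minus)
    also have "\<dots> \<le> exp (- \<zeta> * X) * Zrec w (Suc m) (Suc n) powr \<zeta>"
      using False \<zeta> by (intro mult_left_mono powr_mono2) auto
    also have "\<dots> \<le> exp (- \<zeta> * X) * (?P powr \<zeta> * ((\<Sum>k\<le>n. left_exit w m n k powr \<zeta>) + (\<Sum>k\<le>m. bottom_exit w m n k powr \<zeta>)))"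
      using \<zeta> by (intro mult_left_mono Zrec_powr_le_exits) auto
    also have "\<dots> \<le> exp (- \<zeta> * X) * (?P powr \<zeta> * ((\<Sum>k\<le>n. fl k w) + (\<Sum>k\<le>m. fb k w)))"
      by (intro mult_left_mono add_mono sum_mono nl nb) auto
    also have "\<dots> \<le> W w" unfolding W_def by simp
    finally show ?thesis .
  qed
  have meas: "{w. exp (w (0, 0)) * Zrec w m n \<le> exp Y} \<in> sets env_borel"
  proof -
    have "{w \<in> space env_borel. exp (w (0, 0)) * Zrec w m n \<le> exp Y} \<in> sets env_borel" by measurable
    then show ?thesis by simp
  qed
  have sh: "shift_env 1 1 ?c = (\<lambda>_. \<mu>)" by (auto simp: shift_env_def boundary_params_def)
  have "?L = (\<integral>\<^sup>+w. indicator {w. exp (w (0, 0)) * Zrec w m n \<le> exp Y} w \<partial>env (\<lambda>_. \<mu>))"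
    using meas by simp
  also have "\<dots> = (\<integral>\<^sup>+w. indicator {w. exp (w (0, 0)) * Zrec w m n \<le> exp Y} (shift_env 1 1 w) \<partial>env ?c)"
    using nn_integral_env_shift[of "indicator {w. exp (w (0, 0)) * Zrec w m n \<le> exp Y}" ?c 1 1, OF _ c(1)] meas
    unfolding sh by simp
  also have "\<dots> \<le> (\<integral>\<^sup>+w. ennreal (W w) \<partial>env ?c)"
    using W by (intro nn_integral_mono) (auto simp: indicator_def bulk_def)
  also have "\<dots> = (\<integral>\<^sup>+w. ennreal (exp (\<kappa> * X)) * ennreal (Zrec w (Suc m) (Suc n) powr (- \<kappa>)) +
      ennreal (?P powr \<zeta>) * (ennreal (exp (- \<zeta> * X)) * ((\<Sum>k\<le>n. ennreal (fl k w)) + (\<Sum>k\<le>m. ennreal (fb k w)))) \<partial>env ?c)"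
  proof (rule nn_integral_cong)
    fix w :: "nat \<times> nat \<Rightarrow> real"
    have "ennreal ((\<Sum>k\<le>n. fl k w) + (\<Sum>k\<le>m. fb k w)) = (\<Sum>k\<le>n. ennreal (fl k w)) + (\<Sum>k\<le>m. ennreal (fb k w))"
      by (simp add: nonneg sum_nonneg)
    then show "ennreal (W w) = ennreal (exp (\<kappa> * X)) * ennreal (Zrec w (Suc m) (Suc n) powr (- \<kappa>)) +
      ennreal (?P powr \<zeta>) * (ennreal (exp (- \<zeta> * X)) * ((\<Sum>k\<le>n. ennreal (fl k w)) + (\<Sum>k\<le>m. ennreal (fb k w))))"
      unfolding W_def using W0[of w]
      by (subst ennreal_plus) (auto simp: ennreal_mult' mult.left_commute simp del: Zrec.simps ennreal_plus)
  qed
  also have "\<dots> = ennreal (exp (\<kappa> * X)) * (\<integral>\<^sup>+w. ennreal (Zrec w (Suc m) (Suc n) powr (- \<kappa>)) \<partial>env ?c) +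
      ennreal (?P powr \<zeta>) * ((\<Sum>k\<le>n. ennreal (exp (- \<zeta> * X)) * (\<integral>\<^sup>+w. ennreal (fl k w) \<partial>env ?c)) +
         (\<Sum>k\<le>m. ennreal (exp (- \<zeta> * X)) * (\<integral>\<^sup>+w. ennreal (fb k w) \<partial>env ?c)))"
    by (simp add: nn_integral_add nn_integral_cmult nn_integral_sum sum_distrib_left distrib_left del: Zrec.simps sum_ennreal)
  also have "\<dots> \<le> ennreal (exp (\<kappa> * X)) * (\<integral>\<^sup>+w. ennreal (Zrec w (Suc m) (Suc n) powr (- \<kappa>)) \<partial>env ?c) +
      ennreal (?P powr \<zeta>) * ((\<Sum>k\<le>n. ennreal (?E1 + ?E2 + ?E3)) + (\<Sum>k\<le>m. ennreal (?E1 + ?E2 + ?E3)))"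
    by (intro add_mono mult_left_mono sum_mono IL IB order_refl) auto
  also have "ennreal (exp (\<kappa> * X)) * (\<integral>\<^sup>+w. ennreal (Zrec w (Suc m) (Suc n) powr (- \<kappa>)) \<partial>env ?c) = ennreal ?E0"
    using boundary_moment_exp[of z0 \<mu> "- \<kappa>" "Suc m" "Suc n"] z0 \<kappa>
    by (simp add: ennreal_mult'[symmetric] exp_add algebra_simps del: Zrec.simps)
  also have "ennreal (?P powr \<zeta>) * ((\<Sum>k\<le>n. ennreal (?E1 + ?E2 + ?E3)) + (\<Sum>k\<le>m. ennreal (?E1 + ?E2 + ?E3))) =
      ennreal (?P powr (\<zeta> + 1) * (?E1 + ?E2 + ?E3))"
  proof -
    have "(\<Sum>k\<le>n. ennreal (?E1 + ?E2 + ?E3)) + (\<Sum>k\<le>m. ennreal (?E1 + ?E2 + ?E3)) = ennreal (?P * (?E1 + ?E2 + ?E3))"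
      by (subst (1 2) sum_ennreal, simp, simp, subst ennreal_plus[symmetric]) (simp_all add: sum_nonneg algebra_simps)
    then show ?thesis
      by (simp only: powr_add) (simp add: ennreal_mult'[symmetric] mult.assoc)
  qed
  finally show ?thesis by (simp add: ennreal_plus[symmetric] del: ennreal_plus)
qed

section \<open>Law of large numbers from below\<close>

lemma lmgf_0 [simp]: "lmgf \<nu> 0 = 0"
  by (simp add: lmgf_def)

text \<open>As the exponent tends to zero, moments linearise and log-gamma terms turn into digamma
  values. In the last two cases the parameter moves along with the exponent, with the same
  first-order effect.\<close>

lemma DERIV_lmgf:
  assumes "\<nu> > 0"
  shows "((\<lambda>\<zeta>. lmgf \<nu> \<zeta>) has_real_derivative - Digamma \<nu>) (at 0)"
    and "((\<lambda>\<zeta>. lmgf \<nu> (- \<zeta>)) has_real_derivative Digamma \<nu>) (at 0)"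
    and "((\<lambda>\<zeta>. lmgf (\<nu> + \<zeta>) \<zeta>) has_real_derivative - Digamma \<nu>) (at 0)"
    and "((\<lambda>\<zeta>. lmgf (\<nu> - \<zeta>) (- \<zeta>)) has_real_derivative Digamma \<nu>) (at 0)"
  unfolding lmgf_def using assms by (auto intro!: derivative_eq_intros)

lemma eventually_neg_at_right:
  assumes "(f has_real_derivative d) (at 0)" "d < 0" "f 0 = 0"
  shows "eventually (\<lambda>x. f x < 0) (at_right (0::real))"
proof -
  obtain e where "e > 0" "\<And>h. 0 < h \<Longrightarrow> h < e \<Longrightarrow> f (0 + h) < f 0"
    using DERIV_neg_dec_right[OF assms(1,2)] by auto
  then show ?thesis using assms(3) unfolding eventually_at_right_field by auto
qed

lemma DERIV_phi:
  assumes "0 < z" "z < \<mu>"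
  shows "(phi \<mu> s t has_real_derivative (- t * Polygamma 1 z + s * Polygamma 1 (\<mu> - z))) (at z)"
  unfolding phi_def [abs_def] using assms by (auto intro!: derivative_eq_intros elim!: nonpos_Ints_cases)

lemma Polygamma_1_pos: "x > 0 \<Longrightarrow> Polygamma 1 (x::real) > 0"
  by (intro Polygamma_real_odd_pos) (auto elim!: nonpos_Ints_cases)

text \<open>The limit of \<open>gfun_perturb\<close> for vanishing exponents. At a stationary point
  a shift by h changes \<open>phi\<close> by o(h), but the digamma value of either boundary
  parameter by a multiple of h.\<close>

lemma phi_perturb:
  assumes z: "0 < z" "z < \<mu>" and \<epsilon>: "\<epsilon> > 0" and crit: "t * Polygamma 1 z = s * Polygamma 1 (\<mu> - z)"
  shows "\<exists>z1. 0 < z1 \<and> z1 < z \<and> phi \<mu> s t z1 - \<epsilon> * (Digamma z - Digamma z1) < phi \<mu> s t z" (is ?A)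
    and "\<exists>z2. z < z2 \<and> z2 < \<mu> \<and> phi \<mu> s t z2 - \<epsilon> * (Digamma (\<mu> - z) - Digamma (\<mu> - z2)) < phi \<mu> s t z" (is ?B)
proof -
  note pos = Polygamma_1_pos
  have d0: "(phi \<mu> s t has_real_derivative 0) (at z)"
    using DERIV_phi[OF z, of s t] crit by simp
  show ?A
  proof -
    have "((\<lambda>x. phi \<mu> s t x + \<epsilon> * Digamma x) has_real_derivative (\<epsilon> * Polygamma 1 z)) (at z)"
      using z by (auto intro!: derivative_eq_intros d0 elim!: nonpos_Ints_cases)
    moreover have "0 < \<epsilon> * Polygamma 1 z" using pos[OF z(1)] \<epsilon> by simp
    ultimately obtain e where e: "e > 0" "\<And>h. 0 < h \<Longrightarrow> h < e \<Longrightarrow>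
        phi \<mu> s t (z - h) + \<epsilon> * Digamma (z - h) < phi \<mu> s t z + \<epsilon> * Digamma z"
      using DERIV_pos_inc_left by blast
    define h where "h = min e z / 2"
    have "0 < h" "h < e" "h < z" unfolding h_def using e z by (auto simp: min_def)
    then show ?thesis using e(2)[of h] by (intro exI[of _ "z - h"]) (auto simp: algebra_simps)
  qed
  show ?B
  proof -
    have "((\<lambda>x. phi \<mu> s t x + \<epsilon> * Digamma (\<mu> - x)) has_real_derivative (- (\<epsilon> * Polygamma 1 (\<mu> - z)))) (at z)"
      using z by (auto intro!: derivative_eq_intros d0 elim!: nonpos_Ints_cases)
    moreover have "- (\<epsilon> * Polygamma 1 (\<mu> - z)) < 0" using pos[of "\<mu> - z"] z \<epsilon> by simp
    ultimately obtain e where e: "e > 0" "\<And>h. 0 < h \<Longrightarrow> h < e \<Longrightarrow>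
        phi \<mu> s t (z + h) + \<epsilon> * Digamma (\<mu> - (z + h)) < phi \<mu> s t z + \<epsilon> * Digamma (\<mu> - z)"
      using DERIV_neg_dec_right by blast
    define h where "h = min e (\<mu> - z) / 2"
    have "0 < h" "h < e" "h < \<mu> - z" unfolding h_def using e z by (auto simp: min_def)
    then show ?thesis using e(2)[of h] by (intro exI[of _ "z + h"]) (auto simp: algebra_simps)
  qed
qed

lemma emeasure_bulk_eq:
  assumes "\<mu> > 0"
  shows "emeasure (env (\<lambda>_. \<mu>)) {w. bulk w m n \<le> y} = emeasure (env (\<lambda>_. \<mu>)) {w. exp (w (0, 0)) * Zrec w m n \<le> y}"
proof -
  have meas: "{w. exp (w (0, 0)) * Zrec w m n \<le> y} \<in> sets env_borel" "{w. bulk w m n \<le> y} \<in> sets env_borel"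
  proof -
    have "{w \<in> space env_borel. exp (w (0, 0)) * Zrec w m n \<le> y} \<in> sets env_borel" by measurable
    then show "{w. exp (w (0, 0)) * Zrec w m n \<le> y} \<in> sets env_borel" by simp
    have "{w \<in> space env_borel. bulk w m n \<le> y} \<in> sets env_borel" by measurable
    then show "{w. bulk w m n \<le> y} \<in> sets env_borel" by simp
  qed
  have "emeasure (env (\<lambda>_. \<mu>)) {w. bulk w m n \<le> y} =
    (\<integral>\<^sup>+w. indicator {w. exp (w (0, 0)) * Zrec w m n \<le> y} (shift_env 1 1 w) \<partial>env (\<lambda>_. \<mu>))"
    using meas by (subst nn_integral_indicator[symmetric], simp, intro nn_integral_cong) (simp only: indicator_def, simp add: bulk_def)
  also have "\<dots> = (\<integral>\<^sup>+w. indicator {w. exp (w (0, 0)) * Zrec w m n \<le> y} w \<partial>env (shift_env 1 1 (\<lambda>_. \<mu>)))"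
    using meas assms by (intro nn_integral_env_shift) auto
  also have "shift_env 1 1 (\<lambda>_. \<mu>) = (\<lambda>_. \<mu>)" by (auto simp: shift_env_def)
  finally show ?thesis using meas by simp
qed

text \<open>The thresholds are X < p for the boundary model and Y = p - \<delta> for the bulk. The
  choices are nested: \<epsilon>, then z1 and z2, then X, then \<kappa>, which fixes the bottom
  parameter, and finally \<zeta>. The exponents \<kappa> and \<zeta> are so small that signs of
  derivatives at zero decide the rates. The passage from the bulk to the full partition function
  spends a second \<delta>.\<close>

lemma lln_lower:
  assumes z0: "0 < z0" "z0 < \<mu>" and st: "s > 0" "t > 0" and \<delta>: "\<delta> > 0"
    and crit: "t * Polygamma 1 z0 = s * Polygamma 1 (\<mu> - z0)"
  shows "((\<lambda>N. emeasure (env (\<lambda>_. \<mu>)) {w. Zrec w (ldim s N) (ldim t N) \<le> exp (real N * (phi \<mu> s t z0 - 2 * \<delta>))}) \<longlongrightarrow> 0) sequentially"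
proof -
  define p where "p = phi \<mu> s t z0"
  define D1 where "D1 = \<bar>Digamma z0\<bar> + \<bar>Digamma \<mu>\<bar> + \<bar>Digamma (\<mu> - z0)\<bar> + 1"
  have D1: "D1 \<ge> 1" "- Digamma z0 < D1" "Digamma \<mu> < D1" "- Digamma (\<mu> - z0) < D1"
    unfolding D1_def by (auto simp: abs_if)
  \<comment> \<open>Near exits cost 2\<epsilon>D1 per unit of \<zeta>N. This is \<delta>/4, less
    than X - Y, which exceeds \<delta>/2.\<close>
  define \<epsilon> where "\<epsilon> = \<delta> / (8 * D1)"
  have \<epsilon>: "\<epsilon> > 0" "2 * \<epsilon> * D1 = \<delta> / 4" using \<delta> D1 by (auto simp: \<epsilon>_def)
  obtain z1 where z1: "0 < z1" "z1 < z0" "phi \<mu> s t z1 - \<epsilon> * (Digamma z0 - Digamma z1) < p"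
    using phi_perturb(1)[OF z0 \<epsilon>(1) crit] unfolding p_def by auto
  obtain z2 where z2: "z0 < z2" "z2 < \<mu>" "phi \<mu> s t z2 - \<epsilon> * (Digamma (\<mu> - z0) - Digamma (\<mu> - z2)) < p"
    using phi_perturb(2)[OF z0 \<epsilon>(1) crit] unfolding p_def by auto
  \<comment> \<open>X lies below p but above the rates of the far exits at z1 and z2.\<close>
  obtain X where X: "p - \<delta> / 2 < X" "phi \<mu> s t z1 - \<epsilon> * (Digamma z0 - Digamma z1) < X"
      "phi \<mu> s t z2 - \<epsilon> * (Digamma (\<mu> - z0) - Digamma (\<mu> - z2)) < X" "X < p"
    using dense[of "max (p - \<delta> / 2) (max (phi \<mu> s t z1 - \<epsilon> * (Digamma z0 - Digamma z1))
        (phi \<mu> s t z2 - \<epsilon> * (Digamma (\<mu> - z0) - Digamma (\<mu> - z2))))" p] \<delta> z1 z2 by auto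
  define Y where "Y = p - \<delta>"
  have digamma_lim: "((\<lambda>\<kappa>. Digamma (\<mu> - z0 - \<kappa>)) \<longlongrightarrow> Digamma (\<mu> - z0)) (at_right 0)"
  proof -
    have "isCont (\<lambda>\<kappa>. Digamma (\<mu> - z0 - \<kappa>)) 0"
      using z0 by (intro continuous_intros) (auto elim!: nonpos_Ints_cases)
    then have "((\<lambda>\<kappa>. Digamma (\<mu> - z0 - \<kappa>)) \<longlongrightarrow> Digamma (\<mu> - z0 - 0)) (at 0)" by (simp add: isCont_def)
    then show ?thesis by (simp add: filterlim_at_split)
  qed
  \<comment> \<open>The moment condition holds for small \<kappa> because its left side vanishes at
    0 with derivative X - p < 0; the last two conditions persist by continuity.\<close>
  have "eventually (\<lambda>\<kappa>. \<kappa> > 0 \<and> \<kappa> < min (\<mu> - z0) (z2 - z0) \<and>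
      \<kappa> * X + t * lmgf z0 (- \<kappa>) + s * lmgf (\<mu> - z0 - \<kappa>) (- \<kappa>) < 0 \<and>
      phi \<mu> s t z2 - \<epsilon> * (Digamma (\<mu> - z0 - \<kappa>) - Digamma (\<mu> - z2)) < X \<and>
      - Digamma (\<mu> - z0 - \<kappa>) < D1) (at_right 0)"
  proof (intro eventually_conj)
    show "eventually (\<lambda>\<kappa>. \<kappa> > 0) (at_right (0::real))" by (rule eventually_at_right_less)
    show "eventually (\<lambda>\<kappa>. \<kappa> < min (\<mu> - z0) (z2 - z0)) (at_right 0)"
      using z0 z2 by (intro order_tendstoD[OF tendsto_ident_at]) auto
    show "eventually (\<lambda>\<kappa>. \<kappa> * X + t * lmgf z0 (- \<kappa>) + s * lmgf (\<mu> - z0 - \<kappa>) (- \<kappa>) < 0) (at_right 0)"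
    proof (rule eventually_neg_at_right)
      show "((\<lambda>\<kappa>. \<kappa> * X + t * lmgf z0 (- \<kappa>) + s * lmgf (\<mu> - z0 - \<kappa>) (- \<kappa>)) has_real_derivative
          1 * X + t * Digamma z0 + s * Digamma (\<mu> - z0)) (at 0)"
        using z0 by (intro DERIV_add DERIV_cmult DERIV_cmult_right DERIV_ident DERIV_lmgf) auto
      show "1 * X + t * Digamma z0 + s * Digamma (\<mu> - z0) < 0" using X(4) by (simp add: p_def phi_def)
    qed auto
    have "((\<lambda>\<kappa>. phi \<mu> s t z2 - \<epsilon> * (Digamma (\<mu> - z0 - \<kappa>) - Digamma (\<mu> - z2))) \<longlongrightarrow>
        phi \<mu> s t z2 - \<epsilon> * (Digamma (\<mu> - z0) - Digamma (\<mu> - z2))) (at_right 0)"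
      by (intro tendsto_intros digamma_lim)
    then show "eventually (\<lambda>\<kappa>. phi \<mu> s t z2 - \<epsilon> * (Digamma (\<mu> - z0 - \<kappa>) - Digamma (\<mu> - z2)) < X) (at_right 0)"
      using X(3) by (rule order_tendstoD)
    have "((\<lambda>\<kappa>. - Digamma (\<mu> - z0 - \<kappa>)) \<longlongrightarrow> - Digamma (\<mu> - z0)) (at_right 0)"
      by (intro tendsto_intros digamma_lim)
    then show "eventually (\<lambda>\<kappa>. - Digamma (\<mu> - z0 - \<kappa>) < D1) (at_right 0)"
      using D1(4) by (rule order_tendstoD)
  qed
  then obtain \<kappa> where "\<kappa> > 0 \<and> \<kappa> < min (\<mu> - z0) (z2 - z0) \<and>
      \<kappa> * X + t * lmgf z0 (- \<kappa>) + s * lmgf (\<mu> - z0 - \<kappa>) (- \<kappa>) < 0 \<and>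
      phi \<mu> s t z2 - \<epsilon> * (Digamma (\<mu> - z0 - \<kappa>) - Digamma (\<mu> - z2)) < X \<and>
      - Digamma (\<mu> - z0 - \<kappa>) < D1"
    using eventually_happens'[OF trivial_limit_at_right_real] by blast
  then have \<kappa>: "\<kappa> > 0" "\<kappa> < \<mu> - z0" "\<kappa> < z2 - z0"
      "\<kappa> * X + t * lmgf z0 (- \<kappa>) + s * lmgf (\<mu> - z0 - \<kappa>) (- \<kappa>) < 0"
      "phi \<mu> s t z2 - \<epsilon> * (Digamma (\<mu> - z0 - \<kappa>) - Digamma (\<mu> - z2)) < X" "- Digamma (\<mu> - z0 - \<kappa>) < D1"
    by simp_all
  define a where "a = \<mu> - z0 - \<kappa>"
  have a: "a > 0" "\<mu> - z2 < a" using \<kappa> by (auto simp: a_def)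
  define F0 where "F0 = \<kappa> * X + t * lmgf z0 (- \<kappa>) + s * lmgf a (- \<kappa>)"
  have F0: "F0 < 0" using \<kappa>(4) by (simp add: F0_def a_def)
  define F1 where "F1 \<zeta> = - (\<zeta> * X) + t * lmgf z1 \<zeta> + s * lmgf (\<mu> - z1 + \<zeta>) \<zeta> - \<epsilon> * (lmgf z1 \<zeta> - lmgf z0 \<zeta>)" for \<zeta>
  define F2 where "F2 \<zeta> = - (\<zeta> * X) + t * lmgf z2 \<zeta> + s * lmgf (\<mu> - z2 + \<zeta>) \<zeta> - \<epsilon> * (lmgf (\<mu> - z2 + \<zeta>) \<zeta> - lmgf a \<zeta>)" for \<zeta>
  \<comment> \<open>Apart from the range of \<zeta>, every expression here vanishes at \<zeta> = 0,
    so the sign of its derivative there settles it.\<close>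
  have "eventually (\<lambda>\<zeta>. \<zeta> > 0 \<and> \<zeta> < min z1 a \<and> F1 \<zeta> < 0 \<and> F2 \<zeta> < 0 \<and>
      lmgf z0 \<zeta> - lmgf z1 \<zeta> < 0 \<and> lmgf a \<zeta> - lmgf (\<mu> - z2 + \<zeta>) \<zeta> < 0 \<and>
      lmgf z0 \<zeta> - \<zeta> * D1 < 0 \<and> lmgf a \<zeta> - \<zeta> * D1 < 0 \<and> lmgf \<mu> (- \<zeta>) - \<zeta> * D1 < 0) (at_right 0)"
  proof (intro eventually_conj)
    show "eventually (\<lambda>\<zeta>. \<zeta> > 0) (at_right (0::real))" by (rule eventually_at_right_less)
    show "eventually (\<lambda>\<zeta>. \<zeta> < min z1 a) (at_right 0)"
      using z1 a by (intro order_tendstoD[OF tendsto_ident_at]) auto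
    show "eventually (\<lambda>\<zeta>. F1 \<zeta> < 0) (at_right 0)"
    proof (rule eventually_neg_at_right)
      show "(F1 has_real_derivative - (1 * X) + t * (- Digamma z1) + s * (- Digamma (\<mu> - z1)) - \<epsilon> * (- Digamma z1 - - Digamma z0)) (at 0)"
        unfolding F1_def using z0 z1
        by (intro DERIV_add DERIV_diff DERIV_minus DERIV_cmult DERIV_cmult_right DERIV_ident DERIV_lmgf) auto
      show "- (1 * X) + t * (- Digamma z1) + s * (- Digamma (\<mu> - z1)) - \<epsilon> * (- Digamma z1 - - Digamma z0) < 0"
        using X(2) by (simp add: phi_def algebra_simps)
    qed (simp add: F1_def)
    show "eventually (\<lambda>\<zeta>. F2 \<zeta> < 0) (at_right 0)"
    proof (rule eventually_neg_at_right)
      show "(F2 has_real_derivative - (1 * X) + t * (- Digamma z2) + s * (- Digamma (\<mu> - z2)) - \<epsilon> * (- Digamma (\<mu> - z2) - - Digamma a)) (at 0)"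
        unfolding F2_def using z0 z2 a
        by (intro DERIV_add DERIV_diff DERIV_minus DERIV_cmult DERIV_cmult_right DERIV_ident DERIV_lmgf) auto
      show "- (1 * X) + t * (- Digamma z2) + s * (- Digamma (\<mu> - z2)) - \<epsilon> * (- Digamma (\<mu> - z2) - - Digamma a) < 0"
        using \<kappa>(5) by (simp add: phi_def algebra_simps a_def)
    qed (simp add: F2_def)
    show "eventually (\<lambda>\<zeta>. lmgf z0 \<zeta> - lmgf z1 \<zeta> < 0) (at_right 0)"
      by (rule eventually_neg_at_right[OF DERIV_diff[OF DERIV_lmgf(1) DERIV_lmgf(1)]])
        (use z0 z1 Digamma_real_strict_mono[of z1 z0] in auto)
    show "eventually (\<lambda>\<zeta>. lmgf a \<zeta> - lmgf (\<mu> - z2 + \<zeta>) \<zeta> < 0) (at_right 0)"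
      by (rule eventually_neg_at_right[OF DERIV_diff[OF DERIV_lmgf(1) DERIV_lmgf(3)]])
        (use a z2 Digamma_real_strict_mono[of "\<mu> - z2" a] in auto)
    show "eventually (\<lambda>\<zeta>. lmgf z0 \<zeta> - \<zeta> * D1 < 0) (at_right 0)"
      by (rule eventually_neg_at_right[OF DERIV_diff[OF DERIV_lmgf(1) DERIV_cmult_right[OF DERIV_ident]]])
        (use z0 D1 in auto)
    show "eventually (\<lambda>\<zeta>. lmgf a \<zeta> - \<zeta> * D1 < 0) (at_right 0)"
      by (rule eventually_neg_at_right[OF DERIV_diff[OF DERIV_lmgf(1) DERIV_cmult_right[OF DERIV_ident]]])
        (use a \<kappa>(6) in \<open>auto simp: a_def\<close>)
    show "eventually (\<lambda>\<zeta>. lmgf \<mu> (- \<zeta>) - \<zeta> * D1 < 0) (at_right 0)"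
      by (rule eventually_neg_at_right[OF DERIV_diff[OF DERIV_lmgf(2) DERIV_cmult_right[OF DERIV_ident]]])
        (use z0 D1 in auto)
  qed
  then obtain \<zeta> where "\<zeta> > 0 \<and> \<zeta> < min z1 a \<and> F1 \<zeta> < 0 \<and> F2 \<zeta> < 0 \<and>
      lmgf z0 \<zeta> - lmgf z1 \<zeta> < 0 \<and> lmgf a \<zeta> - lmgf (\<mu> - z2 + \<zeta>) \<zeta> < 0 \<and>
      lmgf z0 \<zeta> - \<zeta> * D1 < 0 \<and> lmgf a \<zeta> - \<zeta> * D1 < 0 \<and> lmgf \<mu> (- \<zeta>) - \<zeta> * D1 < 0"
    using eventually_happens'[OF trivial_limit_at_right_real] by blast
  then have \<zeta>: "\<zeta> > 0" "\<zeta> < z1" "\<zeta> < a" "F1 \<zeta> < 0" "F2 \<zeta> < 0"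
      "lmgf z0 \<zeta> \<le> lmgf z1 \<zeta>" "lmgf a \<zeta> \<le> lmgf (\<mu> - z2 + \<zeta>) \<zeta>"
      "lmgf z0 \<zeta> \<le> \<zeta> * D1" "lmgf a \<zeta> \<le> \<zeta> * D1" "lmgf \<mu> (- \<zeta>) \<le> \<zeta> * D1"
    by simp_all
  define F3 where "F3 = \<zeta> * (- X + Y + 2 * \<epsilon> * D1)"
  have F3: "F3 < 0" unfolding F3_def using \<zeta>(1) X(1) \<epsilon>(2) \<delta> by (intro mult_pos_neg) (auto simp: Y_def)
  define ab :: "real \<Rightarrow> real" where "ab = abs"
  have ab: "0 \<le> ab x" "- x \<le> ab x" "x \<le> ab x" for x by (auto simp: ab_def)
  define C where "C = ab (lmgf z0 (- \<kappa>)) + ab (lmgf a (- \<kappa>)) + ab (lmgf z1 \<zeta>) + ab (lmgf (\<mu> - z1 + \<zeta>) \<zeta>) +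
     2 * ab (lmgf z2 \<zeta>) + 2 * ab (lmgf (\<mu> - z2 + \<zeta>) \<zeta>) + 2 * (\<zeta> * D1)"
  note C_parts = ab(1)[of "lmgf z0 (- \<kappa>)"] ab(1)[of "lmgf a (- \<kappa>)"] ab(1)[of "lmgf z1 \<zeta>"]
    ab(1)[of "lmgf (\<mu> - z1 + \<zeta>) \<zeta>"] ab(1)[of "lmgf z2 \<zeta>"] ab(1)[of "lmgf (\<mu> - z2 + \<zeta>) \<zeta>"]
  \<comment> \<open>R adds to the bound for the bulk a Chernoff bound for the single log-weight at
    (0, 1).\<close>
  define R where "R N = exp (F0 * real N + C) + (real N * (s + t)) powr (\<zeta> + 1) *
      (exp (F1 \<zeta> * real N + C) + exp (F2 \<zeta> * real N + C) + exp (F3 * real N + C)) +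
      exp (lmgf \<mu> (- 1)) * exp (- \<delta> * real N)" for N
  have lim0: "((\<lambda>N. exp (F0 * real N + C)) \<longlongrightarrow> 0) sequentially"
    using F0 by real_asymp
  have lim1: "((\<lambda>N. (real N * (s + t)) powr (\<zeta> + 1) * exp (F * real N + C)) \<longlongrightarrow> 0) sequentially" if "F < 0" for F
    using that \<zeta> st by real_asymp
  have lim2: "((\<lambda>N. exp (lmgf \<mu> (- 1)) * exp (- \<delta> * real N)) \<longlongrightarrow> 0) sequentially"
    using \<delta> by real_asymp
  have "(R \<longlongrightarrow> 0) sequentially"
  proof -
    have "((\<lambda>N. exp (F0 * real N + C) + ((real N * (s + t)) powr (\<zeta> + 1) * exp (F1 \<zeta> * real N + C) +
      (real N * (s + t)) powr (\<zeta> + 1) * exp (F2 \<zeta> * real N + C) + (real N * (s + t)) powr (\<zeta> + 1) * exp (F3 * real N + C)) +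
      exp (lmgf \<mu> (- 1)) * exp (- \<delta> * real N)) \<longlongrightarrow> 0 + (0 + 0 + 0) + 0) sequentially"
      by (intro tendsto_add lim0 lim1 lim2 \<zeta> F3)
    then show ?thesis unfolding R_def by (simp add: distrib_left)
  qed
  then have Rlim: "((\<lambda>N. ennreal (R N)) \<longlongrightarrow> 0) sequentially"
    using tendsto_ennrealI[of R 0 sequentially] by simp
  have "eventually (\<lambda>N. emeasure (env (\<lambda>_. \<mu>)) {w. Zrec w (ldim s N) (ldim t N) \<le> exp (real N * (p - 2 * \<delta>))} \<le> ennreal (R N)) sequentially"
    using eventually_ldim_ge[OF st(1), of 1] eventually_ldim_ge[OF st(2), of 1]
  proof eventually_elim
    case (elim N)
    obtain m n where mn: "ldim s N = Suc m" "ldim t N = Suc n"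
      using elim by (metis Suc_le_D One_nat_def)
    define K where "K = nat \<lceil>\<epsilon> * real N\<rceil>"
    have K: "\<epsilon> * real N \<le> real K" "real K \<le> \<epsilon> * real N + 1"
      using \<epsilon> unfolding K_def by (simp_all add: real_nat_ceiling_ge)
    have dt: "real (Suc n) * A \<le> real N * t * A + ab A" for A
      using ldim_mult_bound[of t N A] st mn by (simp add: ab_def)
    have ds: "real (Suc m) * A \<le> real N * s * A + ab A" for A
      using ldim_mult_bound[of s N A] st mn by (simp add: ab_def)
    have D0: "0 \<le> \<zeta> * D1" using \<zeta> D1 by simp
    have up0: "\<kappa> * (real N * X) + real (Suc n) * lmgf z0 (- \<kappa>) + real (Suc m) * lmgf a (- \<kappa>) \<le> F0 * real N + C"
    proof -
      have "F0 * real N = \<kappa> * (real N * X) + real N * t * lmgf z0 (- \<kappa>) + real N * s * lmgf a (- \<kappa>)"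
        by (simp add: F0_def algebra_simps)
      then show ?thesis using dt[of "lmgf z0 (- \<kappa>)"] ds[of "lmgf a (- \<kappa>)"] D0 C_parts ab(2)[of "lmgf z2 \<zeta>"] ab(3)[of "lmgf (\<mu> - z2 + \<zeta>) \<zeta>"] unfolding C_def by linarith
    qed
    have up1: "- \<zeta> * (real N * X) + real (Suc n) * lmgf z1 \<zeta> + real (Suc m) * lmgf (\<mu> - z1 + \<zeta>) \<zeta> - real K * (lmgf z1 \<zeta> - lmgf z0 \<zeta>) \<le> F1 \<zeta> * real N + C"
    proof -
      have "F1 \<zeta> * real N = - \<zeta> * (real N * X) + real N * t * lmgf z1 \<zeta> + real N * s * lmgf (\<mu> - z1 + \<zeta>) \<zeta> - \<epsilon> * real N * (lmgf z1 \<zeta> - lmgf z0 \<zeta>)"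
        by (simp add: F1_def algebra_simps)
      moreover have "\<epsilon> * real N * (lmgf z1 \<zeta> - lmgf z0 \<zeta>) \<le> real K * (lmgf z1 \<zeta> - lmgf z0 \<zeta>)"
        using \<zeta> K by (intro mult_right_mono) auto
      ultimately show ?thesis using dt[of "lmgf z1 \<zeta>"] ds[of "lmgf (\<mu> - z1 + \<zeta>) \<zeta>"] D0 C_parts ab(2)[of "lmgf z2 \<zeta>"] ab(3)[of "lmgf (\<mu> - z2 + \<zeta>) \<zeta>"] unfolding C_def by linarith
    qed
    have up2: "- \<zeta> * (real N * X) + real n * lmgf z2 \<zeta> + real (Suc (Suc m)) * lmgf (\<mu> - z2 + \<zeta>) \<zeta> - real K * (lmgf (\<mu> - z2 + \<zeta>) \<zeta> - lmgf a \<zeta>) \<le> F2 \<zeta> * real N + C"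
    proof -
      have "F2 \<zeta> * real N = - \<zeta> * (real N * X) + real N * t * lmgf z2 \<zeta> + real N * s * lmgf (\<mu> - z2 + \<zeta>) \<zeta> - \<epsilon> * real N * (lmgf (\<mu> - z2 + \<zeta>) \<zeta> - lmgf a \<zeta>)"
        by (simp add: F2_def algebra_simps)
      moreover have "\<epsilon> * real N * (lmgf (\<mu> - z2 + \<zeta>) \<zeta> - lmgf a \<zeta>) \<le> real K * (lmgf (\<mu> - z2 + \<zeta>) \<zeta> - lmgf a \<zeta>)"
        using \<zeta> K by (intro mult_right_mono) auto
      moreover have "real n * lmgf z2 \<zeta> = real (Suc n) * lmgf z2 \<zeta> - lmgf z2 \<zeta>"
        "real (Suc (Suc m)) * lmgf (\<mu> - z2 + \<zeta>) \<zeta> = real (Suc m) * lmgf (\<mu> - z2 + \<zeta>) \<zeta> + lmgf (\<mu> - z2 + \<zeta>) \<zeta>"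
        by (simp_all add: algebra_simps)
      ultimately show ?thesis using dt[of "lmgf z2 \<zeta>"] ds[of "lmgf (\<mu> - z2 + \<zeta>) \<zeta>"] D0 C_parts ab(2)[of "lmgf z2 \<zeta>"] ab(3)[of "lmgf (\<mu> - z2 + \<zeta>) \<zeta>"] unfolding C_def by linarith
    qed
    have up3: "- \<zeta> * (real N * X) + \<zeta> * (real N * Y) + real K * (2 * (\<zeta> * D1)) \<le> F3 * real N + C"
    proof -
      have "F3 * real N = - \<zeta> * (real N * X) + \<zeta> * (real N * Y) + \<epsilon> * real N * (2 * (\<zeta> * D1))"
        by (simp add: F3_def algebra_simps)
      moreover have "real K * (2 * (\<zeta> * D1)) \<le> (\<epsilon> * real N + 1) * (2 * (\<zeta> * D1))"
        using K D0 by (intro mult_right_mono) auto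
      moreover have "(\<epsilon> * real N + 1) * (2 * (\<zeta> * D1)) = \<epsilon> * real N * (2 * (\<zeta> * D1)) + 2 * (\<zeta> * D1)"
        by (simp add: algebra_simps)
      ultimately show ?thesis using C_parts unfolding C_def by linarith
    qed
    have P: "real (m + n + 2) powr (\<zeta> + 1) \<le> (real N * (s + t)) powr (\<zeta> + 1)"
      using ldim_bounds(1)[of s N] ldim_bounds(1)[of t N] st \<zeta> mn
      by (intro powr_mono2) (auto simp: algebra_simps)
    let ?E = "env (\<lambda>_::nat \<times> nat. \<mu>)"
    have \<mu>: "\<mu> > 0" using z0 by simp
    have "emeasure ?E {w. bulk w m n \<le> exp (real N * Y)} \<le>
      ennreal (exp (\<kappa> * (real N * X) + real (Suc n) * lmgf z0 (- \<kappa>) + real (Suc m) * lmgf a (- \<kappa>)) +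
      real (m + n + 2) powr (\<zeta> + 1) * (
        exp (- \<zeta> * (real N * X) + real (Suc n) * lmgf z1 \<zeta> + real (Suc m) * lmgf (\<mu> - z1 + \<zeta>) \<zeta> - real K * (lmgf z1 \<zeta> - lmgf z0 \<zeta>)) +
        exp (- \<zeta> * (real N * X) + real n * lmgf z2 \<zeta> + real (Suc (Suc m)) * lmgf (\<mu> - z2 + \<zeta>) \<zeta> - real K * (lmgf (\<mu> - z2 + \<zeta>) \<zeta> - lmgf a \<zeta>)) +
        exp (- \<zeta> * (real N * X) + \<zeta> * (real N * Y) + real K * (2 * (\<zeta> * D1)))))"
      unfolding emeasure_bulk_eq[OF \<mu>] a_def
      by (rule bulk_small_prob) (use z0 z1 z2 \<kappa> \<zeta> D0 in \<open>auto simp: a_def\<close>)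
    also have "\<dots> \<le> ennreal (exp (F0 * real N + C) + (real N * (s + t)) powr (\<zeta> + 1) *
      (exp (F1 \<zeta> * real N + C) + exp (F2 \<zeta> * real N + C) + exp (F3 * real N + C)))"
      by (intro ennreal_leI add_mono mult_mono P iffD2[OF exp_le_cancel_iff] up0 up1 up2 up3) auto
    finally have bulk: "emeasure ?E {w. bulk w m n \<le> exp (real N * Y)} \<le> \<dots>" .
    have meas: "{w. bulk w m n \<le> exp (real N * Y)} \<in> sets ?E" "{w. 1 \<le> exp (- 1 * (real N * \<delta>)) * exp (- 1 * w (0, 1))} \<in> sets ?E"
    proof -
      have "{w \<in> space ?E. bulk w m n \<le> exp (real N * Y)} \<in> sets ?E" by measurable
      then show "{w. bulk w m n \<le> exp (real N * Y)} \<in> sets ?E" by simp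
      have "{w \<in> space ?E. 1 \<le> exp (- 1 * (real N * \<delta>)) * exp (- 1 * w (0, 1))} \<in> sets ?E" by measurable
      then show "{w. 1 \<le> exp (- 1 * (real N * \<delta>)) * exp (- 1 * w (0, 1))} \<in> sets ?E" by simp
    qed
    have "emeasure ?E {w. 1 \<le> exp (- 1 * (real N * \<delta>)) * exp (- 1 * w (0, 1))} \<le>
       (\<integral>\<^sup>+w. ennreal (exp (- 1 * (real N * \<delta>))) * ennreal (exp (- 1 * w (0, 1))) \<partial>?E)"
      unfolding nn_integral_indicator[OF meas(2), symmetric]
      by (rule nn_integral_mono) (auto simp: indicator_def ennreal_mult'[symmetric])
    also have "\<dots> = ennreal (exp (- 1 * (real N * \<delta>))) * ennreal (exp (lmgf \<mu> (- 1)))"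
      using nn_integral_exp_sum[of "{(0::nat, 1::nat)}" "\<lambda>_. \<mu>" "- 1"] \<mu> by (subst nn_integral_cmult) auto
    finally have edge: "emeasure ?E {w. 1 \<le> exp (- 1 * (real N * \<delta>)) * exp (- 1 * w (0, 1))} \<le>
       ennreal (exp (lmgf \<mu> (- 1)) * exp (- \<delta> * real N))"
      by (simp add: ennreal_mult'[symmetric] mult.commute)
    \<comment> \<open>The full partition function is at least the weight at (0, 1) times the bulk,
      so it is small only if the bulk or that one weight is.\<close>
    have "{w. Zrec w (Suc m) (Suc n) \<le> exp (real N * (p - 2 * \<delta>))} \<subseteq>
       {w. bulk w m n \<le> exp (real N * Y)} \<union> {w. 1 \<le> exp (- 1 * (real N * \<delta>)) * exp (- 1 * w (0, 1))}"
    proof (intro subsetI UnCI CollectI)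
      fix w :: "nat \<times> nat \<Rightarrow> real"
      assume w: "w \<in> {w. Zrec w (Suc m) (Suc n) \<le> exp (real N * (p - 2 * \<delta>))}"
        and "w \<notin> {w. 1 \<le> exp (- 1 * (real N * \<delta>)) * exp (- 1 * w (0, 1))}"
      then have "- real N * \<delta> \<le> w (0, 1)" by (simp add: exp_add[symmetric])
      have "exp (- real N * \<delta>) * bulk w m n \<le> exp (w (0, 1)) * bulk w m n"
        using \<open>- real N * \<delta> \<le> w (0, 1)\<close> by (intro mult_right_mono) (auto intro: less_imp_le bulk_pos)
      also have "\<dots> = left_exit w m n 0" by (simp add: left_exit_def bulk_def)
      also have "\<dots> \<le> Zrec w (Suc m) (Suc n)" by (rule left_exit_le) simp
      also have "\<dots> \<le> exp (real N * (p - 2 * \<delta>))" using w by simp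
      also have "\<dots> = exp (- real N * \<delta>) * exp (real N * Y)" by (simp add: Y_def exp_add[symmetric] algebra_simps)
      finally show "bulk w m n \<le> exp (real N * Y)" by simp
    qed
    then have "emeasure ?E {w. Zrec w (Suc m) (Suc n) \<le> exp (real N * (p - 2 * \<delta>))} \<le>
       emeasure ?E {w. bulk w m n \<le> exp (real N * Y)} + emeasure ?E {w. 1 \<le> exp (- 1 * (real N * \<delta>)) * exp (- 1 * w (0, 1))}"
      using meas by (intro order_trans[OF emeasure_mono emeasure_subadditive]) auto
    also have "\<dots> \<le> ennreal (exp (F0 * real N + C) + (real N * (s + t)) powr (\<zeta> + 1) *
      (exp (F1 \<zeta> * real N + C) + exp (F2 \<zeta> * real N + C) + exp (F3 * real N + C))) + ennreal (exp (lmgf \<mu> (- 1)) * exp (- \<delta> * real N))"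
      by (intro add_mono bulk edge)
    also have "\<dots> = ennreal (R N)"
      unfolding R_def by (subst ennreal_plus[symmetric]) auto
    finally show ?case unfolding mn .
  qed
  then show ?thesis
    unfolding p_def by (intro tendsto_sandwich[OF _ _ tendsto_const Rlim]) auto
qed

section \<open>Negative moments of a block\<close>

lemma Zrec_ge_straight:
  "exp (\<Sum>v\<in>{1..i} \<times> {0} \<union> {i} \<times> {1..j}. w v) \<le> Zrec w i j"
proof -
  have "(\<Sum>v\<in>{0::nat} \<times> {1..j}. shift_env i 0 w v) = (\<Sum>v\<in>{i} \<times> {1..j}. w v)"
    by (rule sum.reindex_bij_witness[where j = "\<lambda>v. (i + fst v, snd v)" and i = "\<lambda>v. (fst v - i, snd v)"]) auto
  moreover have "(\<Sum>v\<in>{1..i} \<times> {0} \<union> {i} \<times> {1..j}. w v) = (\<Sum>v\<in>{1..i} \<times> {0}. w v) + (\<Sum>v\<in>{i} \<times> {1..j}. w v)"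
    by (rule sum.union_disjoint) auto
  ultimately show ?thesis
    using Zrec_supermult[of w i 0 0 j] by (simp add: Zrec_bottom_edge Zrec_left_edge exp_add del: Zrec.simps)
qed

lemma moment_nn_integral_shift:
  assumes "\<mu> > 0"
  shows "(\<integral>\<^sup>+w. ennreal (Zrec (shift_env a b w) m n powr \<xi>) \<partial>env (\<lambda>_. \<mu>)) = moment \<mu> \<xi> m n"
  using nn_integral_path_shift[of "\<lambda>_. \<mu>" "{}" \<xi> a b \<mu> m n] assms by simp

text \<open>A negative power decreases in the partition function, so a single straight path already
  bounds it by independent weights.\<close>

lemma moment_neg_bound:
  assumes "\<mu> > 0" "\<tau> \<ge> 0"
  shows "moment \<mu> (- \<tau>) i j \<le> ennreal (exp (real (i + j) * lmgf \<mu> (- \<tau>)))"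
proof -
  let ?S = "{1..i} \<times> {0} \<union> {i} \<times> {1..j::nat}"
  have card: "card ?S = i + j" by (subst card_Un_disjoint) auto
  have "moment \<mu> (- \<tau>) i j \<le> (\<integral>\<^sup>+w. ennreal (exp (- \<tau> * (\<Sum>v\<in>?S. w v))) \<partial>env (\<lambda>_. \<mu>))"
    unfolding moment_def
  proof (intro nn_integral_mono ennreal_leI)
    fix w
    have "Zrec w i j powr (- \<tau>) \<le> exp (\<Sum>v\<in>?S. w v) powr (- \<tau>)"
      using assms by (intro powr_mono2' Zrec_ge_straight) auto
    then show "Zrec w i j powr (- \<tau>) \<le> exp (- \<tau> * (\<Sum>v\<in>?S. w v))" by (simp only: powr_exp_eq)
  qed
  also have "\<dots> = ennreal (exp (\<Sum>v\<in>?S. lmgf \<mu> (- \<tau>)))"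
    using assms by (intro nn_integral_exp_sum) auto
  also have "(\<Sum>v\<in>?S. lmgf \<mu> (- \<tau>)) = real (i + j) * lmgf \<mu> (- \<tau>)"
    by (subst sum_constant, subst card) simp
  finally show ?thesis .
qed

text \<open>The N-th root of the reciprocal partition function is at most exp(-(p - \<delta>/2)) off
  an event of vanishing probability, and its second moment is bounded uniformly in N. Truncation
  therefore carries the law of large numbers over to the mean.\<close>

lemma block_moment:
  assumes z0: "0 < z0" "z0 < \<mu>" and st: "s > 0" "t > 0" and \<delta>: "\<delta> > 0"
    and crit: "t * Polygamma 1 z0 = s * Polygamma 1 (\<mu> - z0)"
  shows "eventually (\<lambda>N. moment \<mu> (- 1 / real N) (ldim s N) (ldim t N) \<le> ennreal (exp (- (phi \<mu> s t z0 - \<delta>)))) sequentially"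
proof -
  define p where "p = phi \<mu> s t z0"
  have \<mu>: "\<mu> > 0" using z0 by simp
  define D where "D = \<bar>Digamma \<mu>\<bar> + 1"
  define M where "M = exp (2 * D * (s + t))"
  define gap where "gap = exp (- (p - \<delta>)) - exp (- (p - \<delta> / 2))"
  have gap: "gap > 0" using \<delta> by (simp add: gap_def)
  \<comment> \<open>Truncation level: values up to \<beta> on the bad event cost \<beta> times its
    probability, larger ones at most the second moment divided by \<beta>. Each part receives half
    of \<open>gap\<close>.\<close>
  define \<beta> where "\<beta> = 2 * M / gap"
  have \<beta>: "\<beta> > 0" "M / \<beta> = gap / 2" using gap by (auto simp: \<beta>_def M_def)
  define q where "q N = emeasure (env (\<lambda>_. \<mu>)) {w. Zrec w (ldim s N) (ldim t N) \<le> exp (real N * (p - 2 * (\<delta> / 4)))}" for N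
  have "q \<longlonglongrightarrow> 0"
    unfolding q_def p_def by (rule lln_lower) (use assms in auto)
  then have ev1: "eventually (\<lambda>N. q N < ennreal (gap / (2 * \<beta>))) sequentially"
    by (rule order_tendstoD(2)) (use gap \<beta>(1) in simp)
  \<comment> \<open>D exceeds the derivative of \<open>lmgf \<mu> (- x)\<close> at 0, so the
    exponent 2/N over a path of length of order N gives a bounded moment.\<close>
  have "eventually (\<lambda>x. lmgf \<mu> (- x) - x * D < 0) (at_right 0)"
    by (rule eventually_neg_at_right[OF DERIV_diff[OF DERIV_lmgf(2) DERIV_cmult_right[OF DERIV_ident]]])
      (use \<mu> in \<open>auto simp: D_def\<close>)
  moreover have "filterlim (\<lambda>N. 2 / real N) (at_right 0) sequentially" by real_asymp
  ultimately have ev2: "eventually (\<lambda>N. lmgf \<mu> (- (2 / real N)) - 2 / real N * D < 0) sequentially"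
    by (rule eventually_compose_filterlim)
  show ?thesis
    using ev1 ev2 eventually_gt_at_top[of 0]
  proof eventually_elim
    case (elim N)
    let ?E = "env (\<lambda>_::nat \<times> nat. \<mu>)" and ?Z = "\<lambda>w. Zrec w (ldim s N) (ldim t N)"
    let ?B = "{w. ?Z w \<le> exp (real N * (p - 2 * (\<delta> / 4)))}"
    interpret E: prob_space ?E using \<mu> by (intro prob_space_env)
    have B: "?B \<in> sets ?E"
    proof -
      have "{w \<in> space ?E. ?Z w \<le> exp (real N * (p - 2 * (\<delta> / 4)))} \<in> sets ?E" by measurable
      then show ?thesis by simp
    qed
    have pw: "?Z w powr (- 1 / real N) \<le> exp (- (p - \<delta> / 2)) + \<beta> * indicator ?B w + ?Z w powr (- (2 / real N)) / \<beta>" for w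
    proof (cases "w \<in> ?B")
      case False
      then have "?Z w powr (- 1 / real N) \<le> exp (real N * (p - 2 * (\<delta> / 4))) powr (- 1 / real N)"
        using elim(3) by (intro powr_mono2') auto
      also have "\<dots> = exp (- (p - \<delta> / 2))" using elim(3) by (simp add: powr_exp_eq)
      finally show ?thesis using \<beta> False by (simp add: add_increasing2)
    next
      case True
      define y where "y = ?Z w powr (- 1 / real N)"
      have y2: "?Z w powr (- (2 / real N)) = y * y"
        unfolding y_def by (simp add: powr_add[symmetric])
      have "y \<le> \<beta> + y * y / \<beta>"
      proof (cases "y \<le> \<beta>")
        case False
        then have "y * \<beta> \<le> y * y" using \<beta> by (intro mult_left_mono) auto
        then have "y \<le> y * y / \<beta>" using \<beta> by (simp add: field_simps)
        then show ?thesis using \<beta> by simp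
      qed (use \<beta> in \<open>simp add: add_increasing2\<close>)
      then have "y \<le> exp (- (p - \<delta> / 2)) + \<beta> * 1 + y * y / \<beta>"
        using exp_ge_zero[of "- (p - \<delta> / 2)"] by linarith
      moreover have "indicator ?B w = (1 :: real)" using True by simp
      ultimately show ?thesis unfolding y2 y_def[symmetric] by simp
    qed
    have dims: "real (ldim s N + ldim t N) \<le> real N * (s + t)"
      using ldim_bounds(1)[of s N] ldim_bounds(1)[of t N] st by (simp add: algebra_simps)
    have "moment \<mu> (- (2 / real N)) (ldim s N) (ldim t N) \<le> ennreal (exp (real (ldim s N + ldim t N) * lmgf \<mu> (- (2 / real N))))"
      using \<mu> by (intro moment_neg_bound) auto
    also have "\<dots> \<le> ennreal M"
    proof (rule ennreal_leI)
      have "real (ldim s N + ldim t N) * lmgf \<mu> (- (2 / real N)) \<le> real (ldim s N + ldim t N) * (2 / real N * D)"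
        using elim(2) by (intro mult_left_mono) auto
      also have "\<dots> \<le> (real N * (s + t)) * (2 / real N * D)"
        by (intro mult_right_mono dims) (auto simp: D_def)
      also have "\<dots> = 2 * D * (s + t)" using elim(3) by simp
      finally show "exp (real (ldim s N + ldim t N) * lmgf \<mu> (- (2 / real N))) \<le> M" by (simp add: M_def)
    qed
    finally have mom2: "moment \<mu> (- (2 / real N)) (ldim s N) (ldim t N) \<le> ennreal M" .
    have "moment \<mu> (- 1 / real N) (ldim s N) (ldim t N) \<le>
      (\<integral>\<^sup>+w. ennreal (exp (- (p - \<delta> / 2))) + ennreal \<beta> * indicator ?B w + ennreal (1 / \<beta>) * ennreal (?Z w powr (- (2 / real N))) \<partial>?E)"
      unfolding moment_def
    proof (rule nn_integral_mono)
      fix w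
      have "ennreal (?Z w powr (- 1 / real N)) \<le> ennreal (exp (- (p - \<delta> / 2)) + \<beta> * indicator ?B w + 1 / \<beta> * ?Z w powr (- (2 / real N)))"
        using pw[of w] by (intro ennreal_leI) simp
      also have "\<dots> = ennreal (exp (- (p - \<delta> / 2))) + ennreal \<beta> * indicator ?B w + ennreal (1 / \<beta>) * ennreal (?Z w powr (- (2 / real N)))"
        using \<beta> by (simp add: ennreal_mult' ennreal_indicator[symmetric] ennreal_plus[symmetric] del: ennreal_plus) (simp add: ennreal_mult'[symmetric])
      finally show "ennreal (?Z w powr (- 1 / real N)) \<le> \<dots>" .
    qed
    also have "\<dots> = ennreal (exp (- (p - \<delta> / 2))) + ennreal \<beta> * q N + ennreal (1 / \<beta>) * moment \<mu> (- (2 / real N)) (ldim s N) (ldim t N)"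
      using B E.emeasure_space_1 unfolding moment_def q_def
      by (subst nn_integral_add, simp, simp, subst nn_integral_add, simp, simp) (simp add: nn_integral_cmult nn_integral_cmult_indicator)
    also have "\<dots> \<le> ennreal (exp (- (p - \<delta> / 2))) + ennreal \<beta> * ennreal (gap / (2 * \<beta>)) + ennreal (1 / \<beta>) * ennreal M"
      using elim(1) by (intro add_mono mult_left_mono mom2) auto
    also have "\<dots> = ennreal (exp (- (p - \<delta> / 2)) + gap / 2 + gap / 2)"
    proof -
      have 1: "1 / \<beta> * M = gap / 2" using \<beta>(2) by simp
      have 2: "\<beta> * (gap / (2 * \<beta>)) = gap / 2" using \<beta>(1) by simp
      have "ennreal (1 / \<beta>) * ennreal M = ennreal (gap / 2)"
        unfolding 1[symmetric] using \<beta>(1) by (intro ennreal_mult'[symmetric]) simp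
      moreover have "ennreal \<beta> * ennreal (gap / (2 * \<beta>)) = ennreal (gap / 2)"
        unfolding 2[symmetric] using \<beta>(1) by (intro ennreal_mult'[symmetric]) simp
      ultimately show ?thesis
        using gap by (simp add: ennreal_plus[symmetric] del: ennreal_plus)
    qed
    also have "exp (- (p - \<delta> / 2)) + gap / 2 + gap / 2 = exp (- (p - \<delta>))"
      by (simp add: gap_def)
    finally show ?case by (simp add: p_def)
  qed
qed

section \<open>Disjoint lanes of blocks\<close>

text \<open>Blocks placed corner to corner. A block omits the weight at its own origin, which is the
  last corner of the preceding block, so no weight is used twice and the factors are
  independent.\<close>

definition lane :: "nat \<Rightarrow> nat \<Rightarrow> nat \<Rightarrow> nat \<Rightarrow> (nat \<times> nat \<Rightarrow> real) \<Rightarrow> real" where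
  "lane a b x k w = (\<Prod>i<k. Zrec (shift_env (x + i * a) (i * b) w) a b)"

lemma lane_measurable [measurable]: "lane a b x k \<in> borel_measurable env_borel"
  unfolding lane_def [abs_def] by measurable

lemma lane_pos: "lane a b x k w > 0"
  unfolding lane_def by (intro prod_pos) auto

lemma lane_le_Zrec: "Zrec w x 0 * lane a b x k w \<le> Zrec w (x + k * a) (k * b)"
proof (induction k)
  case (Suc k)
  have "Zrec w x 0 * lane a b x (Suc k) w = (Zrec w x 0 * lane a b x k w) * Zrec (shift_env (x + k * a) (k * b) w) a b"
    by (simp add: lane_def)
  also have "\<dots> \<le> Zrec w (x + k * a) (k * b) * Zrec (shift_env (x + k * a) (k * b) w) a b"
    by (intro mult_right_mono Suc) auto
  also have "\<dots> \<le> Zrec w (x + k * a + a) (k * b + b)" by (rule Zrec_supermult)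
  finally show ?case by (simp add: algebra_simps)
qed (simp add: lane_def)

definition lane_sites :: "nat \<Rightarrow> nat \<Rightarrow> nat \<Rightarrow> nat \<Rightarrow> (nat \<times> nat) set" where
  "lane_sites a b x k = (\<Union>i<k. {x + i * a..x + Suc i * a} \<times> {i * b..Suc i * b})"

lemma depends_on_lane: "depends_on (lane_sites a b x k) (lane a b x k)"
proof (rule depends_onI)
  fix w w' :: "nat \<times> nat \<Rightarrow> real" assume w: "\<And>v. v \<in> lane_sites a b x k \<Longrightarrow> w v = w' v"
  show "lane a b x k w = lane a b x k w'"
    unfolding lane_def
  proof (intro prod.cong refl Zrec_cong)
    fix i u v assume "i \<in> {..<k}" "u \<le> a" "v \<le> b"
    then show "shift_env (x + i * a) (i * b) w (u, v) = shift_env (x + i * a) (i * b) w' (u, v)"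
      unfolding shift_env_apply by (intro w) (auto simp: lane_sites_def intro!: bexI[of _ i])
  qed
qed

text \<open>At the height of a common site the block index in the left lane would be at most one
  more than in the right lane. Two block widths and one extra column already separate such
  blocks.\<close>

lemma lane_sites_disjoint:
  assumes "b \<ge> 1" "x + (2 * a + 1) \<le> y"
  shows "lane_sites a b x k \<inter> lane_sites a b y k = {}"
proof (rule ccontr)
  assume "\<not> ?thesis"
  then obtain i j u v where ij: "x + i * a \<le> u" "u \<le> x + Suc i * a" "i * b \<le> v" "v \<le> Suc i * b"
     "y + j * a \<le> u" "u \<le> y + Suc j * a" "j * b \<le> v" "v \<le> Suc j * b"
    unfolding lane_sites_def by auto
  have "i * b \<le> Suc j * b" using ij by linarith
  then have "i \<le> Suc j" using assms(1) by (simp only: mult_le_cancel2)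
  then have "Suc i * a \<le> (j + 2) * a" by (intro mult_right_mono) auto
  then show False using ij assms(2) by (simp add: algebra_simps)
qed

lemma moment_lane:
  assumes "\<mu> > 0"
  shows "(\<integral>\<^sup>+w. ennreal (lane a b x k w powr \<xi>) \<partial>env (\<lambda>_. \<mu>)) = moment \<mu> \<xi> a b ^ k"
proof (induction k)
  case 0
  interpret E: prob_space "env (\<lambda>_::nat \<times> nat. \<mu>)" using assms by (intro prob_space_env)
  show ?case using E.emeasure_space_1 by (simp add: lane_def)
next
  case (Suc k)
  let ?B = "{v. x + k * a \<le> fst v \<and> k * b \<le> snd v \<and> v \<noteq> (x + k * a, k * b)}"
  have "(\<integral>\<^sup>+w. ennreal (lane a b x (Suc k) w powr \<xi>) \<partial>env (\<lambda>_. \<mu>)) =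
    (\<integral>\<^sup>+w. ennreal (lane a b x k w powr \<xi>) * ennreal (Zrec (shift_env (x + k * a) (k * b) w) a b powr \<xi>) \<partial>env (\<lambda>_. \<mu>))"
    by (simp add: lane_def powr_mult prod_nonneg ennreal_mult')
  also have "\<dots> = (\<integral>\<^sup>+w. ennreal (lane a b x k w powr \<xi>) \<partial>env (\<lambda>_. \<mu>)) *
     (\<integral>\<^sup>+w. ennreal (Zrec (shift_env (x + k * a) (k * b) w) a b powr \<xi>) \<partial>env (\<lambda>_. \<mu>))"
  proof (rule nn_integral_env_mult[where A = "lane_sites a b x k" and B = ?B])
    show "depends_on (lane_sites a b x k) (\<lambda>w. ennreal (lane a b x k w powr \<xi>))"
      by (rule depends_on_compose[OF depends_on_lane])
    show "depends_on ?B (\<lambda>w. ennreal (Zrec (shift_env (x + k * a) (k * b) w) a b powr \<xi>))"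
    proof (rule depends_onI)
      fix w w' :: "nat \<times> nat \<Rightarrow> real"
      assume "\<And>v. v \<in> ?B \<Longrightarrow> w v = w' v"
      then have "Zrec (shift_env (x + k * a) (k * b) w) a b = Zrec (shift_env (x + k * a) (k * b) w') a b"
        by (intro Zrec_cong) auto
      then show "ennreal (Zrec (shift_env (x + k * a) (k * b) w) a b powr \<xi>) = ennreal (Zrec (shift_env (x + k * a) (k * b) w') a b powr \<xi>)" by simp
    qed
    have "u \<le> x + k * a \<and> v \<le> k * b" if "(u, v) \<in> lane_sites a b x k" for u v
    proof -
      obtain i where i: "i < k" "u \<le> x + Suc i * a" "v \<le> Suc i * b"
        using \<open>(u, v) \<in> lane_sites a b x k\<close> unfolding lane_sites_def by auto
      have "Suc i * a \<le> k * a" "Suc i * b \<le> k * b" using i(1) by (intro mult_right_mono; simp)+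
      then show ?thesis using i by linarith
    qed
    then show "lane_sites a b x k \<inter> ?B = {}" by fastforce
  qed (use assms in auto)
  finally show ?case
    by (simp add: Suc moment_nn_integral_shift assms mult.commute)
qed

lemma moment_lanes:
  assumes "\<mu> > 0" "b \<ge> 1"
  shows "(\<integral>\<^sup>+w. (\<Prod>l<L. ennreal (lane a b (l * (2 * a + 1)) k w powr \<xi>)) \<partial>env (\<lambda>_. \<mu>)) = moment \<mu> \<xi> a b ^ (k * L)"
proof (induction L)
  case 0
  interpret E: prob_space "env (\<lambda>_::nat \<times> nat. \<mu>)" using assms by (intro prob_space_env)
  show ?case using E.emeasure_space_1 by simp
next
  case (Suc L)
  let ?x = "\<lambda>l. l * (2 * a + 1)"
  have "(\<integral>\<^sup>+w. (\<Prod>l<Suc L. ennreal (lane a b (?x l) k w powr \<xi>)) \<partial>env (\<lambda>_. \<mu>)) =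
     (\<integral>\<^sup>+w. (\<Prod>l<L. ennreal (lane a b (?x l) k w powr \<xi>)) * ennreal (lane a b (?x L) k w powr \<xi>) \<partial>env (\<lambda>_. \<mu>))"
    by simp
  also have "\<dots> = (\<integral>\<^sup>+w. (\<Prod>l<L. ennreal (lane a b (?x l) k w powr \<xi>)) \<partial>env (\<lambda>_. \<mu>)) * (\<integral>\<^sup>+w. ennreal (lane a b (?x L) k w powr \<xi>) \<partial>env (\<lambda>_. \<mu>))"
  proof (rule nn_integral_env_mult[where A = "\<Union>l<L. lane_sites a b (?x l) k" and B = "lane_sites a b (?x L) k"])
    show "depends_on (\<Union>l<L. lane_sites a b (?x l) k) (\<lambda>w. \<Prod>l<L. ennreal (lane a b (?x l) k w powr \<xi>))"
    proof (rule depends_onI, rule prod.cong[OF refl])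
      fix w w' :: "nat \<times> nat \<Rightarrow> real" and l assume "\<And>v. v \<in> (\<Union>l<L. lane_sites a b (?x l) k) \<Longrightarrow> w v = w' v" "l \<in> {..<L}"
      then have "lane a b (?x l) k w = lane a b (?x l) k w'" by (intro depends_onD[OF depends_on_lane]) auto
      then show "ennreal (lane a b (?x l) k w powr \<xi>) = ennreal (lane a b (?x l) k w' powr \<xi>)" by simp
    qed
    show "depends_on (lane_sites a b (?x L) k) (\<lambda>w. ennreal (lane a b (?x L) k w powr \<xi>))"
      by (rule depends_on_compose[OF depends_on_lane])
    have "lane_sites a b (?x l) k \<inter> lane_sites a b (?x L) k = {}" if "l < L" for l
    proof (rule lane_sites_disjoint[OF assms(2)])
      have "Suc l * (2 * a + 1) \<le> L * (2 * a + 1)" using that by (intro mult_right_mono) auto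
      then show "?x l + (2 * a + 1) \<le> ?x L" by simp
    qed
    then show "(\<Union>l<L. lane_sites a b (?x l) k) \<inter> lane_sites a b (?x L) k = {}" by auto
  qed (use assms in auto)
  also have "\<dots> = moment \<mu> \<xi> a b ^ (k * Suc L)"
    unfolding Suc moment_lane[OF assms(1)] by (simp add: power_add mult.commute)
  finally show ?case .
qed

definition connector :: "nat \<Rightarrow> nat \<Rightarrow> nat \<Rightarrow> nat \<Rightarrow> nat \<Rightarrow> (nat \<times> nat) set" where
  "connector x y h i j = {1..x} \<times> {0} \<union> {Suc y..y + i} \<times> {h} \<union> {y + i} \<times> {Suc h..h + j}"

lemma lane_connected:
  assumes "k * b \<ge> 1"
  shows "exp (\<Sum>v\<in>connector x (x + k * a) (k * b) i j. w v) * lane a b x k w \<le> Zrec w (x + k * a + i) (k * b + j)"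
proof -
  let ?y = "x + k * a" and ?h = "k * b"
  have sh: "(\<Sum>v\<in>{1..i} \<times> {0} \<union> {i} \<times> {1..j}. shift_env ?y ?h w v) = (\<Sum>v\<in>{Suc ?y..?y + i} \<times> {?h} \<union> {?y + i} \<times> {Suc ?h..?h + j}. w v)"
    by (rule sum.reindex_bij_witness[where j = "\<lambda>v. (?y + fst v, ?h + snd v)" and i = "\<lambda>v. (fst v - ?y, snd v - ?h)"])
      (auto simp: shift_env_def)
  \<comment> \<open>The initial piece lies at height 0 and the final one at height
    \<open>k * b\<close> or above, which is positive, so no weight is counted twice.\<close>
  have "(\<Sum>v\<in>connector x ?y ?h i j. w v) = (\<Sum>v\<in>{1..x} \<times> {0}. w v) + (\<Sum>v\<in>{Suc ?y..?y + i} \<times> {?h} \<union> {?y + i} \<times> {Suc ?h..?h + j}. w v)"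
    unfolding connector_def Un_assoc using assms by (intro sum.union_disjoint) auto
  then have "exp (\<Sum>v\<in>connector x ?y ?h i j. w v) * lane a b x k w =
      (Zrec w x 0 * lane a b x k w) * exp (\<Sum>v\<in>{1..i} \<times> {0} \<union> {i} \<times> {1..j}. shift_env ?y ?h w v)"
    unfolding sh by (simp add: Zrec_bottom_edge exp_add del: Zrec.simps)
  also have "\<dots> \<le> Zrec w ?y ?h * Zrec (shift_env ?y ?h w) i j"
    by (intro mult_mono lane_le_Zrec Zrec_ge_straight) auto
  also have "\<dots> \<le> Zrec w (?y + i) (?h + j)" by (rule Zrec_supermult)
  finally show ?thesis .
qed

lemma card_connector: "finite (connector x y h i j)" "card (connector x y h i j) \<le> x + i + j"
proof -
  show "finite (connector x y h i j)" by (simp add: connector_def)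
  show "card (connector x y h i j) \<le> x + i + j"
    unfolding connector_def
    by (rule order_trans[OF card_Un_le add_mono[OF order_trans[OF card_Un_le]]]) auto
qed

text \<open>If the partition function is small, then some connector is small or all L lanes are
  small at once. Connectors overlap, so they get a union bound; lanes are independent, and their
  L-th power is the source of arbitrarily large exponential rates.\<close>

lemma left_tail_ineq:
  assumes \<mu>: "\<mu> > 0" and b: "b \<ge> 1" "k \<ge> 1" and \<kappa>: "\<kappa> \<ge> 0" "\<tau> \<ge> 0"
    and fit: "\<And>l. l < L \<Longrightarrow> l * (2 * a + 1) + k * a \<le> m" "k * b \<le> n"
  shows "emeasure (env (\<lambda>_. \<mu>)) {w. Zrec w m n \<le> exp (T - c)} \<le>
    of_nat L * ennreal (exp (- \<kappa> * c + real (m - k * a + (n - k * b)) * \<bar>lmgf \<mu> (- \<kappa>)\<bar>)) +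
    (ennreal (exp (\<tau> * T)) * moment \<mu> (- \<tau>) a b ^ k) ^ L"
proof -
  let ?E = "env (\<lambda>_::nat \<times> nat. \<mu>)" and ?x = "\<lambda>l. l * (2 * a + 1)"
  define S where "S l = connector (?x l) (?x l + k * a) (k * b) (m - (?x l + k * a)) (n - k * b)" for l
  have S: "finite (S l)" "l < L \<Longrightarrow> card (S l) \<le> m - k * a + (n - k * b)" for l
    using card_connector[of "?x l" "?x l + k * a" "k * b" "m - (?x l + k * a)" "n - k * b"] fit(1)[of l]
    unfolding S_def by auto
  have conn: "exp (\<Sum>v\<in>S l. w v) * lane a b (?x l) k w \<le> Zrec w m n" if "l < L" for l w
    using lane_connected[where k = k and b = b and x = "?x l" and a = a and i = "m - (?x l + k * a)" and j = "n - k * b" and w = w] b fit(1)[OF that] fit(2)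
    unfolding S_def by simp
  define f where "f w = (\<Sum>l<L. ennreal (exp (- \<kappa> * c)) * ennreal (exp (- \<kappa> * (\<Sum>v\<in>S l. w v)))) +
     (\<Prod>l<L. ennreal (exp (\<tau> * T)) * ennreal (lane a b (?x l) k w powr (- \<tau>)))" for w
  have meas: "{w. Zrec w m n \<le> exp (T - c)} \<in> sets ?E"
  proof -
    have "{w \<in> space ?E. Zrec w m n \<le> exp (T - c)} \<in> sets ?E" by measurable
    then show ?thesis by simp
  qed
  have "1 \<le> f w" if w: "Zrec w m n \<le> exp (T - c)" for w
  proof (cases "\<exists>l<L. (\<Sum>v\<in>S l. w v) \<le> - c")
    case True
    then obtain l where l: "l < L" "(\<Sum>v\<in>S l. w v) \<le> - c" by auto
    have "\<kappa> * (\<Sum>v\<in>S l. w v) \<le> \<kappa> * - c" using l \<kappa> by (intro mult_left_mono) auto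
    then have "1 \<le> exp (- \<kappa> * c) * exp (- \<kappa> * (\<Sum>v\<in>S l. w v))" by (simp add: exp_add[symmetric])
    then have "1 \<le> ennreal (exp (- \<kappa> * c)) * ennreal (exp (- \<kappa> * (\<Sum>v\<in>S l. w v)))"
      by (simp add: ennreal_mult'[symmetric])
    also have "\<dots> \<le> (\<Sum>l<L. ennreal (exp (- \<kappa> * c)) * ennreal (exp (- \<kappa> * (\<Sum>v\<in>S l. w v))))"
      using l by (intro member_le_sum) auto
    also have "\<dots> \<le> f w" unfolding f_def by simp
    finally show ?thesis .
  next
    case False
    have "1 \<le> ennreal (exp (\<tau> * T)) * ennreal (lane a b (?x l) k w powr (- \<tau>))" if l: "l < L" for l
    proof -
      have "exp (- c) * lane a b (?x l) k w \<le> exp (\<Sum>v\<in>S l. w v) * lane a b (?x l) k w"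
        using False l lane_pos[of a b "?x l" k w] by (intro mult_right_mono) auto
      also have "\<dots> \<le> exp (T - c)" using conn[OF l, of w] w by simp
      also have "\<dots> = exp (- c) * exp T" by (simp add: exp_add[symmetric])
      finally have le: "lane a b (?x l) k w \<le> exp T" by simp
      have "1 = exp (\<tau> * T) * exp T powr (- \<tau>)" by (simp add: powr_exp_eq exp_minus)
      also have "\<dots> \<le> exp (\<tau> * T) * lane a b (?x l) k w powr (- \<tau>)"
        using le \<kappa> lane_pos[of a b "?x l" k w] by (intro mult_left_mono powr_mono2') auto
      finally show ?thesis by (simp add: ennreal_mult'[symmetric])
    qed
    then have "1 \<le> (\<Prod>l<L. ennreal (exp (\<tau> * T)) * ennreal (lane a b (?x l) k w powr (- \<tau>)))"
      by (intro prod_ge_1) auto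
    also have "\<dots> \<le> f w" unfolding f_def by simp
    finally show ?thesis .
  qed
  then have "emeasure ?E {w. Zrec w m n \<le> exp (T - c)} \<le> (\<integral>\<^sup>+w. f w \<partial>?E)"
    unfolding nn_integral_indicator[OF meas, symmetric]
    by (intro nn_integral_mono) (auto simp: indicator_def)
  also have "\<dots> = (\<Sum>l<L. ennreal (exp (- \<kappa> * c)) * (\<integral>\<^sup>+w. ennreal (exp (- \<kappa> * (\<Sum>v\<in>S l. w v))) \<partial>?E)) +
     (\<integral>\<^sup>+w. ennreal (exp (\<tau> * T)) ^ L * (\<Prod>l<L. ennreal (lane a b (?x l) k w powr (- \<tau>))) \<partial>?E)"
    unfolding f_def by (simp add: nn_integral_add nn_integral_sum nn_integral_cmult prod.distrib)
  also have "(\<integral>\<^sup>+w. ennreal (exp (\<tau> * T)) ^ L * (\<Prod>l<L. ennreal (lane a b (?x l) k w powr (- \<tau>))) \<partial>?E) =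
     (ennreal (exp (\<tau> * T)) * moment \<mu> (- \<tau>) a b ^ k) ^ L"
    by (subst nn_integral_cmult, simp, subst moment_lanes[OF \<mu> b(1)]) (simp add: power_mult power_mult_distrib)
  also have "(\<Sum>l<L. ennreal (exp (- \<kappa> * c)) * (\<integral>\<^sup>+w. ennreal (exp (- \<kappa> * (\<Sum>v\<in>S l. w v))) \<partial>?E)) \<le>
     (\<Sum>l<L. ennreal (exp (- \<kappa> * c + real (m - k * a + (n - k * b)) * \<bar>lmgf \<mu> (- \<kappa>)\<bar>)))"
  proof (rule sum_mono)
    fix l assume l: "l \<in> {..<L}"
    have "(\<Sum>v\<in>S l. lmgf \<mu> (- \<kappa>)) \<le> real (card (S l)) * \<bar>lmgf \<mu> (- \<kappa>)\<bar>"
      by (simp add: mult_left_mono)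
    also have "\<dots> \<le> real (m - k * a + (n - k * b)) * \<bar>lmgf \<mu> (- \<kappa>)\<bar>"
      using S(2)[of l] l by (intro mult_right_mono) (auto simp flip: of_nat_add)
    finally have le: "(\<Sum>v\<in>S l. lmgf \<mu> (- \<kappa>)) \<le> real (m - k * a + (n - k * b)) * \<bar>lmgf \<mu> (- \<kappa>)\<bar>" .
    have "(\<integral>\<^sup>+w. ennreal (exp (- \<kappa> * (\<Sum>v\<in>S l. w v))) \<partial>?E) = ennreal (exp (\<Sum>v\<in>S l. lmgf \<mu> (- \<kappa>)))"
      using S(1) \<mu> \<kappa> by (intro nn_integral_exp_sum) auto
    then have "ennreal (exp (- \<kappa> * c)) * (\<integral>\<^sup>+w. ennreal (exp (- \<kappa> * (\<Sum>v\<in>S l. w v))) \<partial>?E) = ennreal (exp (- \<kappa> * c + (\<Sum>v\<in>S l. lmgf \<mu> (- \<kappa>))))"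
      by (simp add: ennreal_mult'[symmetric] exp_add[symmetric])
    also have "\<dots> \<le> ennreal (exp (- \<kappa> * c + real (m - k * a + (n - k * b)) * \<bar>lmgf \<mu> (- \<kappa>)\<bar>))"
      using le by (intro ennreal_leI) simp
    finally show "ennreal (exp (- \<kappa> * c)) * (\<integral>\<^sup>+w. ennreal (exp (- \<kappa> * (\<Sum>v\<in>S l. w v))) \<partial>?E) \<le> \<dots>" .
  qed
  finally show ?thesis by (simp add: add_right_mono)
qed


text \<open>Constants are fixed in the order \<kappa> (from K), block size N0 (from \<kappa>),
  number of lanes L (from N0), discarded blocks C0 (from L); only then does N grow. The lanes thus
  consist of about N/N0 blocks each, with L independent of N.\<close>

theorem left_tail:
  assumes z0: "0 < z0" "z0 < \<mu>" and st: "s > 0" "t > 0" and \<delta>: "\<delta> > 0"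
    and crit: "t * Polygamma 1 z0 = s * Polygamma 1 (\<mu> - z0)"
  shows "eventually (\<lambda>N. emeasure (env (\<lambda>_. \<mu>)) {w. Zrec w (ldim s N) (ldim t N) \<le> exp (real N * (phi \<mu> s t z0 - \<delta>))}
    \<le> ennreal (exp (- K * real N))) sequentially"
proof -
  define p where "p = phi \<mu> s t z0"
  \<comment> \<open>The four quarters of \<delta> pay for the block mean, the deviation of a lane
    from it, the connectors, and the part of N that no block covers.\<close>
  define d where "d = \<delta> / 4"
  have d: "d > 0" using \<delta> by (simp add: d_def)
  have \<mu>: "\<mu> > 0" using z0 by simp
  \<comment> \<open>A connector deficit dN then costs exp(-(K + 2)N) times a moment of O(N/N0)
    weights; the later choice of N0 keeps this moment below a constant times exp(N). The maximum
    covers very negative K.\<close>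
  define \<kappa> where "\<kappa> = max 0 ((K + 2) / d)"
  have \<kappa>: "\<kappa> \<ge> 0" "\<kappa> * d \<ge> K + 2"
  proof -
    have "(K + 2) / d * d \<le> \<kappa> * d" using d by (intro mult_right_mono) (auto simp: \<kappa>_def)
    then show "\<kappa> * d \<ge> K + 2" using d by simp
  qed (simp add: \<kappa>_def)
  define l where "l = \<bar>lmgf \<mu> (- \<kappa>)\<bar>"
  have "eventually (\<lambda>N0. moment \<mu> (- 1 / real N0) (ldim s N0) (ldim t N0) \<le> ennreal (exp (- (p - d)))) sequentially"
    unfolding p_def by (rule block_moment) (use assms d in auto)
  moreover have "eventually (\<lambda>N0. real N0 \<ge> 2 * l) sequentially"
    using filterlim_real_sequentially unfolding filterlim_at_top by blast
  ultimately have "eventually (\<lambda>N0. moment \<mu> (- 1 / real N0) (ldim s N0) (ldim t N0) \<le> ennreal (exp (- (p - d))) \<and>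
      real N0 \<ge> 2 * l \<and> N0 > 0 \<and> ldim t N0 \<ge> 1) sequentially"
    using eventually_gt_at_top[of 0] eventually_ldim_ge[OF st(2), of 1] by eventually_elim auto
  then obtain N0 where N0: "moment \<mu> (- 1 / real N0) (ldim s N0) (ldim t N0) \<le> ennreal (exp (- (p - d)))"
      "real N0 \<ge> 2 * l" "N0 > 0" "ldim t N0 \<ge> 1"
    using eventually_happens'[OF sequentially_bot] by blast
  define a where "a = ldim s N0"
  define b where "b = ldim t N0"
  have b1: "b \<ge> 1" using N0 by (simp add: b_def)
  have ab: "real a \<le> real N0 * s" "real a \<ge> real N0 * s - 1" "real b \<le> real N0 * t" "real b \<ge> real N0 * t - 1"
    unfolding a_def b_def using ldim_bounds[of s N0] ldim_bounds[of t N0] st by auto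
  \<comment> \<open>A lane of about N/N0 blocks is deficient with probability of order exp(-dN/N0)
    at most; L lanes together reach the rate K + 1.\<close>
  obtain L :: nat where L: "real L * d \<ge> (K + 1) * real N0"
  proof -
    obtain L where "(K + 1) * real N0 / d \<le> real L" using real_arch_simple by blast
    then show ?thesis using d by (intro that[of L]) (simp add: field_simps)
  qed
  \<comment> \<open>Each lane gives up C0 blocks, so that all lanes, whose starting points spread
    over L(2a + 1) columns, fit into the rectangle.\<close>
  obtain C0 :: nat where C0: "real C0 * (real N0 * s) \<ge> real (L * (2 * a + 1))"
  proof -
    obtain C0 where "real (L * (2 * a + 1)) / (real N0 * s) \<le> real C0" using real_arch_simple by blast
    then show ?thesis using N0 st by (intro that[of C0]) (simp add: field_simps)
  qed
  define Ca where "Ca = (s + t) * (real N0 + real C0 * real N0)"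
  define Cb where "Cb = real (L * (C0 + 1)) * d"
  define Cc where "Cc = (real N0 + real C0 * real N0) * \<bar>p - 2 * d\<bar>"
  have "((\<lambda>N. (real L * exp (Ca * l) + exp Cb) * exp (- real N)) \<longlonglongrightarrow> 0)" by real_asymp
  then have ev1: "eventually (\<lambda>N. (real L * exp (Ca * l) + exp Cb) * exp (- real N) < 1) sequentially"
    by (rule order_tendstoD) simp
  have ev2: "eventually (\<lambda>N. real N * d \<ge> Cc) sequentially"
  proof -
    have "filterlim (\<lambda>N. real N * d) at_top sequentially" using d by real_asymp
    then show ?thesis unfolding filterlim_at_top by blast
  qed
  show ?thesis
    using ev1 ev2 eventually_ge_at_top[of "(C0 + 1) * N0"]
  proof eventually_elim
    case (elim N)
    define k where "k = N div N0 - C0"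
    have "C0 + 1 \<le> N div N0" using elim(3) N0(3) by (metis div_le_mono nonzero_mult_div_cancel_right less_not_refl)
    then have k: "k \<ge> 1" "real k = real (N div N0) - real C0" by (auto simp: k_def)
    have div: "real (N div N0) * real N0 \<le> real N" "real N \<le> real (N div N0) * real N0 + real N0"
    proof -
      have "N div N0 * N0 \<le> N" by simp
      then show "real (N div N0) * real N0 \<le> real N" by (simp flip: of_nat_mult)
      have "N \<le> N div N0 * N0 + N0" using mod_less_divisor[OF N0(3), of N] div_mult_mod_eq[of N N0] by linarith
      then show "real N \<le> real (N div N0) * real N0 + real N0" by (simp flip: of_nat_mult of_nat_add)
    qed
    have kN: "real k * real N0 \<le> real N - real C0 * real N0" "real N \<le> real k * real N0 + (real N0 + real C0 * real N0)"
      using div unfolding k(2) by (auto simp: algebra_simps)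
    have kN': "real k * real N0 \<le> real N"
    proof -
      have "0 \<le> real C0 * real N0" by simp
      then show ?thesis using kN(1) by linarith
    qed
    have kdiv: "real k \<le> real N / real N0" using kN' N0(3) by (simp add: field_simps)
    have ka: "real k * real a \<le> real k * (real N0 * s)" "real k * real b \<le> real k * (real N0 * t)"
      "real k * real a \<ge> real k * (real N0 * s - 1)" "real k * real b \<ge> real k * (real N0 * t - 1)"
      using ab by (auto intro!: mult_left_mono)
    have fit1: "L * (2 * a + 1) + k * a \<le> ldim s N"
    proof -
      have "real k * (real N0 * s) \<le> (real N - real C0 * real N0) * s"
        using kN(1) st by (simp only: mult.assoc[symmetric]) (intro mult_right_mono, auto)
      then have "real (L * (2 * a + 1) + k * a) \<le> real N * s"
        using C0 ka(1) by (simp add: algebra_simps)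
      then show ?thesis unfolding ldim_def by (metis le_nat_floor)
    qed
    have fit2: "k * b \<le> ldim t N"
    proof -
      have "real k * (real N0 * t) \<le> real N * t"
        using kN' st by (simp only: mult.assoc[symmetric]) (intro mult_right_mono, auto)
      then have "real (k * b) \<le> real N * t" using ka(2) by simp
      then show ?thesis unfolding ldim_def by (metis le_nat_floor)
    qed
    have fit: "x * (2 * a + 1) + k * a \<le> ldim s N" if "x < L" for x
    proof -
      have "x * (2 * a + 1) \<le> L * (2 * a + 1)" using that by (intro mult_right_mono) auto
      then show ?thesis using fit1 by linarith
    qed
    define r where "r = ldim s N - k * a + (ldim t N - k * b)"
    have r: "real r \<le> Ca + 2 * (real N / real N0)"
    proof -
      have "real r = real (ldim s N) - real k * real a + (real (ldim t N) - real k * real b)"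
        using fit1 fit2 by (simp add: r_def of_nat_diff)
      also have "\<dots> \<le> real N * s - real k * (real N0 * s - 1) + (real N * t - real k * (real N0 * t - 1))"
        using ldim_bounds(1)[of s N] ldim_bounds(1)[of t N] st ka by linarith
      also have "\<dots> = (s + t) * (real N - real k * real N0) + 2 * real k" by (simp add: algebra_simps)
      also have "\<dots> \<le> Ca + 2 * (real N / real N0)"
        unfolding Ca_def using kN(2) kdiv st by (intro add_mono mult_left_mono) auto
      finally show ?thesis .
    qed
    \<comment> \<open>The level of a deficient lane is p - 2d per unit of length covered by its
      blocks, one d below the exponent supplied by the block mean.\<close>
    define T where "T = real k * (real N0 * (p - 2 * d))"
    have TC: "real N * (p - 2 * d) - Cc \<le> T"
    proof -
      have "\<bar>(real N - real k * real N0) * (p - 2 * d)\<bar> \<le> Cc"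
        unfolding Cc_def abs_mult using kN kN' by (intro mult_right_mono) auto
      then show ?thesis unfolding T_def by (simp add: algebra_simps abs_le_iff)
    qed
    have "real N * (p - \<delta>) \<le> T - real N * d"
      using TC elim(2) by (simp add: d_def algebra_simps)
    then have "emeasure (env (\<lambda>_. \<mu>)) {w. Zrec w (ldim s N) (ldim t N) \<le> exp (real N * (p - \<delta>))} \<le>
       emeasure (env (\<lambda>_. \<mu>)) {w. Zrec w (ldim s N) (ldim t N) \<le> exp (T - real N * d)}"
    proof (intro emeasure_mono subsetI CollectI)
      have "{w \<in> space (env (\<lambda>_. \<mu>)). Zrec w (ldim s N) (ldim t N) \<le> exp (T - real N * d)} \<in> sets (env (\<lambda>_. \<mu>))" by measurable
      then show "{w. Zrec w (ldim s N) (ldim t N) \<le> exp (T - real N * d)} \<in> sets (env (\<lambda>_. \<mu>))" by simp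
    qed (auto elim!: order_trans)
    also have "\<dots> \<le> of_nat L * ennreal (exp (- \<kappa> * (real N * d) + real r * l)) +
      (ennreal (exp (1 / real N0 * T)) * moment \<mu> (- (1 / real N0)) a b ^ k) ^ L"
      unfolding r_def l_def by (rule left_tail_ineq) (use \<mu> b1 k \<kappa> fit fit2 in auto)
    also have "\<dots> \<le> of_nat L * ennreal (exp (- (K + 1) * real N + Ca * l)) + ennreal (exp (- (K + 1) * real N + Cb))"
    proof (intro add_mono mult_left_mono ennreal_leI)
      have "real r * l \<le> (Ca + 2 * (real N / real N0)) * l"
        using r by (intro mult_right_mono) (auto simp: l_def)
      also have "\<dots> = Ca * l + (2 * l / real N0) * real N" by (simp add: algebra_simps)
      also have "(2 * l / real N0) * real N \<le> 1 * real N"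
        using N0 by (intro mult_right_mono) (auto simp: field_simps)
      finally have "real r * l \<le> Ca * l + real N" by simp
      moreover have "(K + 2) * real N \<le> \<kappa> * d * real N" using \<kappa> by (intro mult_right_mono) auto
      ultimately show "exp (- \<kappa> * (real N * d) + real r * l) \<le> exp (- (K + 1) * real N + Ca * l)"
        by (simp add: algebra_simps)
      have "moment \<mu> (- (1 / real N0)) a b \<le> ennreal (exp (- (p - d)))" using N0(1) by (simp add: a_def b_def)
      then have "(ennreal (exp (1 / real N0 * T)) * moment \<mu> (- (1 / real N0)) a b ^ k) ^ L \<le>
         (ennreal (exp (1 / real N0 * T)) * ennreal (exp (- (p - d))) ^ k) ^ L"
        by (intro power_mono mult_left_mono) auto
      also have "\<dots> = ennreal (exp (real L * (1 / real N0 * T + real k * - (p - d))))"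
        by (simp add: ennreal_power ennreal_mult'[symmetric] exp_of_nat_mult[symmetric] exp_add[symmetric])
      also have "1 / real N0 * T + real k * - (p - d) = - (real k * d)"
        using N0(3) by (simp add: T_def algebra_simps)
      also have "ennreal (exp (real L * - (real k * d))) \<le> ennreal (exp (- (K + 1) * real N + Cb))"
      proof (rule ennreal_leI)
        have "real N \<le> real N0 * (real k + (1 + real C0))" using kN(2) by (simp add: algebra_simps)
        moreover have "(K + 1) * real N \<le> real L * d * (real k + (1 + real C0))"
        proof (cases "K + 1 \<ge> 0")
          case True
          have "(K + 1) * real N \<le> (K + 1) * (real N0 * (real k + (1 + real C0)))"
            using calculation True by (intro mult_left_mono) auto
          also have "\<dots> = ((K + 1) * real N0) * (real k + (1 + real C0))" by (simp add: algebra_simps)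
          also have "\<dots> \<le> real L * d * (real k + (1 + real C0))" using L by (intro mult_right_mono) auto
          finally show ?thesis .
        next
          case False
          then have "(K + 1) * real N \<le> 0" by (simp add: mult_nonpos_nonneg)
          also have "0 \<le> real L * d * (real k + (1 + real C0))" using d by simp
          finally show ?thesis .
        qed
        ultimately show "exp (real L * - (real k * d)) \<le> exp (- (K + 1) * real N + Cb)"
          by (simp add: Cb_def algebra_simps)
      qed
      finally show "(ennreal (exp (1 / real N0 * T)) * moment \<mu> (- (1 / real N0)) a b ^ k) ^ L \<le> ennreal (exp (- (K + 1) * real N + Cb))" .
    qed auto
    also have "\<dots> = ennreal (exp (- K * real N) * ((real L * exp (Ca * l) + exp Cb) * exp (- real N)))"
    proof -
      have e: "exp (- (K + 1) * real N + x) = exp (- K * real N) * (exp x * exp (- real N))" for x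
        by (simp add: exp_add[symmetric] algebra_simps)
      show ?thesis
        unfolding e ennreal_of_nat_eq_real_of_nat
        by (simp add: ennreal_mult'[symmetric] ennreal_plus[symmetric] algebra_simps del: ennreal_plus)
    qed
    also have "\<dots> \<le> ennreal (exp (- K * real N) * 1)"
      using elim(1) by (intro ennreal_leI mult_left_mono) auto
    finally show ?case by (simp add: p_def)
  qed
qed

section \<open>The rate function\<close>

text \<open>The recurrence of the trigamma function exposes its double pole at 0.\<close>

lemma Polygamma_1_ge: "x > 0 \<Longrightarrow> Polygamma 1 (x::real) \<ge> 1 / x ^ 2"
proof -
  assume x: "x > 0"
  have "Polygamma 1 (x + 1) = Polygamma 1 x - 1 / x ^ 2"
    using Polygamma_plus1[of x 1] x by (simp add: power2_eq_square)
  then show ?thesis using Polygamma_1_pos[of "x + 1"] x by linarith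
qed

lemma Polygamma_1_antimono: "0 < x \<Longrightarrow> x \<le> y \<Longrightarrow> Polygamma 1 (y::real) \<le> Polygamma 1 x"
  using Polygamma_real_strict_antimono[of x y 1] by (cases "x = y") auto

definition phi' :: "real \<Rightarrow> real \<Rightarrow> real \<Rightarrow> real \<Rightarrow> real" where
  "phi' \<mu> s t z = - t * Polygamma 1 z + s * Polygamma 1 (\<mu> - z)"

lemma phi'_mono:
  assumes "s > 0" "t > 0" "0 < x" "x \<le> y" "y < \<mu>"
  shows "phi' \<mu> s t x \<le> phi' \<mu> s t y"
proof -
  have "t * Polygamma 1 y \<le> t * Polygamma 1 x"
    using assms by (intro mult_left_mono Polygamma_1_antimono) auto
  moreover have "s * Polygamma 1 (\<mu> - x) \<le> s * Polygamma 1 (\<mu> - y)"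
    using assms by (intro mult_left_mono Polygamma_1_antimono) auto
  ultimately show ?thesis unfolding phi'_def by linarith
qed

lemma phi'_negative:
  assumes "\<mu> > 0" "s > 0" "t > 0"
  shows "\<exists>x. 0 < x \<and> x \<le> \<mu> / 2 \<and> phi' \<mu> s t x < 0"
proof -
  define c where "c = s * Polygamma 1 (\<mu> / 2)"
  have "filterlim (\<lambda>x::real. t / x ^ 2) at_top (at_right 0)" using assms by real_asymp
  then have "eventually (\<lambda>x. c < t / x ^ 2) (at_right 0)" by (simp add: filterlim_at_top_dense)
  moreover have "eventually (\<lambda>x. x < \<mu> / 2) (at_right 0)"
    using assms by (intro order_tendstoD[OF tendsto_ident_at]) auto
  ultimately have "eventually (\<lambda>x. c < t / x ^ 2 \<and> x < \<mu> / 2 \<and> x > 0) (at_right 0)"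
    by (intro eventually_conj eventually_at_right_less)
  then obtain x where x: "c < t / x ^ 2" "x < \<mu> / 2" "x > 0"
    using eventually_happens'[OF trivial_limit_at_right_real] by blast
  have "t / x ^ 2 \<le> t * Polygamma 1 x" using mult_left_mono[OF Polygamma_1_ge[OF x(3)], of t] assms by simp
  moreover have "s * Polygamma 1 (\<mu> - x) \<le> c"
    unfolding c_def using x assms by (intro mult_left_mono Polygamma_1_antimono) auto
  ultimately have "phi' \<mu> s t x < 0" using x(1) unfolding phi'_def by linarith
  then show ?thesis using x by (intro exI[of _ x]) auto
qed

text \<open>Exchanging the axes reflects z in \<mu>/2, so each one-sided statement about
  \<open>phi\<close> is proved only once.\<close>

lemma phi'_swap: "phi' \<mu> s t (\<mu> - z) = - phi' \<mu> t s z"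
  by (simp add: phi'_def)

lemma phi_swap: "phi \<mu> s t (\<mu> - z) = phi \<mu> t s z"
  by (simp add: phi_def)

lemma phi_critical_exists:
  assumes "\<mu> > 0" "s > 0" "t > 0"
  shows "\<exists>z. 0 < z \<and> z < \<mu> \<and> phi' \<mu> s t z = 0"
proof -
  obtain x where x: "0 < x" "x \<le> \<mu> / 2" "phi' \<mu> s t x < 0" using phi'_negative[OF assms] by auto
  obtain y where y: "0 < y" "y \<le> \<mu> / 2" "phi' \<mu> t s y < 0" using phi'_negative[of \<mu> t s] assms by auto
  have "continuous_on {x..\<mu> - y} (phi' \<mu> s t)"
    unfolding phi'_def [abs_def] using x y
    by (intro continuous_at_imp_continuous_on ballI continuous_intros) (auto elim!: nonpos_Ints_cases)
  moreover have "phi' \<mu> s t (\<mu> - y) > 0" using y by (simp add: phi'_swap)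
  ultimately obtain z where "x \<le> z" "z \<le> \<mu> - y" "phi' \<mu> s t z = 0"
    using IVT'[of "phi' \<mu> s t" x 0 "\<mu> - y"] x y by fastforce
  then show ?thesis using x y by (intro exI[of _ z]) auto
qed

lemma DERIV_phi':
  assumes "0 < z" "z < \<mu>"
  shows "(phi \<mu> s t has_real_derivative phi' \<mu> s t z) (at z)"
  unfolding phi'_def by (rule DERIV_phi[OF assms])

lemma phi_mono_right:
  assumes st: "s > 0" "t > 0" and z0: "0 < z0" "phi' \<mu> s t z0 = 0" and xy: "z0 \<le> x" "x \<le> y" "y < \<mu>"
  shows "phi \<mu> s t x \<le> phi \<mu> s t y"
proof (rule DERIV_nonneg_imp_nondecreasing[OF xy(2)])
  fix u assume u: "x \<le> u" "u \<le> y"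
  then have "phi' \<mu> s t z0 \<le> phi' \<mu> s t u" using assms by (intro phi'_mono) auto
  then show "\<exists>d. (phi \<mu> s t has_real_derivative d) (at u) \<and> 0 \<le> d"
    using DERIV_phi'[of u \<mu> s t] u assms by (intro exI[of _ "phi' \<mu> s t u"]) auto
qed

lemma phi_mono_left:
  assumes "s > 0" "t > 0" "z0 < \<mu>" "phi' \<mu> s t z0 = 0" "0 < x" "x \<le> y" "y \<le> z0"
  shows "phi \<mu> s t y \<le> phi \<mu> s t x"
  using phi_mono_right[of t s "\<mu> - z0" \<mu> "\<mu> - y" "\<mu> - x"] assms by (simp add: phi_swap phi'_swap)

lemma phi_ge_critical:
  assumes "s > 0" "t > 0" "0 < z0" "z0 < \<mu>" "phi' \<mu> s t z0 = 0" "0 < x" "x < \<mu>"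
  shows "phi \<mu> s t z0 \<le> phi \<mu> s t x"
  using phi_mono_left[of s t z0 \<mu> x z0] phi_mono_right[of s t z0 \<mu> z0 x] assms by (cases "x \<le> z0") auto

text \<open>The recurrence of the digamma function exposes its pole at 0, which drives
  \<open>phi\<close> to infinity there; the other digamma term stays bounded.\<close>

lemma phi_large:
  assumes "\<mu> > 0" "s > 0" "t > 0" "0 < z0"
  shows "\<exists>x. 0 < x \<and> x < z0 \<and> x < \<mu> \<and> r \<le> phi \<mu> s t x"
proof -
  define c where "c = r + t * Digamma (\<mu> + 1) + s * Digamma \<mu>"
  have "filterlim (\<lambda>x::real. t / x) at_top (at_right 0)" using assms by real_asymp
  then have "eventually (\<lambda>x. c < t / x) (at_right 0)" by (simp add: filterlim_at_top_dense)
  moreover have "eventually (\<lambda>x. x < min z0 \<mu>) (at_right 0)"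
    using assms by (intro order_tendstoD[OF tendsto_ident_at]) auto
  ultimately have "eventually (\<lambda>x. c < t / x \<and> x < min z0 \<mu> \<and> x > 0) (at_right 0)"
    by (intro eventually_conj eventually_at_right_less)
  then obtain x where x: "c < t / x" "x < z0" "x < \<mu>" "x > 0"
    using eventually_happens'[OF trivial_limit_at_right_real] by fastforce
  have "Digamma x = Digamma (x + 1) - 1 / x" using Digamma_plus1[of x] x by simp
  also have "\<dots> \<le> Digamma (\<mu> + 1) - 1 / x" using x by (intro diff_right_mono Digamma_real_mono) auto
  finally have "t * Digamma x \<le> t * (Digamma (\<mu> + 1) - 1 / x)" using assms by (intro mult_left_mono) auto
  moreover have "s * Digamma (\<mu> - x) \<le> s * Digamma \<mu>"
    using x assms by (intro mult_left_mono Digamma_real_mono) auto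
  ultimately have "r \<le> phi \<mu> s t x" using x(1) unfolding phi_def c_def by (simp add: algebra_simps)
  then show ?thesis using x by auto
qed

lemma phi_continuous: "0 < a \<Longrightarrow> b < \<mu> \<Longrightarrow> continuous_on {a..b} (phi \<mu> s t)"
  by (intro continuous_at_imp_continuous_on ballI DERIV_isCont[OF DERIV_phi']) auto

lemma phi_level_left:
  assumes "s > 0" "t > 0" "0 < z0" "z0 < \<mu>" "phi \<mu> s t z0 < r"
  shows "\<exists>x. 0 < x \<and> x < z0 \<and> phi \<mu> s t x = r"
proof -
  obtain x where x: "0 < x" "x < z0" "r \<le> phi \<mu> s t x" using phi_large[of \<mu> s t z0 r] assms by auto
  obtain y where "x \<le> y" "y \<le> z0" "phi \<mu> s t y = r"
    using IVT2'[of "phi \<mu> s t" z0 r x] x assms phi_continuous[of x z0 \<mu> s t] by auto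
  then show ?thesis using x assms by (intro exI[of _ y]) (auto simp: less_le)
qed

lemma phi_level_right:
  assumes "s > 0" "t > 0" "0 < z0" "z0 < \<mu>" "phi \<mu> s t z0 < r"
  shows "\<exists>x. z0 < x \<and> x < \<mu> \<and> phi \<mu> s t x = r"
proof -
  obtain x where "0 < x" "x < \<mu> - z0" "phi \<mu> t s x = r"
    using phi_level_left[of t s "\<mu> - z0" \<mu> r] assms by (auto simp: phi_swap)
  then show ?thesis by (intro exI[of _ "\<mu> - x"]) (auto simp: phi_swap)
qed

definition hfun :: "real \<Rightarrow> real \<Rightarrow> real \<Rightarrow> real \<Rightarrow> real" where
  "hfun \<mu> s t x = t * ln_Gamma x - s * ln_Gamma (\<mu> - x)"

lemma gfun_eq: "gfun \<mu> s t \<xi> z = hfun \<mu> s t (z - \<xi>) - hfun \<mu> s t z"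
  by (simp add: gfun_def hfun_def lmgf_def algebra_simps)

lemma DERIV_hfun:
  assumes "0 < x" "x < \<mu>"
  shows "(hfun \<mu> s t has_real_derivative - phi \<mu> s t x) (at x)"
  unfolding hfun_def [abs_def] phi_def using assms by (auto intro!: derivative_eq_intros)

lemma DERIV_gfun:
  assumes "0 < z - \<xi>" "z - \<xi> < \<mu>"
  shows "((\<lambda>\<xi>. gfun \<mu> s t \<xi> z) has_real_derivative phi \<mu> s t (z - \<xi>)) (at \<xi>)"
  unfolding gfun_eq using assms
  by (auto intro!: derivative_eq_intros DERIV_chain2[OF DERIV_hfun])

lemma gfun_0 [simp]: "gfun \<mu> s t 0 z = 0"
  by (simp add: gfun_eq)

section \<open>The variational problem at a minimum of \<open>phi\<close>\<close>

locale critical =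
  fixes \<mu> s t z0 :: real
  assumes st: "s > 0" "t > 0" and z0: "0 < z0" "z0 < \<mu>" and crit: "phi' \<mu> s t z0 = 0"
begin

lemma mu_pos: "\<mu> > 0" using z0 by simp

definition p where "p = phi \<mu> s t z0"

lemma p_le: "0 < x \<Longrightarrow> x < \<mu> \<Longrightarrow> p \<le> phi \<mu> s t x"
  unfolding p_def using phi_ge_critical st z0 crit by auto

lemma tilted_mono:
  assumes "0 < x" "x \<le> z" "z < \<mu>" "\<And>u. x \<le> u \<Longrightarrow> u \<le> z \<Longrightarrow> phi \<mu> s t u \<le> r"
  shows "hfun \<mu> s t x + r * x \<le> hfun \<mu> s t z + r * z"
proof (rule DERIV_nonneg_imp_nondecreasing[OF assms(2)])
  fix u assume u: "x \<le> u" "u \<le> z"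
  have "((\<lambda>u. hfun \<mu> s t u + r * u) has_real_derivative - phi \<mu> s t u + r) (at u)"
    using u assms by (auto intro!: derivative_eq_intros DERIV_hfun)
  then show "\<exists>d. ((\<lambda>u. hfun \<mu> s t u + r * u) has_real_derivative d) (at u) \<and> 0 \<le> d"
    using assms(4)[OF u] by (intro exI[of _ "- phi \<mu> s t u + r"]) auto
qed

lemma tilted_antimono:
  assumes "0 < x" "x \<le> z" "z < \<mu>" "\<And>u. x \<le> u \<Longrightarrow> u \<le> z \<Longrightarrow> r \<le> phi \<mu> s t u"
  shows "hfun \<mu> s t z + r * z \<le> hfun \<mu> s t x + r * x"
proof (rule DERIV_nonpos_imp_nonincreasing[OF assms(2)])
  fix u assume u: "x \<le> u" "u \<le> z"
  have "((\<lambda>u. hfun \<mu> s t u + r * u) has_real_derivative - phi \<mu> s t u + r) (at u)"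
    using u assms by (auto intro!: derivative_eq_intros DERIV_hfun)
  then show "\<exists>d. ((\<lambda>u. hfun \<mu> s t u + r * u) has_real_derivative d) (at u) \<and> d \<le> 0"
    using assms(4)[OF u] by (intro exI[of _ "- phi \<mu> s t u + r"]) auto
qed

text \<open>The objective is the increment of \<open>hfun x + r x\<close> from \<open>z - \<xi>\<close> to \<open>z\<close>, and this function
  increases exactly between the two level points of \<open>phi\<close>.\<close>

lemma maximizer:
  assumes r: "p < r"
  obtains x1 x2 where "0 < x1" "x1 < x2" "x2 < \<mu>" "phi \<mu> s t x1 = r" "phi \<mu> s t x2 = r"
    "\<And>\<xi> z. 0 \<le> \<xi> \<Longrightarrow> \<xi> < z \<Longrightarrow> z < \<mu> \<Longrightarrow> r * \<xi> - gfun \<mu> s t \<xi> z \<le> r * (x2 - x1) - gfun \<mu> s t (x2 - x1) x2"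
proof -
  obtain x1 where x1: "0 < x1" "x1 < z0" "phi \<mu> s t x1 = r"
    using phi_level_left[OF st z0] r unfolding p_def by auto
  obtain x2 where x2: "z0 < x2" "x2 < \<mu>" "phi \<mu> s t x2 = r"
    using phi_level_right[OF st z0] r unfolding p_def by auto
  have low: "r \<le> phi \<mu> s t u" if "0 < u" "u \<le> x1" for u
    using phi_mono_left[OF st z0(2) crit that(1) that(2)] x1 by simp
  have high: "r \<le> phi \<mu> s t u" if "x2 \<le> u" "u < \<mu>" for u
    using phi_mono_right[OF st z0(1) crit _ that] x2 by simp
  have mid: "phi \<mu> s t u \<le> r" if "x1 \<le> u" "u \<le> x2" for u
    using phi_mono_left[OF st z0(2) crit x1(1) that(1)] phi_mono_right[OF st z0(1) crit _ that(2) x2(2)] x1 x2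
    by (cases "u \<le> z0") auto
  let ?k = "\<lambda>u. hfun \<mu> s t u + r * u"
  have k12: "?k x1 \<le> ?k x2" using x1 x2 mid by (intro tilted_mono) auto
  have max: "?k z - ?k x \<le> ?k x2 - ?k x1" if xz: "0 < x" "x \<le> z" "z < \<mu>" for x z
  proof -
    \<comment> \<open>If [x, z] misses the level interval, the increment is nonpositive. Otherwise
      moving x to x1 and z to x2 never lowers it.\<close>
    consider "z < x1" | "x2 < x" | "x1 \<le> z" "x \<le> x2" by linarith
    then show ?thesis
    proof cases
      case 1
      have "?k z \<le> ?k x" using xz 1 low by (intro tilted_antimono) auto
      then show ?thesis using k12 by linarith
    next
      case 2
      have "?k z \<le> ?k x" using xz 2 high by (intro tilted_antimono) auto
      then show ?thesis using k12 by linarith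
    next
      case 3
      have "?k z \<le> ?k x2"
      proof (cases "z \<le> x2")
        case True
        then show ?thesis using 3 x1 x2 mid by (intro tilted_mono) auto
      next
        case False
        then show ?thesis using xz x1 x2 high by (intro tilted_antimono) auto
      qed
      moreover have "?k x1 \<le> ?k x"
      proof (cases "x1 \<le> x")
        case True
        then show ?thesis using 3 x1 x2 mid by (intro tilted_mono) auto
      next
        case False
        then show ?thesis using xz x1 x2 low by (intro tilted_antimono) auto
      qed
      ultimately show ?thesis by linarith
    qed
  qed
  show ?thesis
  proof (rule that[of x1 x2])
    fix \<xi> z assume "0 \<le> \<xi>" "\<xi> < z" "z < \<mu>"
    then show "r * \<xi> - gfun \<mu> s t \<xi> z \<le> r * (x2 - x1) - gfun \<mu> s t (x2 - x1) x2"
      using max[of "z - \<xi>" z] by (simp add: gfun_eq algebra_simps)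
  qed (use x1 x2 in auto)
qed

text \<open>\<open>phi\<close> never falls below p, so \<open>hfun\<close> plus p times the identity
  is decreasing, and its increment from z - \<xi> to z is nonpositive.\<close>

lemma gfun_ge:
  assumes "0 \<le> \<xi>" "\<xi> < z" "z < \<mu>"
  shows "p * \<xi> \<le> gfun \<mu> s t \<xi> z"
  using tilted_antimono[of "z - \<xi>" z p] p_le assms by (simp add: gfun_eq algebra_simps)

text \<open>Subtracting an infimum gives one supremum over pairs. It is finite for every real r,
  also below p, where it is 0 and differs from the rate. On the whole line it is convex on an open
  set, which yields continuity at p as well.\<close>

definition I where "I r = (SUP (\<xi>, z)\<in>{(\<xi>, z). 0 \<le> \<xi> \<and> \<xi> < z \<and> z < \<mu>}. r * \<xi> - gfun \<mu> s t \<xi> z)"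

lemma I_bound:
  assumes "0 \<le> \<xi>" "\<xi> < z" "z < \<mu>"
  shows "r * \<xi> - gfun \<mu> s t \<xi> z \<le> \<bar>r - p\<bar> * \<mu>"
proof -
  have "r * \<xi> - gfun \<mu> s t \<xi> z \<le> (r - p) * \<xi>" using gfun_ge[OF assms] by (simp add: algebra_simps)
  also have "\<dots> \<le> \<bar>r - p\<bar> * \<xi>" using assms by (intro mult_right_mono) auto
  also have "\<dots> \<le> \<bar>r - p\<bar> * \<mu>" using assms by (intro mult_left_mono) auto
  finally show ?thesis .
qed

lemma I_upper:
  assumes "0 \<le> \<xi>" "\<xi> < z" "z < \<mu>"
  shows "r * \<xi> - gfun \<mu> s t \<xi> z \<le> I r"
proof -
  have "bdd_above ((\<lambda>(\<xi>, z). r * \<xi> - gfun \<mu> s t \<xi> z) ` {(\<xi>, z). 0 \<le> \<xi> \<and> \<xi> < z \<and> z < \<mu>})"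
    by (rule bdd_aboveI[of _ "\<bar>r - p\<bar> * \<mu>"]) (auto intro: I_bound)
  from cSUP_upper[OF _ this, of "(\<xi>, z)"] show ?thesis using assms unfolding I_def by auto
qed

lemma I_least:
  assumes "\<And>\<xi> z. 0 \<le> \<xi> \<Longrightarrow> \<xi> < z \<Longrightarrow> z < \<mu> \<Longrightarrow> r * \<xi> - gfun \<mu> s t \<xi> z \<le> c"
  shows "I r \<le> c"
  unfolding I_def
proof (rule cSUP_least)
  have "(0, z0) \<in> {(\<xi>, z). 0 \<le> \<xi> \<and> \<xi> < z \<and> z < \<mu>}" using z0 by simp
  then show "{(\<xi>, z). 0 \<le> \<xi> \<and> \<xi> < z \<and> z < \<mu>} \<noteq> {}" by blast
qed (use assms in auto)

lemma I_nonneg: "I r \<ge> 0"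
  using I_upper[of 0 z0 r] z0 by simp

lemma I_p: "I p = 0"
proof (rule antisym[OF I_least I_nonneg])
  fix \<xi> z assume "0 \<le> \<xi>" "\<xi> < z" "z < \<mu>"
  then show "p * \<xi> - gfun \<mu> s t \<xi> z \<le> 0" using gfun_ge[of \<xi> z] by simp
qed

text \<open>At z = z0 the objective vanishes for \<xi> = 0 and has derivative r - p there.\<close>

lemma I_pos:
  assumes "p < r" shows "I r > 0"
proof -
  have "((\<lambda>\<xi>. r * \<xi> - gfun \<mu> s t \<xi> z0) has_real_derivative r - phi \<mu> s t (z0 - 0)) (at 0)"
    using z0 by (auto intro!: derivative_eq_intros DERIV_gfun)
  moreover have "0 < r - phi \<mu> s t (z0 - 0)" using assms by (simp add: p_def)
  ultimately obtain d where d: "d > 0" "\<And>h. 0 < h \<Longrightarrow> h < d \<Longrightarrow> r * 0 - gfun \<mu> s t 0 z0 < r * (0 + h) - gfun \<mu> s t (0 + h) z0"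
    using DERIV_pos_inc_right by blast
  define h where "h = min d z0 / 2"
  have "0 < h" "h < d" "h < z0" using d z0 unfolding h_def by (auto simp: min_def)
  then have "r * 0 - gfun \<mu> s t 0 z0 < r * (0 + h) - gfun \<mu> s t (0 + h) z0" by (intro d(2))
  moreover have "r * h - gfun \<mu> s t h z0 \<le> I r" using \<open>0 < h\<close> \<open>h < z0\<close> z0 by (intro I_upper) auto
  ultimately show ?thesis by (simp only: gfun_0 mult_zero_right diff_self add_0)
qed

lemma I_convex: "convex_on UNIV I"
proof (rule convex_onI)
  fix u x y :: real assume u: "0 < u" "u < 1"
  show "I ((1 - u) *\<^sub>R x + u *\<^sub>R y) \<le> (1 - u) * I x + u * I y"
  proof (rule I_least)
    fix \<xi> z assume *: "0 \<le> \<xi>" "\<xi> < z" "z < \<mu>"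
    have "(1 - u) * (x * \<xi> - gfun \<mu> s t \<xi> z) + u * (y * \<xi> - gfun \<mu> s t \<xi> z) \<le> (1 - u) * I x + u * I y"
      by (rule add_mono[OF mult_left_mono[OF I_upper[OF *]] mult_left_mono[OF I_upper[OF *]]]) (use u in simp_all)
    moreover have "((1 - u) *\<^sub>R x + u *\<^sub>R y) * \<xi> - gfun \<mu> s t \<xi> z =
        (1 - u) * (x * \<xi> - gfun \<mu> s t \<xi> z) + u * (y * \<xi> - gfun \<mu> s t \<xi> z)"
      by (simp add: algebra_simps)
    ultimately show "((1 - u) *\<^sub>R x + u *\<^sub>R y) * \<xi> - gfun \<mu> s t \<xi> z \<le> (1 - u) * I x + u * I y"
      by (simp only:)
  qed
qed auto

lemma I_continuous: "continuous_on UNIV I"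
  by (rule convex_on_continuous[OF open_UNIV I_convex])

text \<open>A convex function vanishing at p lies below its chords from p, and such a chord
  increases strictly when its far end is positive.\<close>

lemma I_strict_mono:
  assumes "p \<le> r" "r < r'"
  shows "I r < I r'"
proof (cases "p = r")
  case True
  then have "I r = 0" "p < r'" using I_p assms(2) by metis+
  then show ?thesis using I_pos[of r'] by metis
next
  case False
  define u where "u = (r - p) / (r' - p)"
  have u: "0 \<le> u" "u < 1" using assms False by (auto simp: u_def)
  have "u * (r' - p) = r - p" using assms by (simp add: u_def)
  then have "r = (1 - u) *\<^sub>R p + u *\<^sub>R r'" by (simp add: algebra_simps)
  then have "I r \<le> (1 - u) * I p + u * I r'"
    using convex_onD[OF I_convex, of u p r'] u by simp
  also have "\<dots> < I r'" using I_p I_pos[of r'] u assms by simp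
  finally show ?thesis .
qed

lemma rate_function_eq:
  assumes "p \<le> r"
  shows "rate_function \<mu> s t p r = ereal (I r)"
proof -
  have g: "ereal t * log_mgf z \<xi> - ereal s * log_mgf (\<mu> - z) (- \<xi>) = ereal (gfun \<mu> s t \<xi> z)"
    if "0 \<le> \<xi>" "\<xi> < z" "z < \<mu>" for \<xi> z
  proof -
    have "ln (Gamma x) = ln_Gamma x" if "x > 0" for x :: real
      using that by (simp add: Gamma_real_pos_exp)
    then show ?thesis using that by (simp add: log_mgf_def gfun_def lmgf_def algebra_simps)
  qed
  let ?F = "\<lambda>\<xi>. INF z\<in>{\<xi><..<\<mu>}. ereal t * log_mgf z \<xi> - ereal s * log_mgf (\<mu> - z) (- \<xi>)"
  have "(SUP \<xi>\<in>{0..<\<mu>}. ereal (r * \<xi>) - ?F \<xi>) = ereal (I r)"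
  proof (rule antisym)
    show "(SUP \<xi>\<in>{0..<\<mu>}. ereal (r * \<xi>) - ?F \<xi>) \<le> ereal (I r)"
    proof (rule SUP_least)
      fix \<xi> assume \<xi>: "\<xi> \<in> {0..<\<mu>}"
      have "ereal (r * \<xi> - I r) \<le> ?F \<xi>"
        using \<xi> I_upper[of \<xi> _ r] by (intro INF_greatest) (auto simp: g algebra_simps)
      then show "ereal (r * \<xi>) - ?F \<xi> \<le> ereal (I r)" by (cases "?F \<xi>") (auto simp: algebra_simps)
    qed
    let ?S = "SUP \<xi>\<in>{0..<\<mu>}. ereal (r * \<xi>) - ?F \<xi>"
    have S: "ereal (r * \<xi> - gfun \<mu> s t \<xi> z) \<le> ?S" if "0 \<le> \<xi>" "\<xi> < z" "z < \<mu>" for \<xi> z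
    proof -
      have "?F \<xi> \<le> ereal (gfun \<mu> s t \<xi> z)"
        using that by (intro INF_lower2[of z]) (auto simp: g)
      then have "ereal (r * \<xi>) - ereal (gfun \<mu> s t \<xi> z) \<le> ereal (r * \<xi>) - ?F \<xi>" by (intro ereal_minus_mono) auto
      also have "\<dots> \<le> ?S" using that by (intro SUP_upper) auto
      finally show ?thesis by simp
    qed
    show "ereal (I r) \<le> ?S"
    proof (cases ?S)
      case (real c)
      have "I r \<le> c" using S unfolding real by (intro I_least) auto
      then show ?thesis unfolding real by simp
    next
      case MInf
      then show ?thesis using S[of 0 z0] z0 by simp
    qed simp
  qed
  then show ?thesis using assms by (simp add: rate_function_def)
qed

end

section \<open>Tail bounds\<close>

lemma measurable_Zrec_Collect:
  assumes "A \<in> sets borel"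
  shows "{w. Zrec w m n \<in> A} \<in> sets (env c)"
proof -
  have "{w \<in> space (env c). Zrec w m n \<in> A} \<in> sets (env c)" using assms by measurable
  then show ?thesis by simp
qed

lemma moment_upper_asymptotic:
  assumes st: "s \<ge> 0" "t \<ge> 0" and z: "z < \<mu>" "0 \<le> \<xi>" "\<xi> < z"
  shows "\<exists>C. \<forall>N. moment \<mu> \<xi> (ldim s N) (ldim t N) \<le> ennreal (exp (C + real N * gfun \<mu> s t \<xi> z))"
proof -
  let ?A = "lmgf z \<xi>" and ?B = "lmgf (\<mu> - z + \<xi>) \<xi>"
  have "moment \<mu> \<xi> (ldim s N) (ldim t N) \<le> ennreal (exp (?B - lmgf \<mu> \<xi> + \<bar>?A\<bar> + \<bar>?B\<bar> + real N * gfun \<mu> s t \<xi> z))" for N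
  proof -
    have "real (ldim t N) * ?A + real (ldim s N) * ?B \<le> \<bar>?A\<bar> + \<bar>?B\<bar> + real N * gfun \<mu> s t \<xi> z"
      using ldim_mult_bound[OF st(1), of N ?B] ldim_mult_bound[OF st(2), of N ?A]
      by (simp add: gfun_def algebra_simps abs_le_iff)
    then have "exp (?B - lmgf \<mu> \<xi>) * exp (real (ldim t N) * ?A + real (ldim s N) * ?B) \<le>
        exp (?B - lmgf \<mu> \<xi> + \<bar>?A\<bar> + \<bar>?B\<bar> + real N * gfun \<mu> s t \<xi> z)"
      by (simp add: exp_add[symmetric])
    then show ?thesis
      using moment_upper_bound[OF z, of "ldim s N" "ldim t N"] by (meson ennreal_leI order_trans)
  qed
  then show ?thesis by blast
qed

section \<open>Tails of the homogeneous model on the exponential scale\<close>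

context critical
begin

abbreviation P where "P \<equiv> env (\<lambda>_::nat \<times> nat. \<mu>)"
abbreviation Z where "Z N w \<equiv> Zrec w (ldim s N) (ldim t N)"

lemma prob_space_P: "prob_space P"
  using mu_pos by (intro prob_space_env)

lemma right_tail_upper:
  assumes "0 \<le> \<xi>" "\<xi> < z" "z < \<mu>"
  shows "\<exists>C. \<forall>N. measure P {w. exp (real N * r) \<le> Z N w} \<le> exp (C + real N * (gfun \<mu> s t \<xi> z - r * \<xi>))"
proof -
  interpret prob_space P by (rule prob_space_P)
  obtain C where C: "\<And>N. moment \<mu> \<xi> (ldim s N) (ldim t N) \<le> ennreal (exp (C + real N * gfun \<mu> s t \<xi> z))"
    using moment_upper_asymptotic[of s t z \<mu> \<xi>] assms st by auto
  have "measure P {w. exp (real N * r) \<le> Z N w} \<le> exp (C + real N * (gfun \<mu> s t \<xi> z - r * \<xi>))" for N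
  proof -
    have meas: "{w. exp (real N * r) \<le> Z N w} \<in> sets P"
      using measurable_Zrec_Collect[of "{exp (real N * r)..}" "ldim s N" "ldim t N" "\<lambda>_. \<mu>"] by simp
    have "emeasure P {w. exp (real N * r) \<le> Z N w} \<le> (\<integral>\<^sup>+w. ennreal (exp (- \<xi> * (real N * r))) * ennreal (Z N w powr \<xi>) \<partial>P)"
      unfolding nn_integral_indicator[OF meas, symmetric]
    proof (rule nn_integral_mono)
      fix w
      show "indicator {w. exp (real N * r) \<le> Z N w} w \<le> ennreal (exp (- \<xi> * (real N * r))) * ennreal (Z N w powr \<xi>)"
      proof (cases "exp (real N * r) \<le> Z N w")
        case True
        have "1 = exp (- \<xi> * (real N * r)) * exp (real N * r) powr \<xi>" by (simp add: powr_exp_eq exp_minus)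
        also have "\<dots> \<le> exp (- \<xi> * (real N * r)) * Z N w powr \<xi>"
          using True assms by (intro mult_left_mono powr_mono2) auto
        finally show ?thesis using True by (simp add: ennreal_mult'[symmetric])
      qed simp
    qed
    also have "\<dots> = ennreal (exp (- \<xi> * (real N * r))) * moment \<mu> \<xi> (ldim s N) (ldim t N)"
      unfolding moment_def by (rule nn_integral_cmult) simp
    also have "\<dots> \<le> ennreal (exp (- \<xi> * (real N * r))) * ennreal (exp (C + real N * gfun \<mu> s t \<xi> z))"
      by (intro mult_left_mono C) auto
    also have "\<dots> = ennreal (exp (C + real N * (gfun \<mu> s t \<xi> z - r * \<xi>)))"
      by (simp add: ennreal_mult'[symmetric] exp_add[symmetric] algebra_simps)
    finally show ?thesis by (simp add: emeasure_eq_measure)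
  qed
  then show ?thesis by blast
qed

lemma right_tail_upper_rate:
  assumes \<eta>: "\<eta> > 0"
  shows "eventually (\<lambda>N. measure P {w. exp (real N * r) \<le> Z N w} \<le> exp (- real N * (I r - \<eta>))) sequentially"
proof -
  \<comment> \<open>The supremum is approached up to half of the margin; the other half absorbs the
    constant of the moment bound.\<close>
  obtain \<xi> z where xz: "0 \<le> \<xi>" "\<xi> < z" "z < \<mu>" "I r - \<eta> / 2 < r * \<xi> - gfun \<mu> s t \<xi> z"
  proof (rule ccontr)
    assume "\<not> thesis"
    then have "I r \<le> I r - \<eta> / 2" using that by (intro I_least) force
    then show False using \<eta> by simp
  qed
  obtain C where C: "\<And>N. measure P {w. exp (real N * r) \<le> Z N w} \<le> exp (C + real N * (gfun \<mu> s t \<xi> z - r * \<xi>))"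
    using right_tail_upper[OF xz(1-3)] by auto
  have "eventually (\<lambda>N. real N \<ge> 2 * C / \<eta>) sequentially"
    using filterlim_real_sequentially unfolding filterlim_at_top by blast
  then show ?thesis
  proof eventually_elim
    case (elim N)
    have "C \<le> real N * (\<eta> / 2)" using elim \<eta> by (simp add: field_simps)
    moreover have "real N * (gfun \<mu> s t \<xi> z - r * \<xi>) \<le> real N * (- (I r - \<eta> / 2))"
      using xz(4) by (intro mult_left_mono) auto
    ultimately have "C + real N * (gfun \<mu> s t \<xi> z - r * \<xi>) \<le> - real N * (I r - \<eta>)"
      by (simp add: algebra_simps)
    then show ?case using C[of N] by (meson exp_le_cancel_iff order_trans)
  qed
qed

text \<open>Under the tilt by \<open>Z powr \<xi>\<close> the free energy concentrates at \<open>r\<close>: neighbouring powers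
  bound the contribution of both tails.\<close>

lemma local_lower_aux:
  assumes r: "p < r" and \<delta>: "\<delta> > 0"
  shows "\<exists>\<xi>\<ge>0. \<xi> \<le> \<mu> \<and> (\<forall>\<eta>>0. eventually (\<lambda>N. exp (- real N * (I r + \<eta> + \<xi> * \<delta>)) \<le>
     measure P {w. exp (real N * (r - \<delta>)) < Z N w \<and> Z N w < exp (real N * (r + \<delta>))}) sequentially)"
proof -
  interpret prob_space P by (rule prob_space_P)
  obtain x1 x2 where x: "0 < x1" "x1 < x2" "x2 < \<mu>" "phi \<mu> s t x1 = r" "phi \<mu> s t x2 = r"
    and max: "\<And>\<xi> z. 0 \<le> \<xi> \<Longrightarrow> \<xi> < z \<Longrightarrow> z < \<mu> \<Longrightarrow> r * \<xi> - gfun \<mu> s t \<xi> z \<le> r * (x2 - x1) - gfun \<mu> s t (x2 - x1) x2"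
    using maximizer[OF r] by metis
  define \<xi> where "\<xi> = x2 - x1"
  define g0 where "g0 = gfun \<mu> s t \<xi> x2"
  have \<xi>: "0 < \<xi>" "\<xi> < x2" "\<xi> \<le> \<mu>" using x by (auto simp: \<xi>_def)
  have I: "I r = r * \<xi> - g0"
    unfolding g0_def \<xi>_def using x by (intro antisym I_least max I_upper) auto
  \<comment> \<open>At the maximising pair the derivative in \<xi> is \<open>phi\<close> at x1,
    hence r. A step h in the power changes the exponent by about rh, which against r + \<delta>
    above or r - \<delta> below gains about \<delta>h.\<close>
  have dg: "((\<lambda>\<xi>. gfun \<mu> s t \<xi> x2) has_real_derivative r) (at \<xi>)"
    using DERIV_gfun[of x2 \<xi> \<mu> s t] x by (simp add: \<xi>_def)
  have d1: "((\<lambda>y. gfun \<mu> s t y x2 - (y - \<xi>) * (r + \<delta>)) has_real_derivative - \<delta>) (at \<xi>)"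
    by (rule derivative_eq_intros dg refl | simp)+
  have d2: "((\<lambda>y. gfun \<mu> s t y x2 - (y - \<xi>) * (r - \<delta>)) has_real_derivative \<delta>) (at \<xi>)"
    by (rule derivative_eq_intros dg refl | simp)+
  obtain e1 where e1: "e1 > 0" "\<And>h. 0 < h \<Longrightarrow> h < e1 \<Longrightarrow> gfun \<mu> s t (\<xi> + h) x2 - h * (r + \<delta>) < g0"
    using DERIV_neg_dec_right[OF d1] \<delta> by (auto simp: g0_def)
  obtain e2 where e2: "e2 > 0" "\<And>h. 0 < h \<Longrightarrow> h < e2 \<Longrightarrow> gfun \<mu> s t (\<xi> - h) x2 + h * (r - \<delta>) < g0"
    using DERIV_pos_inc_left[OF d2] \<delta> by (auto simp: g0_def)
  define h where "h = min (min e1 e2) (min \<xi> x1) / 2"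
  have h: "0 < h" "h < e1" "h < e2" "h < \<xi>" "h < x1" unfolding h_def using e1 e2 \<xi> x by (auto simp: min_def)
  define c where "c = min (g0 - (gfun \<mu> s t (\<xi> + h) x2 - h * (r + \<delta>))) (g0 - (gfun \<mu> s t (\<xi> - h) x2 + h * (r - \<delta>)))"
  have c: "c > 0" using e1(2)[OF h(1,2)] e2(2)[OF h(1,3)] by (simp add: c_def)
  obtain C1 where C1: "\<And>N. moment \<mu> (\<xi> + h) (ldim s N) (ldim t N) \<le> ennreal (exp (C1 + real N * gfun \<mu> s t (\<xi> + h) x2))"
    using moment_upper_asymptotic[of s t x2 \<mu> "\<xi> + h"] st x h \<xi> by (auto simp: \<xi>_def)
  obtain C2 where C2: "\<And>N. moment \<mu> (\<xi> - h) (ldim s N) (ldim t N) \<le> ennreal (exp (C2 + real N * gfun \<mu> s t (\<xi> - h) x2))"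
    using moment_upper_asymptotic[of s t x2 \<mu> "\<xi> - h"] st x h \<xi> by auto
  show ?thesis
  proof (intro exI[of _ \<xi>] conjI allI impI)
    fix \<eta> :: real assume \<eta>: "\<eta> > 0"
    define \<eta>' where "\<eta>' = min (\<eta> / 2) (c / 2)"
    have \<eta>': "\<eta>' > 0" "\<eta>' \<le> \<eta> / 2" "\<eta>' \<le> c / 2" using \<eta> c by (auto simp: \<eta>'_def)
    have ev1: "eventually (\<lambda>N. ennreal (exp (real N * (g0 - \<eta>'))) \<le> moment \<mu> \<xi> (ldim s N) (ldim t N)) sequentially"
      unfolding g0_def
    proof (rule moment_asymptotic_lower)
      \<comment> \<open>Equality of \<open>phi\<close> at the two level points is exactly
        criticality of z = x2 for this \<xi>.\<close>
      show "t * (Digamma (x2 - \<xi>) - Digamma x2) + s * (Digamma (\<mu> - x2 + \<xi>) - Digamma (\<mu> - x2)) = 0"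
        using x(4,5) by (simp add: \<xi>_def phi_def algebra_simps)
    qed (use \<xi> x st \<eta>' in auto)
    have "((\<lambda>N. (exp C1 + exp C2) * exp (- (c / 2) * real N)) \<longlonglongrightarrow> 0)" using c by real_asymp
    then have ev2: "eventually (\<lambda>N. (exp C1 + exp C2) * exp (- (c / 2) * real N) < 1 / 2) sequentially"
      by (rule order_tendstoD) simp
    have "((\<lambda>N. exp (- (\<eta> / 2) * real N)) \<longlonglongrightarrow> 0)" using \<eta> by real_asymp
    then have ev3: "eventually (\<lambda>N. exp (- (\<eta> / 2) * real N) < 1 / 2) sequentially"
      by (rule order_tendstoD) simp
    show "eventually (\<lambda>N. exp (- real N * (I r + \<eta> + \<xi> * \<delta>)) \<le>
       measure P {w. exp (real N * (r - \<delta>)) < Z N w \<and> Z N w < exp (real N * (r + \<delta>))}) sequentially"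
      using ev1 ev2 ev3
    proof eventually_elim
      case (elim N)
      let ?B = "{w. exp (real N * (r - \<delta>)) < Z N w \<and> Z N w < exp (real N * (r + \<delta>))}"
      have meas: "?B \<in> sets P"
        using measurable_Zrec_Collect[of "{exp (real N * (r - \<delta>))<..<exp (real N * (r + \<delta>))}" "ldim s N" "ldim t N" "\<lambda>_. \<mu>"] by simp
      \<comment> \<open>Above the window the h-th power of Z exp(-N(r + \<delta>)) is at least 1,
        below it the h-th power of exp(N(r - \<delta>))/Z is. On the window Z is at most exp(N(r +
        \<delta>)), which causes the loss \<xi>\<delta> in the statement.\<close>
      have pw: "Z N w powr \<xi> \<le> exp (real N * (\<xi> * (r + \<delta>))) * indicator ?B w +
          exp (- (real N * (h * (r + \<delta>)))) * Z N w powr (\<xi> + h) + exp (real N * (h * (r - \<delta>))) * Z N w powr (\<xi> - h)" for w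
      proof -
        have nn: "0 \<le> exp (- (real N * (h * (r + \<delta>)))) * Z N w powr (\<xi> + h)"
          "0 \<le> exp (real N * (h * (r - \<delta>))) * Z N w powr (\<xi> - h)"
          "0 \<le> exp (real N * (\<xi> * (r + \<delta>))) * indicator ?B w" by simp_all
        consider "Z N w \<ge> exp (real N * (r + \<delta>))" | "Z N w \<le> exp (real N * (r - \<delta>))" | "w \<in> ?B" by fastforce
        then show ?thesis
        proof cases
          case 1
          have "1 = exp (- (real N * (h * (r + \<delta>)))) * exp (real N * (r + \<delta>)) powr h"
            unfolding powr_exp_eq exp_add[symmetric] by (simp add: algebra_simps)
          also have "\<dots> \<le> exp (- (real N * (h * (r + \<delta>)))) * Z N w powr h"
            using 1 h by (intro mult_left_mono powr_mono2) auto
          finally have "1 * Z N w powr \<xi> \<le> (exp (- (real N * (h * (r + \<delta>)))) * Z N w powr h) * Z N w powr \<xi>"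
            by (intro mult_right_mono) auto
          also have "\<dots> = exp (- (real N * (h * (r + \<delta>)))) * Z N w powr (\<xi> + h)"
            by (simp add: powr_add mult_ac)
          finally show ?thesis using nn by linarith
        next
          case 2
          have "Z N w powr h \<le> exp (real N * (r - \<delta>)) powr h"
            using 2 h by (intro powr_mono2) auto
          also have "\<dots> = exp (real N * (h * (r - \<delta>)))" by (simp add: powr_exp_eq mult_ac)
          finally have "Z N w powr h * Z N w powr (\<xi> - h) \<le> exp (real N * (h * (r - \<delta>))) * Z N w powr (\<xi> - h)"
            by (intro mult_right_mono) auto
          moreover have "Z N w powr h * Z N w powr (\<xi> - h) = Z N w powr \<xi>" by (simp add: powr_add[symmetric])
          ultimately show ?thesis using nn by linarith
        next
          case 3
          have "Z N w powr \<xi> \<le> exp (real N * (r + \<delta>)) powr \<xi>"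
            using 3 \<xi> by (intro powr_mono2) auto
          also have "\<dots> = exp (real N * (\<xi> * (r + \<delta>))) * indicator ?B w"
            using 3 by (simp add: powr_exp_eq mult_ac)
          finally show ?thesis using nn by linarith
        qed
      qed
      have "ennreal (exp (real N * (g0 - \<eta>'))) \<le> (\<integral>\<^sup>+w. ennreal (exp (real N * (\<xi> * (r + \<delta>)))) * indicator ?B w +
          ennreal (exp (- (real N * (h * (r + \<delta>))))) * ennreal (Z N w powr (\<xi> + h)) +
          ennreal (exp (real N * (h * (r - \<delta>)))) * ennreal (Z N w powr (\<xi> - h)) \<partial>P)"
      proof (rule order_trans[OF elim(1)], unfold moment_def, rule nn_integral_mono)
        fix w
        have "ennreal (Z N w powr \<xi>) \<le> ennreal (exp (real N * (\<xi> * (r + \<delta>))) * indicator ?B w +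
          exp (- (real N * (h * (r + \<delta>)))) * Z N w powr (\<xi> + h) + exp (real N * (h * (r - \<delta>))) * Z N w powr (\<xi> - h))"
          by (rule ennreal_leI[OF pw])
        also have "\<dots> = ennreal (exp (real N * (\<xi> * (r + \<delta>)))) * indicator ?B w +
          ennreal (exp (- (real N * (h * (r + \<delta>))))) * ennreal (Z N w powr (\<xi> + h)) +
          ennreal (exp (real N * (h * (r - \<delta>)))) * ennreal (Z N w powr (\<xi> - h))"
          by (subst ennreal_plus, simp, simp, subst ennreal_plus, simp, simp)
            (simp only: ennreal_mult' exp_ge_zero ennreal_indicator)
        finally show "ennreal (Z N w powr \<xi>) \<le> \<dots>" .
      qed
      also have "\<dots> = ennreal (exp (real N * (\<xi> * (r + \<delta>)))) * emeasure P ?B +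
          ennreal (exp (- (real N * (h * (r + \<delta>))))) * moment \<mu> (\<xi> + h) (ldim s N) (ldim t N) +
          ennreal (exp (real N * (h * (r - \<delta>)))) * moment \<mu> (\<xi> - h) (ldim s N) (ldim t N)"
        unfolding moment_def using meas
        by (subst nn_integral_add, simp, simp, subst nn_integral_add, simp, simp)
          (simp only: nn_integral_cmult_indicator, simp add: nn_integral_cmult)
      also have "\<dots> \<le> ennreal (exp (real N * (\<xi> * (r + \<delta>)))) * emeasure P ?B +
          ennreal (exp (- (real N * (h * (r + \<delta>))))) * ennreal (exp (C1 + real N * gfun \<mu> s t (\<xi> + h) x2)) +
          ennreal (exp (real N * (h * (r - \<delta>)))) * ennreal (exp (C2 + real N * gfun \<mu> s t (\<xi> - h) x2))"
        by (intro add_mono mult_left_mono C1 C2 order_refl) auto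
      also have "\<dots> = ennreal (exp (real N * (\<xi> * (r + \<delta>))) * measure P ?B +
          exp (C1 + real N * (gfun \<mu> s t (\<xi> + h) x2 - h * (r + \<delta>))) +
          exp (C2 + real N * (gfun \<mu> s t (\<xi> - h) x2 + h * (r - \<delta>))))"
        unfolding emeasure_eq_measure
        by (simp add: ennreal_mult'[symmetric] ennreal_plus[symmetric] exp_add[symmetric] del: ennreal_plus)
          (simp add: algebra_simps)
      finally have "exp (real N * (g0 - \<eta>')) \<le> exp (real N * (\<xi> * (r + \<delta>))) * measure P ?B +
          exp (C1 + real N * (gfun \<mu> s t (\<xi> + h) x2 - h * (r + \<delta>))) +
          exp (C2 + real N * (gfun \<mu> s t (\<xi> - h) x2 + h * (r - \<delta>)))"
        by (subst (asm) ennreal_le_iff) auto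
      also have "\<dots> \<le> exp (real N * (\<xi> * (r + \<delta>))) * measure P ?B +
          exp (C1 + real N * (g0 - c)) + exp (C2 + real N * (g0 - c))"
        by (intro add_mono iffD2[OF exp_le_cancel_iff] mult_left_mono order_refl) (auto simp: c_def)
      finally have main: "exp (real N * (g0 - \<eta>')) \<le> exp (real N * (\<xi> * (r + \<delta>))) * measure P ?B +
          exp (C1 + real N * (g0 - c)) + exp (C2 + real N * (g0 - c))" .
      \<comment> \<open>The two tail terms make up at most half of the lower bound for the moment,
        so the window carries the rest.\<close>
      have "exp (C1 + real N * (g0 - c)) + exp (C2 + real N * (g0 - c)) = exp (real N * (g0 - c / 2)) * ((exp C1 + exp C2) * exp (- (c / 2) * real N))"
      proof -
        have "exp (real N * (g0 - c)) = exp (real N * (g0 - c / 2)) * exp (- (c / 2) * real N)"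
          by (simp add: exp_add[symmetric] algebra_simps)
        moreover have "x * (E * F) + y * (E * F) = E * ((x + y) * F)" for x y E F :: real
          by (simp add: algebra_simps)
        ultimately show ?thesis by (simp only: exp_add[of C1] exp_add[of C2])
      qed
      also have "\<dots> \<le> exp (real N * (g0 - \<eta>')) * (1 / 2)"
        using elim(2) \<eta>' by (intro mult_mono iffD2[OF exp_le_cancel_iff] mult_left_mono) auto
      finally have "exp (real N * (g0 - \<eta>')) * (1 / 2) \<le> exp (real N * (\<xi> * (r + \<delta>))) * measure P ?B"
        using main by linarith
      moreover have "exp (real N * (g0 - \<eta>')) * exp (- (\<eta> / 2) * real N) \<le> exp (real N * (g0 - \<eta>')) * (1 / 2)"
        using elim(3) by (intro mult_left_mono) auto
      ultimately have "exp (real N * (g0 - \<eta>')) * exp (- (\<eta> / 2) * real N) \<le> exp (real N * (\<xi> * (r + \<delta>))) * measure P ?B" by linarith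
      moreover have "exp (real N * (\<xi> * (r + \<delta>))) * exp (- real N * (I r + \<eta> + \<xi> * \<delta>)) \<le> exp (real N * (g0 - \<eta>')) * exp (- (\<eta> / 2) * real N)"
      proof -
        have "real N * \<eta>' \<le> real N * (\<eta> / 2)" using \<eta>' by (intro mult_left_mono) auto
        then have "real N * (\<xi> * (r + \<delta>)) + - real N * (I r + \<eta> + \<xi> * \<delta>) \<le> real N * (g0 - \<eta>') + - (\<eta> / 2) * real N"
          unfolding I by (simp add: algebra_simps)
        then show ?thesis by (simp only: exp_add[symmetric] exp_le_cancel_iff)
      qed
      ultimately have "exp (real N * (\<xi> * (r + \<delta>))) * exp (- real N * (I r + \<eta> + \<xi> * \<delta>)) \<le> exp (real N * (\<xi> * (r + \<delta>))) * measure P ?B"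
        by linarith
      then show ?case by simp
    qed
  qed (use \<xi> in auto)
qed

text \<open>The window is shrunk until the loss \<xi>d is at most \<eta>/2. Since \<xi> is obtained
  only after d, the uniform bound \<xi> \<le> \<mu> is what breaks the circle.\<close>

lemma local_lower:
  assumes r: "p < r" and \<delta>: "\<delta> > 0" and \<eta>: "\<eta> > 0"
  shows "eventually (\<lambda>N. exp (- real N * (I r + \<eta>)) \<le>
     measure P {w. exp (real N * (r - \<delta>)) < Z N w \<and> Z N w < exp (real N * (r + \<delta>))}) sequentially"
proof -
  interpret prob_space P by (rule prob_space_P)
  define d where "d = min \<delta> (\<eta> / (2 * \<mu>))"
  have d: "d > 0" "d \<le> \<delta>" "\<mu> * d \<le> \<eta> / 2"
  proof -
    show "d > 0" "d \<le> \<delta>" using \<delta> \<eta> mu_pos by (auto simp: d_def)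
    have "\<mu> * d \<le> \<mu> * (\<eta> / (2 * \<mu>))" using mu_pos by (intro mult_left_mono) (auto simp: d_def)
    then show "\<mu> * d \<le> \<eta> / 2" using mu_pos by simp
  qed
  obtain \<xi> where \<xi>: "\<xi> \<ge> 0" "\<xi> \<le> \<mu>" and ev: "\<And>\<eta>. \<eta> > 0 \<Longrightarrow> eventually (\<lambda>N. exp (- real N * (I r + \<eta> + \<xi> * d)) \<le>
     measure P {w. exp (real N * (r - d)) < Z N w \<and> Z N w < exp (real N * (r + d))}) sequentially"
    using local_lower_aux[OF r d(1)] by auto
  have "\<eta> / 2 > 0" using \<eta> by simp
  from ev[OF this] show ?thesis
  proof eventually_elim
    case (elim N)
    have "\<xi> * d \<le> \<mu> * d" using \<xi> d by (intro mult_right_mono) auto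
    then have "I r + \<eta> / 2 + \<xi> * d \<le> I r + \<eta>" using d(3) by linarith
    then have "real N * (I r + \<eta> / 2 + \<xi> * d) \<le> real N * (I r + \<eta>)" by (intro mult_left_mono) auto
    then have "exp (- real N * (I r + \<eta>)) \<le> exp (- real N * (I r + \<eta> / 2 + \<xi> * d))" by simp
    also have "\<dots> \<le> measure P {w. exp (real N * (r - d)) < Z N w \<and> Z N w < exp (real N * (r + d))}" by (rule elim)
    also have "\<dots> \<le> measure P {w. exp (real N * (r - \<delta>)) < Z N w \<and> Z N w < exp (real N * (r + \<delta>))}"
    proof (rule finite_measure_mono)
      show "{w. exp (real N * (r - \<delta>)) < Z N w \<and> Z N w < exp (real N * (r + \<delta>))} \<in> sets P"
        using measurable_Zrec_Collect[of "{exp (real N * (r - \<delta>))<..<exp (real N * (r + \<delta>))}" "ldim s N" "ldim t N" "\<lambda>_. \<mu>"] by simp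
      have le: "exp (real N * (r - \<delta>)) \<le> exp (real N * (r - d))" "exp (real N * (r + d)) \<le> exp (real N * (r + \<delta>))"
        using d by (auto intro!: mult_left_mono)
      show "{w. exp (real N * (r - d)) < Z N w \<and> Z N w < exp (real N * (r + d))} \<subseteq>
          {w. exp (real N * (r - \<delta>)) < Z N w \<and> Z N w < exp (real N * (r + \<delta>))}"
        by (rule Collect_mono, rule impI, elim conjE, rule conjI, erule le_less_trans[OF le(1)], erule less_le_trans[OF _ le(2)])
    qed
    finally show ?case .
  qed
qed

lemma left_tail_P:
  assumes "\<delta> > 0"
  shows "eventually (\<lambda>N. measure P {w. Z N w \<le> exp (real N * (p - \<delta>))} \<le> exp (- real N * K)) sequentially"
proof -
  interpret prob_space P by (rule prob_space_P)
  have "t * Polygamma 1 z0 = s * Polygamma 1 (\<mu> - z0)" using crit by (simp add: phi'_def)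
  from left_tail[OF z0 st assms this, of K] show ?thesis
    unfolding p_def by eventually_elim (simp add: emeasure_eq_measure mult.commute)
qed

end

section \<open>From tail bounds to the large deviation principle\<close>

abbreviation scaled_log_prob :: "'w measure \<Rightarrow> nat \<Rightarrow> 'w set \<Rightarrow> ereal" where
  "scaled_log_prob M n A \<equiv> ereal (1 / real n) * log_prob M A"

lemma scaled_log_prob_upper:
  assumes "n > 0" "measure M A \<le> exp (- real n * c)"
  shows "scaled_log_prob M n A \<le> ereal (- c)"
proof (cases "measure M A = 0")
  case True
  then show ?thesis using assms by (simp add: log_prob_def)
next
  case False
  then have pos: "measure M A > 0" using measure_nonneg[of M A] by linarith
  have "ln (measure M A) \<le> ln (exp (- real n * c))" using assms pos by (subst ln_le_cancel_iff) auto
  then have "ln (measure M A) / real n \<le> - c" using assms(1) by (simp add: field_simps)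
  then show ?thesis using False by (simp add: log_prob_def)
qed

lemma scaled_log_prob_lower:
  assumes "n > 0" "exp (- real n * c) \<le> measure M A"
  shows "ereal (- c) \<le> scaled_log_prob M n A"
proof -
  have pos: "measure M A > 0" using assms(2) exp_gt_zero[of "- real n * c"] by linarith
  have "ln (exp (- real n * c)) \<le> ln (measure M A)" using assms pos by (subst ln_le_cancel_iff) auto
  then have "- c \<le> ln (measure M A) / real n" using assms(1) by (simp add: field_simps)
  then show ?thesis using pos by (simp add: log_prob_def)
qed

text \<open>What the principle requires of the model. Lower bounds are demanded only strictly to the
  right of p; at p they follow by approach from the right and continuity of \<open>I\<close>. The
  left tail has to beat every exponential rate, hence the arbitrary K.\<close>

locale ldp_tails = prob_space M for M :: "'w measure" +
  fixes X :: "nat \<Rightarrow> 'w \<Rightarrow> real" and I :: "real \<Rightarrow> real" and p :: real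
  assumes X_measurable [measurable]: "\<And>n. X n \<in> borel_measurable M"
    and I_at_p: "I p = 0"
    and I_mono: "\<And>r r'. p \<le> r \<Longrightarrow> r < r' \<Longrightarrow> I r < I r'"
    and I_cont: "continuous_on UNIV I"
    and right_upper: "\<And>r \<eta>. p < r \<Longrightarrow> 0 < \<eta> \<Longrightarrow>
      eventually (\<lambda>n. prob {\<omega> \<in> space M. r \<le> X n \<omega>} \<le> exp (- real n * (I r - \<eta>))) sequentially"
    and local_lower: "\<And>r \<delta> \<eta>. p < r \<Longrightarrow> 0 < \<delta> \<Longrightarrow> 0 < \<eta> \<Longrightarrow>
      eventually (\<lambda>n. exp (- real n * (I r + \<eta>)) \<le> prob {\<omega> \<in> space M. \<bar>X n \<omega> - r\<bar> < \<delta>}) sequentially"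
    and left_upper: "\<And>\<delta> K. 0 < \<delta> \<Longrightarrow>
      eventually (\<lambda>n. prob {\<omega> \<in> space M. X n \<omega> \<le> p - \<delta>} \<le> exp (- real n * K)) sequentially"
begin

definition rate :: "real \<Rightarrow> ereal" where
  "rate r = (if p \<le> r then ereal (I r) else \<infinity>)"

lemma event_measurable [measurable]:
  assumes "A \<in> sets borel" shows "{\<omega> \<in> space M. X n \<omega> \<in> A} \<in> events"
  using assms by measurable

lemma near_right:
  assumes "p \<le> r" "\<eta> > 0"
  shows "\<exists>d>0. \<forall>r'. r < r' \<and> r' < r + d \<longrightarrow> I r' < I r + \<eta>"
proof -
  have "isCont I r" using I_cont by (simp add: continuous_on_eq_continuous_at)
  then obtain d where "d > 0" "\<And>r'. dist r' r < d \<Longrightarrow> dist (I r') (I r) < \<eta>"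
    using assms(2) unfolding continuous_at_eps_delta by blast
  moreover have "I r' < I r + \<eta>" if "r < r'" "r' < r + d" "dist (I r') (I r) < \<eta>" for r'
    using that by (simp add: dist_real_def abs_less_iff)
  ultimately show ?thesis by (intro exI[of _ d]) (simp add: dist_real_def)
qed

lemma open_lower:
  assumes "open G" "r \<in> G"
  shows "- rate r \<le> liminf (\<lambda>n. scaled_log_prob M n {\<omega> \<in> space M. X n \<omega> \<in> G})"
proof (cases "p \<le> r")
  case False
  then show ?thesis by (simp add: rate_def)
next
  case True
  show ?thesis
  proof (rule ereal_le_epsilon2)
    fix \<eta> :: real assume \<eta>: "\<eta> > 0"
    have \<eta>2: "0 < \<eta> / 2" using \<eta> by simp
    obtain d where d: "d > 0" "\<And>r'. r < r' \<Longrightarrow> r' < r + d \<Longrightarrow> I r' < I r + \<eta> / 2"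
      using near_right[OF True, of "\<eta> / 2"] \<eta> by auto
    obtain e where e: "e > 0" "ball r e \<subseteq> G" using assms openE by blast
    \<comment> \<open>A nearby point still inside G and strictly above p even when r = p; continuity
      keeps the change of the rate within \<eta>/2.\<close>
    define r' where "r' = r + min d e / 2"
    define \<delta> where "\<delta> = min d e / 2"
    have r': "r < r'" "r' < r + d" "p < r'" "\<delta> > 0" using d e True by (auto simp: r'_def \<delta>_def)
    have sub: "x \<in> G" if "\<bar>x - r'\<bar> < \<delta>" for x
    proof -
      have "min d e \<le> e" "0 < min d e" using d e by auto
      then have "\<bar>x - r\<bar> < e" using that unfolding r'_def \<delta>_def abs_less_iff by linarith
      then show ?thesis using e by (auto simp: dist_real_def abs_minus_commute)
    qed
    have "eventually (\<lambda>n. ereal (- (I r + \<eta>)) \<le> scaled_log_prob M n {\<omega> \<in> space M. X n \<omega> \<in> G}) sequentially"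
      using local_lower[OF r'(3,4) \<eta>2] eventually_gt_at_top[of 0]
    proof eventually_elim
      case (elim n)
      have "prob {\<omega> \<in> space M. \<bar>X n \<omega> - r'\<bar> < \<delta>} \<le> prob {\<omega> \<in> space M. X n \<omega> \<in> G}"
        using sub assms by (intro finite_measure_mono event_measurable) auto
      moreover have "exp (- real n * (I r + \<eta>)) \<le> exp (- real n * (I r' + \<eta> / 2))"
        using d(2)[OF r'(1,2)] by (auto intro!: mult_left_mono)
      ultimately show ?case using elim(1) by (intro scaled_log_prob_lower[OF elim(2)]) linarith
    qed
    then have "ereal (- (I r + \<eta>)) \<le> liminf (\<lambda>n. scaled_log_prob M n {\<omega> \<in> space M. X n \<omega> \<in> G})"
      by (rule Liminf_bounded)
    then have "ereal (- (I r + \<eta>)) + ereal \<eta> \<le> liminf (\<lambda>n. scaled_log_prob M n {\<omega> \<in> space M. X n \<omega> \<in> G}) + ereal \<eta>"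
      by (rule add_right_mono)
    then show "- rate r \<le> liminf (\<lambda>n. scaled_log_prob M n {\<omega> \<in> space M. X n \<omega> \<in> G}) + ereal \<eta>"
      using True by (simp add: rate_def)
  qed
qed

lemma limsup_le_zero: "limsup (\<lambda>n. scaled_log_prob M n (A n)) \<le> 0"
proof (rule Limsup_bounded)
  show "eventually (\<lambda>n. scaled_log_prob M n (A n) \<le> 0) sequentially"
    using eventually_gt_at_top[of 0]
    by eventually_elim (use scaled_log_prob_upper[of _ M _ 0] in \<open>auto simp: zero_ereal_def\<close>)
qed

text \<open>The left tail admits any rate, so with K = I r - \<eta>/2 both parts obey the same
  bound, and the factor 2 goes into the other half of \<eta>.\<close>

lemma split_upper:
  assumes d: "d > 0" and r: "p < r" and F: "\<And>x. x \<in> F \<Longrightarrow> x \<le> p - d \<or> r \<le> x" "F \<in> sets borel"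
  shows "limsup (\<lambda>n. scaled_log_prob M n {\<omega> \<in> space M. X n \<omega> \<in> F}) \<le> ereal (- I r)"
proof (rule ereal_le_epsilon2)
  fix \<eta> :: real assume \<eta>: "\<eta> > 0"
  have \<eta>2: "0 < \<eta> / 2" using \<eta> by simp
  have "((\<lambda>n. 2 * exp (- (\<eta> / 2) * real n)) \<longlonglongrightarrow> 0)" using \<eta> by real_asymp
  then have ev: "eventually (\<lambda>n. 2 * exp (- (\<eta> / 2) * real n) < 1) sequentially"
    by (rule order_tendstoD) simp
  have "eventually (\<lambda>n. scaled_log_prob M n {\<omega> \<in> space M. X n \<omega> \<in> F} \<le> ereal (- (I r - \<eta>))) sequentially"
    using right_upper[OF r \<eta>2] left_upper[OF d, of "I r - \<eta> / 2"] eventually_gt_at_top[of 0] ev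
  proof eventually_elim
    case (elim n)
    have "prob {\<omega> \<in> space M. X n \<omega> \<in> F} \<le> prob ({\<omega> \<in> space M. X n \<omega> \<le> p - d} \<union> {\<omega> \<in> space M. r \<le> X n \<omega>})"
      using F(1) by (intro finite_measure_mono) auto
    also have "\<dots> \<le> prob {\<omega> \<in> space M. X n \<omega> \<le> p - d} + prob {\<omega> \<in> space M. r \<le> X n \<omega>}"
      by (intro measure_Un_le) auto
    also have "\<dots> \<le> 2 * exp (- real n * (I r - \<eta> / 2))" using elim by simp
    also have "\<dots> = (2 * exp (- (\<eta> / 2) * real n)) * exp (- real n * (I r - \<eta>))"
      by (simp add: exp_add[symmetric] algebra_simps)
    also have "\<dots> \<le> 1 * exp (- real n * (I r - \<eta>))"
      using elim by (intro mult_right_mono) auto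
    finally show ?case using elim by (intro scaled_log_prob_upper) auto
  qed
  then have "limsup (\<lambda>n. scaled_log_prob M n {\<omega> \<in> space M. X n \<omega> \<in> F}) \<le> ereal (- (I r - \<eta>))"
    by (rule Limsup_bounded)
  then show "limsup (\<lambda>n. scaled_log_prob M n {\<omega> \<in> space M. X n \<omega> \<in> F}) \<le> ereal (- I r) + ereal \<eta>" by simp
qed

lemma left_only_upper:
  assumes d: "d > 0" and F: "\<And>x. x \<in> F \<Longrightarrow> x \<le> p - d" "F \<in> sets borel"
  shows "limsup (\<lambda>n. scaled_log_prob M n {\<omega> \<in> space M. X n \<omega> \<in> F}) = -\<infinity>"
proof (rule ereal_bot)
  fix B :: real
  have "eventually (\<lambda>n. scaled_log_prob M n {\<omega> \<in> space M. X n \<omega> \<in> F} \<le> ereal (- (- B))) sequentially"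
    using left_upper[OF d, of "- B"] eventually_gt_at_top[of 0]
  proof eventually_elim
    case (elim n)
    have "prob {\<omega> \<in> space M. X n \<omega> \<in> F} \<le> prob {\<omega> \<in> space M. X n \<omega> \<le> p - d}"
      using F(1) by (intro finite_measure_mono) auto
    then show ?case using elim by (intro scaled_log_prob_upper) auto
  qed
  then show "limsup (\<lambda>n. scaled_log_prob M n {\<omega> \<in> space M. X n \<omega> \<in> F}) \<le> ereal B"
    by (intro Limsup_bounded) simp
qed

lemma closed_upper:
  assumes "closed F"
  shows "limsup (\<lambda>n. scaled_log_prob M n {\<omega> \<in> space M. X n \<omega> \<in> F}) \<le> - (INF r\<in>F. rate r)"
proof (cases "p \<in> F")
  case True
  have "rate p = 0" by (simp add: rate_def I_at_p zero_ereal_def)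
  then have "(INF r\<in>F. rate r) \<le> 0" using INF_lower[OF True, of rate] by (simp only:)
  then have "0 \<le> - (INF r\<in>F. rate r)" by (simp only: ereal_0_le_uminus_iff)
  then show ?thesis by (rule order_trans[OF limsup_le_zero])
next
  case False
  have "open (- F)" "p \<in> - F" using assms False by auto
  then obtain e where e: "e > 0" "ball p e \<subseteq> - F" using openE by blast
  have away: "\<bar>x - p\<bar> \<ge> e" if "x \<in> F" for x
  proof (rule ccontr)
    assume "\<not> ?thesis"
    then have "x \<in> ball p e" by (simp add: dist_real_def abs_minus_commute)
    then show False using e that by auto
  qed
  have borel: "F \<in> sets borel" using assms by simp
  let ?R = "F \<inter> {p..}"
  show ?thesis
  proof (cases "?R = {}")
    case True
    have "limsup (\<lambda>n. scaled_log_prob M n {\<omega> \<in> space M. X n \<omega> \<in> F}) = -\<infinity>"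
    proof (rule left_only_upper[OF e(1) _ borel])
      fix x assume x: "x \<in> F"
      then have "x < p" using True by fastforce
      then show "x \<le> p - e" using away[OF x] by (auto simp: abs_if)
    qed
    then show ?thesis by simp
  next
    case False
    \<comment> \<open>The point of F nearest to p on the right carries the smallest rate, while the
      points of F on the left stay at distance e from p.\<close>
    define r where "r = Inf ?R"
    have bdd: "bdd_below ?R" by (rule bdd_belowI[of _ p]) auto
    have "r \<in> ?R" unfolding r_def using assms False bdd by (intro closed_contains_Inf) auto
    then have r: "r \<in> F" "p \<le> r" by auto
    then have "p + e \<le> r" using away[of r] by (auto simp: abs_if split: if_splits)
    then have "p < r" using e by simp
    have "limsup (\<lambda>n. scaled_log_prob M n {\<omega> \<in> space M. X n \<omega> \<in> F}) \<le> ereal (- I r)"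
    proof (rule split_upper[OF e(1) \<open>p < r\<close> _ borel])
      fix x assume x: "x \<in> F"
      show "x \<le> p - e \<or> r \<le> x"
      proof (cases "p \<le> x")
        case True
        then show ?thesis unfolding r_def using x bdd by (auto intro: cInf_lower)
      next
        case False
        then show ?thesis using away[OF x] by (auto simp: abs_if)
      qed
    qed
    also have "ereal (- I r) = - rate r" using r by (simp add: rate_def)
    also have "\<dots> \<le> - (INF r\<in>F. rate r)"
      by (simp only: ereal_minus_le_minus) (rule INF_lower[OF r(1)])
    finally show ?thesis .
  qed
qed

lemma LDP: "satisfies_LDP M X rate"
  unfolding satisfies_LDP_def
proof (intro conjI allI impI)
  fix F :: "real set" assume "closed F"
  then show "limsup (\<lambda>n. scaled_log_prob M n {\<omega> \<in> space M. X n \<omega> \<in> F}) \<le> - (INF r\<in>F. rate r)"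
    by (rule closed_upper)
next
  fix G :: "real set" assume G: "open G"
  have "- (INF r\<in>G. rate r) = (SUP r\<in>G. - rate r)" by (simp add: ereal_SUP_uminus_eq)
  also have "\<dots> \<le> liminf (\<lambda>n. scaled_log_prob M n {\<omega> \<in> space M. X n \<omega> \<in> G})"
    by (rule SUP_least) (rule open_lower[OF G])
  finally show "- (INF r\<in>G. rate r) \<le> liminf (\<lambda>n. scaled_log_prob M n {\<omega> \<in> space M. X n \<omega> \<in> G})" .
qed

text \<open>Up to p the limit is -I p = 0: the upper bound is trivial there, and the lower bound
  comes from levels just above p.\<close>

lemma right_tail_limit:
  "(\<lambda>n. scaled_log_prob M n {\<omega> \<in> space M. r \<le> X n \<omega>}) \<longlonglongrightarrow> ereal (- I (max r p))"
proof -
  let ?f = "\<lambda>n. scaled_log_prob M n {\<omega> \<in> space M. r \<le> X n \<omega>}"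
  let ?q = "max r p"
  have up: "limsup ?f \<le> ereal (- I ?q)"
  proof (cases "p < r")
    case True
    have "limsup (\<lambda>n. scaled_log_prob M n {\<omega> \<in> space M. X n \<omega> \<in> {r..}}) \<le> ereal (- I r)"
      by (rule split_upper[of 1]) (use True in auto)
    then show ?thesis using True by (simp add: max_def)
  next
    case False
    then have "?q = p" by simp
    then show ?thesis using limsup_le_zero by (simp add: I_at_p zero_ereal_def)
  qed
  have lo: "ereal (- I ?q) \<le> liminf ?f"
  proof (rule ereal_le_epsilon2)
    fix \<eta> :: real assume \<eta>: "\<eta> > 0"
    have \<eta>2: "0 < \<eta> / 2" using \<eta> by simp
    have q: "p \<le> ?q" by simp
    obtain d where d: "d > 0" "\<And>r'. ?q < r' \<Longrightarrow> r' < ?q + d \<Longrightarrow> I r' < I ?q + \<eta> / 2"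
      using near_right[OF q, of "\<eta> / 2"] \<eta> by auto
    define r' where "r' = ?q + d / 2"
    have r': "?q < r'" "r' < ?q + d" "p < r'" "d / 2 > 0" using d unfolding r'_def by (auto intro: le_less_trans[OF q])
    have "eventually (\<lambda>n. ereal (- (I ?q + \<eta>)) \<le> ?f n) sequentially"
      using local_lower[OF r'(3,4) \<eta>2] eventually_gt_at_top[of 0]
    proof eventually_elim
      case (elim n)
      have "r \<le> x" if "\<bar>x - r'\<bar> < d / 2" for x
      proof -
        have "?q < x" using that unfolding r'_def abs_less_iff by linarith
        then show ?thesis by simp
      qed
      then have "prob {\<omega> \<in> space M. \<bar>X n \<omega> - r'\<bar> < d / 2} \<le> prob {\<omega> \<in> space M. r \<le> X n \<omega>}"
        by (intro finite_measure_mono) auto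
      moreover have "exp (- real n * (I ?q + \<eta>)) \<le> exp (- real n * (I r' + \<eta> / 2))"
        using d(2)[OF r'(1,2)] by (auto intro!: mult_left_mono)
      ultimately show ?case using elim(1) by (intro scaled_log_prob_lower[OF elim(2)]) linarith
    qed
    then have "ereal (- (I ?q + \<eta>)) \<le> liminf ?f" by (rule Liminf_bounded)
    then have "ereal (- (I ?q + \<eta>)) + ereal \<eta> \<le> liminf ?f + ereal \<eta>" by (rule add_right_mono)
    then show "ereal (- I ?q) \<le> liminf ?f + ereal \<eta>" by simp
  qed
  have "liminf ?f \<le> limsup ?f" by (rule Liminf_le_Limsup) simp
  then have "liminf ?f = ereal (- I ?q)" "limsup ?f = ereal (- I ?q)" using up lo by (auto intro: antisym order_trans)
  then show ?thesis by (simp add: tendsto_iff_Liminf_eq_Limsup)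
qed

text \<open>Both deviation probabilities are summable for every e, so Borel-Cantelli applies. This
  existence statement, with uniqueness below, makes the description of \<open>free_energy\<close>
  meaningful.\<close>

lemma AE_limit: "AE \<omega> in M. (\<lambda>n. X n \<omega>) \<longlonglongrightarrow> p"
proof -
  have dev: "AE \<omega> in M. eventually (\<lambda>n. \<bar>X n \<omega> - p\<bar> < e) sequentially" if e: "e > 0" for e
  proof -
    let ?A = "\<lambda>n. {\<omega> \<in> space M. X n \<omega> \<le> p - e} \<union> {\<omega> \<in> space M. p + e \<le> X n \<omega>}"
    \<comment> \<open>A common rate: the left tail is used with K = 1, the right tail with half of
      its rate given up.\<close>
    define c where "c = min 1 (I (p + e) / 2)"
    have Ie: "I (p + e) > 0" using I_mono[of p "p + e"] I_at_p e by simp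
    have pe: "p < p + e" "0 < I (p + e) / 2" using Ie e by auto
    have c: "c > 0" "c \<le> 1" "c \<le> I (p + e) / 2" using Ie by (auto simp: c_def)
    have "eventually (\<lambda>n. norm (prob (?A n)) \<le> 2 * exp (- c) ^ n) sequentially"
      using left_upper[OF e, of 1] right_upper[OF pe]
    proof eventually_elim
      case (elim n)
      have "prob (?A n) \<le> prob {\<omega> \<in> space M. X n \<omega> \<le> p - e} + prob {\<omega> \<in> space M. p + e \<le> X n \<omega>}"
        by (intro measure_Un_le) auto
      also have "\<dots> \<le> exp (- real n * 1) + exp (- real n * (I (p + e) / 2))" using elim by simp
      also have "\<dots> \<le> exp (- real n * c) + exp (- real n * c)"
        using c by (intro add_mono iffD2[OF exp_le_cancel_iff] mult_left_mono_neg) auto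
      also have "\<dots> = 2 * exp (- c) ^ n" by (simp add: exp_of_nat_mult[symmetric])
      finally show ?case by simp
    qed
    moreover have "summable (\<lambda>n. 2 * exp (- c) ^ n)" using c by (intro summable_mult summable_geometric) simp
    ultimately have "summable (\<lambda>n. prob (?A n))" by (rule summable_comparison_test_ev)
    then have "AE \<omega> in M. eventually (\<lambda>n. \<omega> \<in> space M - ?A n) sequentially"
      by (intro borel_cantelli_AE1) (auto simp: less_top[symmetric])
    then show ?thesis
      by eventually_elim (auto elim!: eventually_mono simp: abs_less_iff not_le)
  qed
  have "AE \<omega> in M. \<forall>k::nat. eventually (\<lambda>n. \<bar>X n \<omega> - p\<bar> < 1 / real (Suc k)) sequentially"
    unfolding AE_all_countable by (intro allI dev) simp
  then show ?thesis
  proof eventually_elim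
    case (elim \<omega>)
    show ?case
    proof (rule tendstoI)
      fix e :: real assume "e > 0"
      then obtain k where k: "1 / real (Suc k) < e" using nat_approx_posE by blast
      show "eventually (\<lambda>n. dist (X n \<omega>) p < e) sequentially"
        using elim[rule_format, of k] by eventually_elim (use k in \<open>simp add: dist_real_def\<close>)
    qed
  qed
qed

lemma AE_limit_unique:
  assumes "AE \<omega> in M. (\<lambda>n. X n \<omega>) \<longlonglongrightarrow> c"
  shows "c = p"
proof -
  have "AE \<omega> in M. c = p" using assms AE_limit by eventually_elim (rule LIMSEQ_unique)
  then show ?thesis by simp
qed

end

section \<open>Transfer to the given weights\<close>

text \<open>The log-weight is written as -ln of the reciprocal, so that its law is the image of the
  gamma law by definition. The weight equals exp of it where the reciprocal is positive, that is,
  almost surely; as there are countably many sites, one null set serves them all.\<close>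

lemma log_weights_law:
  assumes M: "prob_space M" and \<mu>: "\<mu> > 0" and Y: "inverse_gamma_weights M \<mu> Y"
  defines "W \<equiv> \<lambda>\<omega> v. - ln (inverse (Y v \<omega>))"
  shows "W \<in> M \<rightarrow>\<^sub>M env_borel" "distr M env_borel W = env (\<lambda>_. \<mu>)"
    "AE \<omega> in M. \<forall>v. Y v \<omega> = exp (W \<omega> v)"
proof -
  interpret prob_space M by (rule M)
  have ind: "indep_vars (\<lambda>_. borel) Y UNIV"
    and dens: "distributed M lborel (\<lambda>\<omega>. inverse (Y v \<omega>)) (\<lambda>x. ennreal (gamma_density \<mu> x))" for v
    using Y unfolding inverse_gamma_weights_def by (auto simp del: split_paired_All)
  have [measurable]: "Y v \<in> borel_measurable M" for v using ind unfolding indep_vars_def by (auto simp del: split_paired_All)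
  have [measurable]: "(\<lambda>\<omega>. W \<omega> v) \<in> borel_measurable M" for v unfolding W_def by measurable
  show meas: "W \<in> M \<rightarrow>\<^sub>M env_borel" by (rule measurable_abs_UNIV) simp
  have law: "distr M borel (\<lambda>\<omega>. W \<omega> v) = log_inv_gamma \<mu>" for v
  proof -
    have "distr M borel (\<lambda>\<omega>. W \<omega> v) = distr (distr M lborel (\<lambda>\<omega>. inverse (Y v \<omega>))) borel (\<lambda>x. - ln x)"
      unfolding W_def by (subst distr_distr) (auto simp: comp_def)
    also have "\<dots> = log_inv_gamma \<mu>"
      using dens[of v] unfolding distributed_def log_inv_gamma_def by simp
    finally show ?thesis .
  qed
  have "indep_vars (\<lambda>_. borel) (\<lambda>v. (\<lambda>y. - ln (inverse y)) \<circ> Y v) UNIV"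
    by (rule indep_vars_compose[OF ind]) auto
  then have "indep_vars (\<lambda>_. borel) (\<lambda>v \<omega>. W \<omega> v) UNIV" by (simp add: W_def comp_def)
  then have "distr M env_borel (\<lambda>x. \<lambda>i\<in>UNIV. W x i) = (\<Pi>\<^sub>M i\<in>UNIV. distr M borel (\<lambda>\<omega>. W \<omega> i))"
    by (subst (asm) indep_vars_iff_distr_eq_PiM') auto
  then show "distr M env_borel W = env (\<lambda>_. \<mu>)" by (simp add: law env_def restrict_UNIV)
  have "AE \<omega> in M. Y v \<omega> = exp (W \<omega> v)" for v
  proof -
    have "AE x in density lborel (\<lambda>x. ennreal (gamma_density \<mu> x)). 0 < x"
      by (subst AE_density, measurable) (auto simp: gamma_density_def)
    moreover have "distr M lborel (\<lambda>\<omega>. inverse (Y v \<omega>)) = density lborel (\<lambda>x. ennreal (gamma_density \<mu> x))"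
      using dens[of v] by (simp add: distributed_def)
    ultimately have "AE x in distr M lborel (\<lambda>\<omega>. inverse (Y v \<omega>)). 0 < x" by metis
    then have "AE \<omega> in M. 0 < inverse (Y v \<omega>)" by (rule AE_distrD[rotated]) auto
    then show ?thesis
      by eventually_elim (simp add: W_def ln_inverse)
  qed
  then show "AE \<omega> in M. \<forall>v. Y v \<omega> = exp (W \<omega> v)" by (simp add: AE_all_countable)
qed

lemma log_Z_law:
  assumes M: "prob_space M" and \<mu>: "\<mu> > 0" and Y: "inverse_gamma_weights M \<mu> Y"
  shows "log_Z Y s t n \<in> borel_measurable M"
    and "A \<in> sets borel \<Longrightarrow> measure M {\<omega> \<in> space M. log_Z Y s t n \<omega> \<in> A} =
      measure (env (\<lambda>_. \<mu>)) {w. ln (Zrec w (ldim s n) (ldim t n)) \<in> A}"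
proof -
  interpret prob_space M by (rule M)
  define W where "W = (\<lambda>\<omega> v. - ln (inverse (Y v \<omega>)))"
  note law = log_weights_law[OF M \<mu> Y, folded W_def]
  have [measurable]: "Y v \<in> borel_measurable M" for v
    using Y unfolding inverse_gamma_weights_def indep_vars_def by (auto simp del: split_paired_All)
  show meas [measurable]: "log_Z Y s t n \<in> borel_measurable M"
    unfolding log_Z_def [abs_def] partition_function_def by measurable
  note [measurable] = law(1)
  assume A [measurable]: "A \<in> sets borel"
  have "{w \<in> space (env (\<lambda>_. \<mu>)). ln (Zrec w (ldim s n) (ldim t n)) \<in> A} \<in> sets (env (\<lambda>_. \<mu>))" by measurable
  then have ms: "{w. ln (Zrec w (ldim s n) (ldim t n)) \<in> A} \<in> sets (env (\<lambda>_. \<mu>))" by simp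
  have "AE \<omega> in M. log_Z Y s t n \<omega> = ln (Zrec (W \<omega>) (ldim s n) (ldim t n))"
    using law(3)
  proof eventually_elim
    case (elim \<omega>)
    then have "Y v \<omega> = exp (W \<omega> v)" for v unfolding W_def by blast
    then have "(\<lambda>v. Y v \<omega>) = (\<lambda>v. exp (W \<omega> v))" by (rule ext)
    then show ?case by (simp add: log_Z_def partition_function_eq_Zrec ldim_def)
  qed
  then have "measure M {\<omega> \<in> space M. log_Z Y s t n \<omega> \<in> A} = measure M {\<omega> \<in> space M. ln (Zrec (W \<omega>) (ldim s n) (ldim t n)) \<in> A}"
    by (intro finite_measure_eq_AE) (auto elim!: eventually_mono)
  also have "\<dots> = measure (distr M env_borel W) {w. ln (Zrec w (ldim s n) (ldim t n)) \<in> A}"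
    using ms law(1) by (subst measure_distr) (auto intro!: arg_cong[where f = "measure M"])
  finally show "measure M {\<omega> \<in> space M. log_Z Y s t n \<omega> \<in> A} = measure (env (\<lambda>_. \<mu>)) {w. ln (Zrec w (ldim s n) (ldim t n)) \<in> A}"
    by (simp add: law(2))
qed

theorem theorem2p2:
  fixes M :: "'w measure" and Y :: "nat \<times> nat \<Rightarrow> 'w \<Rightarrow> real" and \<mu> s t :: real
  assumes "prob_space M"
    and "\<mu> > 0"
    and "inverse_gamma_weights M \<mu> Y"
    and "s > 0" and "t > 0"
  shows "let p = free_energy M Y s t; I = rate_function \<mu> s t p; J = right_tail_rate M Y s t in
     satisfies_LDP M (\<lambda>n \<omega>. log_Z Y s t n \<omega> / real n) I \<and>
     (\<forall>r\<ge>p. \<bar>I r\<bar> \<noteq> \<infinity>) \<and>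
     strict_mono_on {p..} I \<and>
     continuous_on {p..} I \<and>
     convex_on {p..} (\<lambda>r. real_of_ereal (I r)) \<and>
     (\<forall>r. I r = 0 \<longleftrightarrow> r = p) \<and>
     (\<forall>r. convergent (right_tail_seq M Y s t r)) \<and>
     (\<forall>r\<le>p. J r = 0) \<and>
     (\<forall>r\<ge>p. J r = I r)"
proof -
  obtain z0 where z0: "0 < z0" "z0 < \<mu>" "phi' \<mu> s t z0 = 0"
    using phi_critical_exists[of \<mu> s t] assms by auto
  interpret C: critical \<mu> s t z0 by unfold_locales (use z0 assms in auto)
  note law = log_Z_law[OF assms(1-3), where s = s and t = t]
  define X where "X n \<omega> = log_Z Y s t n \<omega> / real n" for n \<omega>
  have tail: "measure M {\<omega> \<in> space M. X n \<omega> \<in> A} = measure C.P {w. ln (C.Z n w) / real n \<in> A}" if "A \<in> sets borel" for n A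
  proof -
    have "(\<lambda>x. x / real n) -` A \<in> sets borel" using that by (intro measurable_sets_borel[OF _ that]) auto
    from law(2)[OF this, of n] show ?thesis by (simp add: X_def)
  qed
  interpret T: ldp_tails M X C.I C.p
  proof (intro ldp_tails.intro ldp_tails_axioms.intro)
    show "prob_space M" by (rule assms)
    show "X n \<in> borel_measurable M" for n unfolding X_def using law(1) by measurable
    show "C.I C.p = 0" by (rule C.I_p)
    show "C.I r < C.I r'" if "C.p \<le> r" "r < r'" for r r' by (rule C.I_strict_mono[OF that])
    show "continuous_on UNIV C.I" by (rule C.I_continuous)
    show "eventually (\<lambda>n. measure M {\<omega> \<in> space M. r \<le> X n \<omega>} \<le> exp (- real n * (C.I r - \<eta>))) sequentially"
      if "C.p < r" "0 < \<eta>" for r \<eta>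
      using C.right_tail_upper_rate[OF that(2), of r] eventually_gt_at_top[of 0]
    proof eventually_elim
      case (elim n)
      have "{w. ln (C.Z n w) / real n \<in> {r..}} = {w. exp (real n * r) \<le> C.Z n w}"
        using elim(2) by (auto simp: field_simps ln_ge_iff)
      then show ?case using elim(1) tail[of "{r..}" n] by simp
    qed
    show "eventually (\<lambda>n. exp (- real n * (C.I r + \<eta>)) \<le> measure M {\<omega> \<in> space M. \<bar>X n \<omega> - r\<bar> < \<delta>}) sequentially"
      if "C.p < r" "0 < \<delta>" "0 < \<eta>" for r \<delta> \<eta>
      using C.local_lower[OF that] eventually_gt_at_top[of 0]
    proof eventually_elim
      case (elim n)
      have "{w. ln (C.Z n w) / real n \<in> {r - \<delta><..<r + \<delta>}} =
          {w. exp (real n * (r - \<delta>)) < C.Z n w \<and> C.Z n w < exp (real n * (r + \<delta>))}"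
      proof (intro Collect_cong)
        fix w
        have "exp (real n * (r - \<delta>)) < C.Z n w \<longleftrightarrow> real n * (r - \<delta>) < ln (C.Z n w)"
          by (metis exp_ln ln_less_cancel_iff exp_gt_zero ln_exp Zrec_pos)
        moreover have "C.Z n w < exp (real n * (r + \<delta>)) \<longleftrightarrow> ln (C.Z n w) < real n * (r + \<delta>)"
          by (metis exp_ln ln_less_cancel_iff exp_gt_zero ln_exp Zrec_pos)
        ultimately show "ln (C.Z n w) / real n \<in> {r - \<delta><..<r + \<delta>} \<longleftrightarrow>
            exp (real n * (r - \<delta>)) < C.Z n w \<and> C.Z n w < exp (real n * (r + \<delta>))"
          using elim(2) by (simp add: pos_less_divide_eq pos_divide_less_eq mult.commute)
      qed
      moreover have "{\<omega> \<in> space M. \<bar>X n \<omega> - r\<bar> < \<delta>} = {\<omega> \<in> space M. X n \<omega> \<in> {r - \<delta><..<r + \<delta>}}"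
        by (auto simp: abs_less_iff)
      ultimately show ?case using elim(1) tail[of "{r - \<delta><..<r + \<delta>}" n] by simp
    qed
    show "eventually (\<lambda>n. measure M {\<omega> \<in> space M. X n \<omega> \<le> C.p - \<delta>} \<le> exp (- real n * K)) sequentially"
      if "0 < \<delta>" for \<delta> K
      using C.left_tail_P[OF that, of K] eventually_gt_at_top[of 0]
    proof eventually_elim
      case (elim n)
      have "{w. ln (C.Z n w) / real n \<in> {..C.p - \<delta>}} = {w. C.Z n w \<le> exp (real n * (C.p - \<delta>))}"
      proof (intro Collect_cong)
        fix w
        have "C.Z n w \<le> exp (real n * (C.p - \<delta>)) \<longleftrightarrow> ln (C.Z n w) \<le> real n * (C.p - \<delta>)"
          by (metis exp_ln ln_le_cancel_iff exp_gt_zero ln_exp Zrec_pos)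
        then show "ln (C.Z n w) / real n \<in> {..C.p - \<delta>} \<longleftrightarrow> C.Z n w \<le> exp (real n * (C.p - \<delta>))"
          using elim(2) by (simp add: pos_divide_le_eq mult.commute)
      qed
      then show ?case using elim(1) tail[of "{..C.p - \<delta>}" n] by simp
    qed
  qed
  have p: "free_energy M Y s t = C.p"
    unfolding free_energy_def
  proof (rule the_equality)
    show "AE \<omega> in M. (\<lambda>n. log_Z Y s t n \<omega> / real n) \<longlonglongrightarrow> C.p"
      using T.AE_limit unfolding X_def .
    show "c = C.p" if "AE \<omega> in M. (\<lambda>n. log_Z Y s t n \<omega> / real n) \<longlonglongrightarrow> c" for c
      by (rule T.AE_limit_unique) (use that in \<open>simp only: X_def\<close>)
  qed
  have rate: "rate_function \<mu> s t C.p = T.rate"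
  proof
    fix r show "rate_function \<mu> s t C.p r = T.rate r"
      using C.rate_function_eq[of r] by (auto simp: T.rate_def rate_function_def)
  qed
  have I_eq: "T.rate r = ereal (C.I r)" if "r \<ge> C.p" for r using that by (simp add: T.rate_def)
  have seq: "right_tail_seq M Y s t r \<longlonglongrightarrow> ereal (- C.I (max r C.p))" for r
  proof (rule Lim_transform_eventually[OF T.right_tail_limit])
    \<comment> \<open>The events agree once n is positive; at n = 0 the quotient in \<open>X\<close>
      is 0 by convention.\<close>
    show "eventually (\<lambda>n. scaled_log_prob M n {\<omega> \<in> space M. r \<le> X n \<omega>} = right_tail_seq M Y s t r n) sequentially"
      using eventually_gt_at_top[of 0]
    proof eventually_elim
      case (elim n)
      then have "{\<omega> \<in> space M. r \<le> X n \<omega>} = {\<omega> \<in> space M. log_Z Y s t n \<omega> \<ge> real n * r}"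
        by (auto simp: X_def field_simps)
      then show ?case by (simp add: right_tail_seq_def)
    qed
  qed
  have J: "right_tail_rate M Y s t r = ereal (C.I (max r C.p))" for r
    unfolding right_tail_rate_def using limI[OF seq[of r]] by simp
  have "satisfies_LDP M (\<lambda>n \<omega>. log_Z Y s t n \<omega> / real n) T.rate" using T.LDP unfolding X_def .
  moreover have "\<forall>r\<ge>C.p. \<bar>T.rate r\<bar> \<noteq> \<infinity>" by (simp add: I_eq)
  moreover have "strict_mono_on {C.p..} T.rate"
    by (rule strict_mono_onI) (auto simp: I_eq intro: C.I_strict_mono)
  moreover have "continuous_on {C.p..} T.rate"
  proof -
    have "continuous_on {C.p..} (\<lambda>r. ereal (C.I r))"
      by (intro continuous_on_ereal continuous_on_subset[OF C.I_continuous]) auto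
    then show ?thesis by (rule continuous_on_eq) (simp add: I_eq)
  qed
  moreover have "convex_on {C.p..} (\<lambda>r. real_of_ereal (T.rate r))"
  proof (rule convex_onI)
    fix u x y :: real assume u: "0 < u" "u < 1" and xy: "x \<in> {C.p..}" "y \<in> {C.p..}"
    have "(1 - u) *\<^sub>R x + u *\<^sub>R y \<in> {C.p..}"
      by (rule convexD_alt[OF _ xy]) (use u in \<open>auto intro: convex_real_interval\<close>)
    moreover have "C.I ((1 - u) *\<^sub>R x + u *\<^sub>R y) \<le> (1 - u) * C.I x + u * C.I y"
      using convex_onD[OF C.I_convex, of u x y] u by simp
    ultimately show "real_of_ereal (T.rate ((1 - u) *\<^sub>R x + u *\<^sub>R y)) \<le>
        (1 - u) * real_of_ereal (T.rate x) + u * real_of_ereal (T.rate y)"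
      using xy by (simp add: I_eq)
  qed (simp add: convex_real_interval)
  moreover have "\<forall>r. T.rate r = 0 \<longleftrightarrow> r = C.p"
    using C.I_pos C.I_p by (auto simp: T.rate_def less_le zero_ereal_def split: if_splits)
  moreover have "\<forall>r. convergent (right_tail_seq M Y s t r)" using seq by (auto simp: convergent_def)
  moreover have "\<forall>r\<le>C.p. right_tail_rate M Y s t r = 0" using C.I_p by (simp add: J max_absorb2)
  moreover have "\<forall>r\<ge>C.p. right_tail_rate M Y s t r = T.rate r" by (simp add: J I_eq max_absorb1)
  ultimately show ?thesis unfolding Let_def p rate by blast
qed

end
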